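(* Let $n\ge1$, $1\le c\le n$, $k\ge 2$, and let $(d_1,\dots,d_c)\in\mathbb{N}^c$ (positive integers) be such that each $d_i\neq 2$. Then for general $u\in U$, the set of algebraic $k$-bottlenecks of $V(F_u)$ is finite. In particular, for general $u\in U$, $\eta^{-1}(u)\setminus\Gamma_k$ is finite.
   Context: $P_i=\mathbb{P}^{N_i}$ with $N_i=\binom{d_i+n}{d_i}-1$ is the (complex) parameter space of hypersurfaces in $\mathbb{C}^n$ of degree at most $d_i$. Complete intersections in $\mathbb{C}^n$ of codimension $c$ and degree type $(d_1,\dots,d_c)$ are parameterized by an open subset $U\subseteq\prod_{i=1}^cP_i$. For $u\in U$, $F_u$ is the corresponding system of $c$ polynomials in $n$ variables (each determined up to scaling) and $X_u=V(F_u)\subseteq\mathbb{C}^n$ is the corresponding complete intersection. "General $u\in U$" means all $u$ in some nonempty Zariski open subset of $U$. For $x,z\in\mathbb{C}^n$, $d(x,z)^2=\sum_i(x_i-z_i)^2$ (no complex conjugation). For a system $F$ with $V(F)$ of codimension $c$ and Jacobian $JF$, the $k$-th bottleneck correspondence $B_k(F)\subseteq(\mathbb{C}^n)^k\times\mathbb{C}^k$ is the set of $(x_1,\dots,x_k,t_1,\dots,t_k)$ such that $\sum_{i=1}^k t_i=1$ and, with $z=\sum_{i=1}^k t_ix_i$: $d(x_1,z)^2=d(x_j,z)^2$ for $j=2,\dots,k$; and $F(x_i)=0$ and $\operatorname{rank}[\,x_i-z\ \ JF(x_i)^T]\le c$ for $i=1,\dots,k$. $\Gamma_k\subset(\mathbb{C}^n)^k\times\mathbb{C}^k$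 consists of all points where some $t_i=0$ or $\{x_1,\dots,x_k\}$ is affinely dependent. With $\rho_k(x_1,\dots,x_k,t_1,\dots,t_k)=\sum_i t_ix_i$, a point $z\in\mathbb{C}^n$ is an algebraic $k$-bottleneck of $V(F)$ if $z\in\rho_k(B_k(F)\setminus\Gamma_k)$. $S_k=\{(u,x_1,\dots,x_k,t_1,\dots,t_k)\in U\times(\mathbb{C}^n)^k\times\mathbb{C}^k:(x_1,\dots,x_k,t_1,\dots,t_k)\in B_k(F_u)\}$ and $\eta:S_k\to U$ is the projection; the fiber $\eta^{-1}(u)=\{u\}\times B_k(F_u)$ is identified with $B_k(F_u)$, so that $\eta^{-1}(u)\setminus\Gamma_k$ means $B_k(F_u)\setminus\Gamma_k$. *)

theory Defs
  imports "HOL-Analysis.Analysis" "HOL-Library.Poly_Mapping"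
begin

section \<open>Multivariate polynomials\<close>

type_synonym 'v monom = "'v \<Rightarrow>\<^sub>0 nat"
type_synonym 'v cpoly = "'v monom \<Rightarrow>\<^sub>0 complex"

definition monom_degree :: "'v monom \<Rightarrow> nat" where
  "monom_degree m = (\<Sum>v\<in>Poly_Mapping.keys m. Poly_Mapping.lookup m v)"

definition peval :: "'v cpoly \<Rightarrow> ('v \<Rightarrow> complex) \<Rightarrow> complex" where
  "peval f x =
    (\<Sum>m\<in>Poly_Mapping.keys f. Poly_Mapping.lookup f m *
      (\<Prod>v\<in>Poly_Mapping.keys m. x v ^ Poly_Mapping.lookup m v))"

definition degree_le :: "nat \<Rightarrow> 'v cpoly \<Rightarrow> bool" where
  "degree_le d f \<longleftrightarrow> (\<forall>m\<in>Poly_Mapping.keys f. monom_degree m \<le> d)"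

definition zero_locus :: "('c \<Rightarrow> ('n::finite) cpoly) \<Rightarrow> (complex ^ 'n) set" where
  "zero_locus F = {x. \<forall>i. peval (F i) (($) x) = 0}"

text \<open>The dimension \<open>n\<close> of the ambient space, the number \<open>c\<close> of equations and the number \<open>k\<close>
  of points are the cardinalities of the finite index types \<open>'n\<close>, \<open>'c\<close> and \<open>'k\<close>.\<close>

definition jacobian_matrix ::
  "(('c::finite) \<Rightarrow> ('n::finite) cpoly) \<Rightarrow> complex ^ 'n \<Rightarrow> complex ^ 'n ^ 'c" where
  "jacobian_matrix F x =
    (\<chi> i j. deriv (\<lambda>s. peval (F i) (($) (x + s *s axis j 1))) 0)"

section \<open>Dimension in the Zariski topology\<close>

definition zariski :: "(complex ^ 'n) topology" where
  "zariski = topology_generated_by {{x. peval f (($) x) \<noteq> 0} | f. True}"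

definition irreducible_closed :: "'a topology \<Rightarrow> 'a set \<Rightarrow> bool" where
  "irreducible_closed X Z \<longleftrightarrow> closedin X Z \<and> Z \<noteq> {} \<and>
    (\<forall>A B. closedin X A \<longrightarrow> closedin X B \<longrightarrow> Z = A \<union> B \<longrightarrow> Z = A \<or> Z = B)"

definition irreducible_chain :: "'a topology \<Rightarrow> nat \<Rightarrow> bool" where
  "irreducible_chain X m \<longleftrightarrow>
    (\<exists>Z. (\<forall>i\<le>m. irreducible_closed X (Z i)) \<and> (\<forall>i<m. Z i \<subset> Z (Suc i)))"

text \<open>The empty space contains no chain and therefore has no dimension.\<close>

definition has_krull_dim :: "'a topology \<Rightarrow> nat \<Rightarrow> bool" where
  "has_krull_dim X m \<longleftrightarrow> irreducible_chain X m \<and> (\<forall>l. irreducible_chain X l \<longrightarrow> l \<le> m)"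

definition has_codim :: "(complex ^ 'n) set \<Rightarrow> nat \<Rightarrow> bool" where
  "has_codim V c \<longleftrightarrow> (\<exists>m. has_krull_dim (subtopology zariski V) m \<and> m + c = CARD('n))"

definition complete_intersection :: "(('c::finite) \<Rightarrow> ('n::finite) cpoly) \<Rightarrow> bool" where
  "complete_intersection F \<longleftrightarrow> has_codim (zero_locus F) CARD('c)"

section \<open>The parameter space\<close>

text \<open>A point of projective space is represented by the punctured line of all nonzero multiples
  of a nonzero polynomial.\<close>

definition proj_point :: "'v cpoly \<Rightarrow> 'v cpoly set" where
  "proj_point f = {Poly_Mapping.map ((*) a) f | a. a \<noteq> 0}"

definition hypersurfaces :: "nat \<Rightarrow> 'v cpoly set set" where
  "hypersurfaces d = {proj_point f | f. f \<noteq> 0 \<and> degree_le d f}"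

definition param_space :: "('c \<Rightarrow> nat) \<Rightarrow> ('c \<Rightarrow> 'n cpoly set) set" where
  "param_space d = {u. \<forall>i. u i \<in> hypersurfaces (d i)}"

text \<open>The system of a parameter is determined only up to scaling of each equation; every notion
  applied to it below is invariant under such scaling.\<close>

definition system :: "('c \<Rightarrow> 'n cpoly set) \<Rightarrow> 'c \<Rightarrow> 'n cpoly" where
  "system u i = (SOME f. f \<in> u i)"

text \<open>The variable \<open>(i, m)\<close> is the homogeneous coordinate on the \<open>i\<close>-th factor given by the
  coefficient of the monomial \<open>m\<close>.\<close>

definition multihomogeneous :: "('c \<times> 'b) cpoly \<Rightarrow> bool" where
  "multihomogeneous g \<longleftrightarrow> (\<exists>e. \<forall>m\<in>Poly_Mapping.keys g. \<forall>i.
    (\<Sum>v\<in>{v\<in>Poly_Mapping.keys m. fst v = i}. Poly_Mapping.lookup m v) = e i)"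

definition homogeneous_coords :: "('c \<Rightarrow> 'n cpoly set) \<Rightarrow> 'c \<times> 'n monom \<Rightarrow> complex" where
  "homogeneous_coords u = (\<lambda>(i, m). Poly_Mapping.lookup (system u i) m)"

definition param_zariski :: "('c \<Rightarrow> nat) \<Rightarrow> ('c \<Rightarrow> 'n cpoly set) topology" where
  "param_zariski d = topology_generated_by
    {{u \<in> param_space d. peval g (homogeneous_coords u) \<noteq> 0} | g. multihomogeneous g}"

definition for_general :: "'a topology \<Rightarrow> 'a set \<Rightarrow> ('a \<Rightarrow> bool) \<Rightarrow> bool" where
  "for_general X U P \<longleftrightarrow>
    (\<exists>W. openin (subtopology X U) W \<and> W \<noteq> {} \<and> (\<forall>u\<in>W. P u))"

section \<open>Bottlenecks\<close>

definition sqdist :: "complex ^ 'n \<Rightarrow> complex ^ 'n \<Rightarrow> complex" where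
  "sqdist x z = (\<Sum>i\<in>UNIV. (x $ i - z $ i)\<^sup>2)"

definition rho :: "(complex ^ 'n ^ 'k) \<times> (complex ^ 'k) \<Rightarrow> complex ^ 'n" where
  "rho = (\<lambda>(x, t). \<Sum>i\<in>UNIV. (t $ i) *s (x $ i))"

text \<open>The column \<open>None\<close> is \<open>x - z\<close>, the column \<open>Some j\<close> is the gradient of \<open>F j\<close> at \<open>x\<close>.\<close>

definition augmented_jacobian ::
  "(('c::finite) \<Rightarrow> ('n::finite) cpoly) \<Rightarrow> complex ^ 'n \<Rightarrow> complex ^ 'n \<Rightarrow> complex ^ ('c option) ^ 'n" where
  "augmented_jacobian F x z =
    (\<chi> r s. case s of None \<Rightarrow> (x - z) $ r | Some j \<Rightarrow> transpose (jacobian_matrix F x) $ r $ j)"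

definition bottleneck_correspondence ::
  "(('c::finite) \<Rightarrow> ('n::finite) cpoly) \<Rightarrow> ((complex ^ 'n ^ 'k) \<times> (complex ^ 'k)) set" where
  "bottleneck_correspondence F =
    {(x, t). (\<Sum>i\<in>UNIV. t $ i) = 1 \<and>
      (let z = rho (x, t) in
        (\<forall>i j. sqdist (x $ i) z = sqdist (x $ j) z) \<and>
        (\<forall>i. x $ i \<in> zero_locus F \<and> rank (augmented_jacobian F (x $ i) z) \<le> CARD('c)))}"

text \<open>Affine dependence is over the complex numbers (\<^const>\<open>affine_dependent\<close> is over the reals)
  and is that of the family of points, so that coinciding points count as dependent.\<close>

definition complex_affine_dependent :: "complex ^ 'n ^ 'k \<Rightarrow> bool" where
  "complex_affine_dependent x \<longleftrightarrow>
    (\<exists>a :: complex ^ 'k. a \<noteq> 0 \<and> (\<Sum>i\<in>UNIV. a $ i) = 0 \<and> (\<Sum>i\<in>UNIV. (a $ i) *s (x $ i)) = 0)"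

definition degenerate_locus :: "((complex ^ 'n ^ 'k) \<times> (complex ^ 'k)) set" where
  "degenerate_locus = {(x, t). (\<exists>i. t $ i = 0) \<or> complex_affine_dependent x}"

text \<open>The index type \<open>'k\<close> does not occur in the set of bottlenecks and is passed as an argument.\<close>

definition algebraic_bottlenecks ::
  "('k::finite) itself \<Rightarrow> (('c::finite) \<Rightarrow> ('n::finite) cpoly) \<Rightarrow> (complex ^ 'n) set" where
  "algebraic_bottlenecks _ F =
    rho ` (bottleneck_correspondence F - (degenerate_locus :: ((complex ^ 'n ^ 'k) \<times> _) set))"

definition bottleneck_incidence ::
  "(('c::finite) \<Rightarrow> ('n::finite) cpoly set) set \<Rightarrow>
    (('c \<Rightarrow> 'n cpoly set) \<times> ((complex ^ 'n ^ 'k) \<times> (complex ^ 'k))) set" where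
  "bottleneck_incidence U = {(u, p). u \<in> U \<and> p \<in> bottleneck_correspondence (system u)}"

definition eta_fiber ::
  "(('c::finite) \<Rightarrow> ('n::finite) cpoly set) set \<Rightarrow> ('c \<Rightarrow> 'n cpoly set) \<Rightarrow>
    ((complex ^ 'n ^ 'k) \<times> (complex ^ 'k)) set" where
  "eta_fiber U u = snd ` {s \<in> bottleneck_incidence U. fst s = u}"

end

theory Submission
  imports Defs
begin

text \<open>The proof is a dimension count. A point of the fibre is a configuration of points \<open>x j\<close> and
  weights \<open>t j\<close>; together with the system \<open>F\<close> and a kernel vector \<open>w j\<close> of each augmented Jacobian it
  is a point of an incidence variety. If that variety has dimension at most the dimension of the
  space of systems, then each coordinate of a configuration satisfies a nontrivial algebraic relation
  over the coefficients of \<open>F\<close>, and so takes finitely many values for general \<open>F\<close>.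

  Dimension is measured by growth: \<open>growth_le S \<Psi> N\<close> says that on \<open>S\<close> the polynomial expressions of
  degree at most \<open>D\<close> in the functions \<open>\<Psi>\<close> span a space of dimension \<open>O((D + 1)\<^sup>N)\<close>. The bound \<open>N\<close> rises by one with a new function
  (\<open>growth_le_insert\<close>), does not rise with a root of a quadratic equation (\<open>growth_le_quadratic\<close>),
  and is compatible with cutting \<open>S\<close> into finitely many pieces (\<open>growth_le_Un\<close>). New functions
  subject to independent linear equations cost only the excess of unknowns over equations
  (\<open>growth_le_linear_system\<close>). A bound equal to the number of coefficients forces an algebraic
  relation (\<open>growth_le_imp_generically_finite\<close>).

  The count has three ingredients. The configurations with barycentre \<open>z\<close> at equal squared distance
  to all points have dimension \<open>k n\<close> (\<open>growth_le_equidistant\<close>); the multipliers \<open>w j\<close> add \<open>k c\<close> after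
  normalization. With these given, \<open>F i (x j) = 0\<close> and the kernel equations are linear in the
  coefficients of \<open>F\<close>, and they number \<open>k c + k n\<close>. They are independent because values and
  gradients of polynomials of degree at least three can be prescribed at affinely independent points
  (\<open>hermite_independent\<close>). For equations of degree one the gradient is constant, so only the values
  can be prescribed; this suffices since, for general equations of degree one, every kernel vector
  involves the gradient of some other equation (\<open>bottleneck_is_critical\<close>), on which the kernel
  equation can be imposed.

  The relations hold for representatives of the points of the parameter space. To obtain open
  subsets of a product of projective spaces one passes to a multihomogeneous component
  (\<open>generic_if_rescale_invariant\<close>), and finitely many nonempty open subsets have a common point
  (\<open>for_general_generic\<close>).\<close>

section \<open>Function families of bounded growth\<close>

text \<open>Polynomial expressions are treated as functions: this allows the family \<open>\<Psi>\<close> to grow during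
  the count without a change of the ring of formal polynomials.\<close>

inductive polyp :: "('s \<Rightarrow> complex) set \<Rightarrow> nat \<Rightarrow> ('s \<Rightarrow> complex) \<Rightarrow> bool"
  for \<Psi> :: "('s \<Rightarrow> complex) set" where
  const: "polyp \<Psi> D (\<lambda>_. a)"
| add: "polyp \<Psi> D f \<Longrightarrow> polyp \<Psi> D g \<Longrightarrow> polyp \<Psi> D (\<lambda>s. f s + g s)"
| gen_mult: "polyp \<Psi> D f \<Longrightarrow> g \<in> \<Psi> \<Longrightarrow> polyp \<Psi> (Suc D) (\<lambda>s. g s * f s)"
| weaken: "polyp \<Psi> D f \<Longrightarrow> polyp \<Psi> (Suc D) f"

definition polys :: "('s \<Rightarrow> complex) set \<Rightarrow> nat \<Rightarrow> ('s \<Rightarrow> complex) set" where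
  "polys \<Psi> D = {f. polyp \<Psi> D f}"

lemma polys_const: "(\<lambda>_. a) \<in> polys \<Psi> D"
  and polys_add: "f \<in> polys \<Psi> D \<Longrightarrow> g \<in> polys \<Psi> D \<Longrightarrow> (\<lambda>s. f s + g s) \<in> polys \<Psi> D"
  and polys_gen_mult: "f \<in> polys \<Psi> D \<Longrightarrow> h \<in> \<Psi> \<Longrightarrow> (\<lambda>s. h s * f s) \<in> polys \<Psi> (Suc D)"
  and polys_weaken: "f \<in> polys \<Psi> D \<Longrightarrow> f \<in> polys \<Psi> (Suc D)"
  unfolding polys_def by (auto intro: polyp.intros)

lemmas polys_intros = polys_const polys_add polys_gen_mult polys_weaken

lemma polys_induct [consumes 1, case_names const add gen_mult weaken, induct set: polys]:
  assumes "f \<in> polys \<Psi> D"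
    and "\<And>D a. P D (\<lambda>_. a)"
    and "\<And>D f g. f \<in> polys \<Psi> D \<Longrightarrow> P D f \<Longrightarrow> g \<in> polys \<Psi> D \<Longrightarrow> P D g \<Longrightarrow> P D (\<lambda>s. f s + g s)"
    and "\<And>D f g. f \<in> polys \<Psi> D \<Longrightarrow> P D f \<Longrightarrow> g \<in> \<Psi> \<Longrightarrow> P (Suc D) (\<lambda>s. g s * f s)"
    and "\<And>D f. f \<in> polys \<Psi> D \<Longrightarrow> P D f \<Longrightarrow> P (Suc D) f"
  shows "P D f"
proof -
  from assms(1) have "polyp \<Psi> D f" by (simp add: polys_def)
  then show ?thesis
    by induction (use assms(2-5) in \<open>auto simp: polys_def\<close>)
qed

lemma polys_mono_degree: "f \<in> polys \<Psi> D \<Longrightarrow> D \<le> D' \<Longrightarrow> f \<in> polys \<Psi> D'"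
  by (rotate_tac 1, induction rule: dec_induct) (auto intro: polys_weaken)

lemma polys_mono:
  assumes "f \<in> polys \<Psi> D" "\<Psi> \<subseteq> \<Phi>" shows "f \<in> polys \<Phi> D"
  using assms by induction (auto intro: polys_intros)

lemma polys_scale: "f \<in> polys \<Psi> D \<Longrightarrow> (\<lambda>s. a * f s) \<in> polys \<Psi> D"
proof (induction rule: polys_induct)
  case (add D f g)
  then show ?case by (simp add: distrib_left polys_add)
next
  case (gen_mult D f g)
  have "(\<lambda>s. g s * (a * f s)) \<in> polys \<Psi> (Suc D)"
    by (intro polys_gen_mult gen_mult)
  then show ?case by (simp add: mult.left_commute)
qed (auto intro: polys_intros)

lemma polys_mult:
  assumes "f \<in> polys \<Psi> D" "g \<in> polys \<Psi> E"
  shows "(\<lambda>s. f s * g s) \<in> polys \<Psi> (D + E)"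
  using assms
proof (induction rule: polys_induct)
  case (const D a)
  then show ?case by (auto intro: polys_scale polys_mono_degree)
next
  case (add D f1 f2)
  then show ?case by (simp add: distrib_right polys_add)
next
  case (gen_mult D f h)
  then show ?case
    using polys_gen_mult[of "\<lambda>s. f s * g s" \<Psi> "D + E" h] by (simp add: mult.assoc)
next
  case (weaken D f)
  then show ?case by (simp add: polys_weaken)
qed

lemma polys_sum:
  "(\<And>i. i \<in> A \<Longrightarrow> f i \<in> polys \<Psi> D) \<Longrightarrow> (\<lambda>s. \<Sum>i\<in>A. f i s) \<in> polys \<Psi> D"
  by (induction A rule: infinite_finite_induct) (auto intro: polys_intros)

lemma polys_gen: "f \<in> \<Psi> \<Longrightarrow> f \<in> polys \<Psi> 1"
  using polys_gen_mult[OF polys_const[of 1 \<Psi> 0], of f] by simp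

lemma polys_power: "f \<in> polys \<Psi> D \<Longrightarrow> (\<lambda>s. f s ^ e) \<in> polys \<Psi> (e * D)"
  by (induction e) (auto intro: polys_const polys_mult)

definition alg :: "('s \<Rightarrow> complex) set \<Rightarrow> ('s \<Rightarrow> complex) set" where
  "alg \<Psi> = (\<Union>D. polys \<Psi> D)"

lemma alg_const [intro]: "(\<lambda>_. a) \<in> alg \<Psi>"
  by (auto simp: alg_def intro: polys_const)

lemma alg_gen: "f \<in> \<Psi> \<Longrightarrow> f \<in> alg \<Psi>"
  unfolding alg_def using polys_gen by blast

lemma alg_add [intro]: "f \<in> alg \<Psi> \<Longrightarrow> g \<in> alg \<Psi> \<Longrightarrow> (\<lambda>s. f s + g s) \<in> alg \<Psi>"
  unfolding alg_def by (auto intro!: polys_add elim: polys_mono_degree[OF _ max.cobounded1]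
      polys_mono_degree[OF _ max.cobounded2])

lemma alg_mult [intro]: "f \<in> alg \<Psi> \<Longrightarrow> g \<in> alg \<Psi> \<Longrightarrow> (\<lambda>s. f s * g s) \<in> alg \<Psi>"
  unfolding alg_def by (auto dest: polys_mult)

lemma alg_diff [intro]: "f \<in> alg \<Psi> \<Longrightarrow> g \<in> alg \<Psi> \<Longrightarrow> (\<lambda>s. f s - g s) \<in> alg \<Psi>"
  using alg_add[of f \<Psi> "\<lambda>s. - 1 * g s"] alg_mult[of "\<lambda>_. -1" \<Psi> g] by auto

lemma alg_uminus [intro]: "f \<in> alg \<Psi> \<Longrightarrow> (\<lambda>s. - f s) \<in> alg \<Psi>"
  using alg_diff[of "\<lambda>_. 0" \<Psi> f] by auto

lemma alg_power [intro]: "f \<in> alg \<Psi> \<Longrightarrow> (\<lambda>s. f s ^ e) \<in> alg \<Psi>"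
  by (induction e) auto

lemma alg_sum [intro]: "(\<And>i. i \<in> A \<Longrightarrow> f i \<in> alg \<Psi>) \<Longrightarrow> (\<lambda>s. \<Sum>i\<in>A. f i s) \<in> alg \<Psi>"
  by (induction A rule: infinite_finite_induct) auto

lemma alg_prod [intro]: "(\<And>i. i \<in> A \<Longrightarrow> f i \<in> alg \<Psi>) \<Longrightarrow> (\<lambda>s. \<Prod>i\<in>A. f i s) \<in> alg \<Psi>"
  by (induction A rule: infinite_finite_induct) auto

lemma alg_mono: "f \<in> alg \<Psi> \<Longrightarrow> \<Psi> \<subseteq> \<Phi> \<Longrightarrow> f \<in> alg \<Phi>"
  unfolding alg_def using polys_mono by blast

definition in_span :: "'s set \<Rightarrow> ('s \<Rightarrow> complex) set \<Rightarrow> ('s \<Rightarrow> complex) \<Rightarrow> bool" where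
  "in_span S G f \<longleftrightarrow> (\<exists>a. \<forall>s\<in>S. f s = (\<Sum>g\<in>G. a g * g s))"

lemma in_spanI_gen: "g \<in> G \<Longrightarrow> finite G \<Longrightarrow> in_span S G g"
  unfolding in_span_def by (rule exI[of _ "\<lambda>h. if h = g then 1 else 0"]) (simp add: if_distrib[of "\<lambda>x. x * _"] cong: if_cong)

lemma in_span_add: "in_span S G f \<Longrightarrow> in_span S G g \<Longrightarrow> in_span S G (\<lambda>s. f s + g s)"
  unfolding in_span_def
  by (elim exE, rename_tac a b, rule_tac x="\<lambda>g. a g + b g" in exI)
    (simp add: distrib_right sum.distrib)

lemma in_span_scale: "in_span S G f \<Longrightarrow> in_span S G (\<lambda>s. c * f s)"
  unfolding in_span_def
  by (elim exE, rename_tac a, rule_tac x="\<lambda>g. c * a g" in exI)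
    (simp add: mult.assoc sum_distrib_left)

lemma in_span_sum: "(\<And>i. i \<in> A \<Longrightarrow> in_span S G (f i)) \<Longrightarrow> in_span S G (\<lambda>s. \<Sum>i\<in>A. f i s)"
proof (induction A rule: infinite_finite_induct)
  case (insert i A)
  then show ?case by (simp add: in_span_add)
qed (auto simp: in_span_def intro: exI[of _ "\<lambda>_. 0"])

lemma in_span_cong: "in_span S G f \<Longrightarrow> (\<And>s. s \<in> S \<Longrightarrow> f s = g s) \<Longrightarrow> in_span S G g"
  unfolding in_span_def by metis

lemma in_span_trans:
  assumes "in_span S G f" "\<And>g. g \<in> G \<Longrightarrow> in_span S H g" shows "in_span S H f"
proof -
  obtain a where a: "\<forall>s\<in>S. f s = (\<Sum>g\<in>G. a g * g s)" using assms(1) by (auto simp: in_span_def)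
  have "in_span S H (\<lambda>s. \<Sum>g\<in>G. a g * g s)"
    by (intro in_span_sum in_span_scale assms(2))
  then show ?thesis by (rule in_span_cong) (use a in auto)
qed

lemma in_span_mult:
  assumes "in_span S G f" "finite G"
  shows "in_span S ((\<lambda>g s. h s * g s) ` G) (\<lambda>s. h s * f s)"
proof -
  obtain a where a: "\<forall>s\<in>S. f s = (\<Sum>g\<in>G. a g * g s)" using assms(1) by (auto simp: in_span_def)
  have "in_span S ((\<lambda>g s. h s * g s) ` G) (\<lambda>s. \<Sum>g\<in>G. a g * (h s * g s))"
    by (intro in_span_sum in_span_scale in_spanI_gen imageI finite_imageI assms(2))
  then show ?thesis
    by (rule in_span_cong) (use a in \<open>auto simp: sum_distrib_left mult.left_commute\<close>)
qed

lemma in_span_superset: "in_span S G f \<Longrightarrow> G \<subseteq> H \<Longrightarrow> finite H \<Longrightarrow> in_span S H f"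
  by (rule in_span_trans) (auto intro: in_spanI_gen)

text \<open>The spanning functions are arbitrary, not polynomial in \<open>\<Psi>\<close>. They may thus contain
  denominators or be supported on a part of \<open>S\<close>.\<close>

definition growth_le :: "'s set \<Rightarrow> ('s \<Rightarrow> complex) set \<Rightarrow> nat \<Rightarrow> bool" where
  "growth_le S \<Psi> N \<longleftrightarrow> (\<exists>C. \<forall>D. \<exists>G. finite G \<and> card G \<le> C * (D + 1) ^ N \<and>
      (\<forall>f\<in>polys \<Psi> D. in_span S G f))"

lemma growth_le_empty: "growth_le S {} 0"
proof -
  have "in_span S {\<lambda>_. 1} f" if "f \<in> polys {} D" for f D
    using that
  proof induction
    case (const D a)
    show ?case using in_span_scale[OF in_spanI_gen[of "\<lambda>_. 1" "{\<lambda>_. 1}" S], of a] by simp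
  qed (auto intro: in_span_add)
  then show ?thesis unfolding growth_le_def
    by (intro exI[of _ 1] allI exI[of _ "{\<lambda>_. 1}"]) auto
qed

lemma growth_le_subset: "growth_le S \<Psi> N \<Longrightarrow> \<Phi> \<subseteq> \<Psi> \<Longrightarrow> growth_le S \<Phi> N"
  unfolding growth_le_def by (meson polys_mono)

lemma growth_le_mono:
  assumes "growth_le S \<Psi> N" "N \<le> M" shows "growth_le S \<Psi> M"
proof -
  obtain C where C: "\<And>D. \<exists>G. finite G \<and> card G \<le> C * (D + 1) ^ N \<and> (\<forall>f\<in>polys \<Psi> D. in_span S G f)"
    using assms(1) by (auto simp: growth_le_def)
  have "C * (D + 1) ^ N \<le> C * (D + 1) ^ M" for D
    using assms(2) by (simp add: power_increasing)
  then show ?thesis unfolding growth_le_def using C by (meson le_trans)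
qed

text \<open>Cutting the domain into finitely many pieces does not change the growth. All case
  distinctions of the argument rest on this.\<close>

lemma growth_le_Un:
  assumes "growth_le S \<Psi> N" "growth_le T \<Psi> N" shows "growth_le (S \<union> T) \<Psi> N"
proof -
  obtain C where C: "\<And>D. \<exists>G. finite G \<and> card G \<le> C * (D + 1) ^ N \<and> (\<forall>f\<in>polys \<Psi> D. in_span S G f)"
    using assms(1) by (auto simp: growth_le_def)
  obtain C' where C': "\<And>D. \<exists>G. finite G \<and> card G \<le> C' * (D + 1) ^ N \<and> (\<forall>f\<in>polys \<Psi> D. in_span T G f)"
    using assms(2) by (auto simp: growth_le_def)
  have "\<exists>G. finite G \<and> card G \<le> (C + C') * (D + 1) ^ N \<and> (\<forall>f\<in>polys \<Psi> D. in_span (S \<union> T) G f)" for D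
  proof -
    obtain G where G: "finite G" "card G \<le> C * (D + 1) ^ N" "\<forall>f\<in>polys \<Psi> D. in_span S G f"
      using C by blast
    obtain H where H: "finite H" "card H \<le> C' * (D + 1) ^ N" "\<forall>f\<in>polys \<Psi> D. in_span T H f"
      using C' by blast
    let ?i = "\<lambda>s. if s \<in> S then 1 else (0::complex)" and ?j = "\<lambda>s. if s \<in> S then 0 else (1::complex)"
    let ?G = "(\<lambda>g s. ?i s * g s) ` G" and ?H = "(\<lambda>g s. ?j s * g s) ` H"
    have "in_span (S \<union> T) (?G \<union> ?H) f" if f: "f \<in> polys \<Psi> D" for f
    proof -
      have "in_span (S \<union> T) ?G (\<lambda>s. ?i s * f s)"
      proof -
        obtain a where a: "\<forall>s\<in>S. f s = (\<Sum>g\<in>G. a g * g s)" using G(3) f by (auto simp: in_span_def)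
        have "in_span (S \<union> T) ?G (\<lambda>s. \<Sum>g\<in>G. a g * (?i s * g s))"
          by (intro in_span_sum in_span_scale in_spanI_gen imageI finite_imageI G)
        then show ?thesis
          by (rule in_span_cong) (use a in auto)
      qed
      moreover have "in_span (S \<union> T) ?H (\<lambda>s. ?j s * f s)"
      proof -
        obtain a where a: "\<forall>s\<in>T. f s = (\<Sum>g\<in>H. a g * g s)" using H(3) f by (auto simp: in_span_def)
        have "in_span (S \<union> T) ?H (\<lambda>s. \<Sum>g\<in>H. a g * (?j s * g s))"
          by (intro in_span_sum in_span_scale in_spanI_gen imageI finite_imageI H)
        then show ?thesis
          by (rule in_span_cong) (use a in auto)
      qed
      ultimately have "in_span (S \<union> T) (?G \<union> ?H) (\<lambda>s. ?i s * f s + ?j s * f s)"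
        using G(1) H(1) by (intro in_span_add) (auto intro: in_span_superset)
      then show ?thesis by (rule in_span_cong) auto
    qed
    moreover have "card (?G \<union> ?H) \<le> (C + C') * (D + 1) ^ N"
    proof -
      have "card (?G \<union> ?H) \<le> card ?G + card ?H" by (rule card_Un_le)
      also have "\<dots> \<le> card G + card H" by (intro add_mono card_image_le G H)
      also have "\<dots> \<le> (C + C') * (D + 1) ^ N" using G(2) H(2) by (simp only: distrib_right add_mono)
      finally show ?thesis .
    qed
    ultimately show ?thesis using G(1) H(1) by (intro exI[of _ "?G \<union> ?H"]) auto
  qed
  then show ?thesis unfolding growth_le_def by blast
qed

lemma growth_le_on_empty: "growth_le {} \<Psi> N"
  unfolding growth_le_def in_span_def by (intro exI[of _ 0] allI exI[of _ "{}"]) auto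

lemma growth_le_UN:
  "finite I \<Longrightarrow> (\<And>i. i \<in> I \<Longrightarrow> growth_le (S i) \<Psi> N) \<Longrightarrow> growth_le (\<Union>i\<in>I. S i) \<Psi> N"
  by (induction I rule: finite_induct) (auto intro: growth_le_Un growth_le_on_empty)

lemma growth_le_on_subset:
  assumes "growth_le S \<Psi> N" "T \<subseteq> S" shows "growth_le T \<Psi> N"
proof -
  have "in_span S G f \<Longrightarrow> in_span T G f" for G f
    unfolding in_span_def using assms(2) by (meson subsetD)
  then show ?thesis using assms(1) unfolding growth_le_def by meson
qed

lemma polys_insert:
  assumes "f \<in> polys (insert h \<Psi>) D"
  shows "\<exists>p. (\<forall>e\<le>D. p e \<in> polys \<Psi> D) \<and> (\<forall>s. f s = (\<Sum>e\<le>D. p e s * h s ^ e))"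
  using assms
proof induction
  case (const D a)
  have "(\<Sum>e\<le>D. (if e = 0 then a else 0) * h s ^ e) = a" for s
    by (simp add: if_distrib[of "\<lambda>x. x * _"] cong: if_cong)
  then show ?case
    by (intro exI[of _ "\<lambda>e _. if e = 0 then a else 0"]) (auto intro: polys_const)
next
  case (add D f g)
  then obtain p q where "\<forall>e\<le>D. p e \<in> polys \<Psi> D" "\<forall>s. f s = (\<Sum>e\<le>D. p e s * h s ^ e)"
    "\<forall>e\<le>D. q e \<in> polys \<Psi> D" "\<forall>s. g s = (\<Sum>e\<le>D. q e s * h s ^ e)" by blast
  then show ?case
    by (intro exI[of _ "\<lambda>e s. p e s + q e s"]) (auto simp: distrib_right sum.distrib intro: polys_add)
next
  case (gen_mult D f g)
  then obtain p where p: "\<forall>e\<le>D. p e \<in> polys \<Psi> D" "\<forall>s. f s = (\<Sum>e\<le>D. p e s * h s ^ e)" by blast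
  show ?case
  proof (cases "g = h")
    case True
    have "(\<Sum>e\<le>Suc D. (if e = 0 then 0 else p (e - 1) s) * h s ^ e) = h s * f s" for s
      by (subst sum.atMost_Suc_shift) (simp add: p(2) sum_distrib_left mult_ac)
    moreover have "(\<lambda>s. if e = 0 then 0 else p (e - 1) s) \<in> polys \<Psi> (Suc D)" if "e \<le> Suc D" for e
      using p(1) that by (cases e) (auto intro: polys_const polys_weaken)
    ultimately show ?thesis using True
      by (intro exI[of _ "\<lambda>e s. if e = 0 then 0 else p (e - 1) s"]) auto
  next
    case False
    then have g: "g \<in> \<Psi>" using gen_mult by auto
    have "(\<Sum>e\<le>Suc D. (if e = Suc D then 0 else g s * p e s) * h s ^ e) = g s * f s" for s
      by (simp add: p(2) sum_distrib_left mult_ac)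
    moreover have "(\<lambda>s. if e = Suc D then 0 else g s * p e s) \<in> polys \<Psi> (Suc D)" if "e \<le> Suc D" for e
      using p(1) that g by (cases "e = Suc D") (auto intro: polys_const polys_gen_mult)
    ultimately show ?thesis
      by (intro exI[of _ "\<lambda>e s. if e = Suc D then 0 else g s * p e s"]) auto
  qed
next
  case (weaken D f)
  then obtain p where p: "\<forall>e\<le>D. p e \<in> polys \<Psi> D" "\<forall>s. f s = (\<Sum>e\<le>D. p e s * h s ^ e)" by blast
  have "(\<lambda>s. if e = Suc D then 0 else p e s) \<in> polys \<Psi> (Suc D)" if "e \<le> Suc D" for e
    using p(1) that by (cases "e = Suc D") (auto intro: polys_const polys_weaken)
  then show ?case
    by (intro exI[of _ "\<lambda>e s. if e = Suc D then 0 else p e s"]) (auto simp: p(2))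
qed

lemma growth_le_insert:
  assumes "growth_le S \<Psi> N" shows "growth_le S (insert h \<Psi>) (N + 1)"
proof -
  obtain C where C: "\<And>D. \<exists>G. finite G \<and> card G \<le> C * (D + 1) ^ N \<and> (\<forall>f\<in>polys \<Psi> D. in_span S G f)"
    using assms(1) by (auto simp: growth_le_def)
  have "\<exists>G. finite G \<and> card G \<le> C * (D + 1) ^ (N + 1) \<and> (\<forall>f\<in>polys (insert h \<Psi>) D. in_span S G f)" for D
  proof -
    obtain G where G: "finite G" "card G \<le> C * (D + 1) ^ N" "\<forall>f\<in>polys \<Psi> D. in_span S G f"
      using C by blast
    let ?H = "\<Union>e\<le>D. (\<lambda>g s. h s ^ e * g s) ` G"
    have "in_span S ?H f" if f: "f \<in> polys (insert h \<Psi>) D" for f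
    proof -
      obtain p where p: "\<forall>e\<le>D. p e \<in> polys \<Psi> D" "\<forall>s. f s = (\<Sum>e\<le>D. p e s * h s ^ e)"
        using polys_insert[OF f] by blast
      have "in_span S ?H (\<lambda>s. \<Sum>e\<le>D. h s ^ e * p e s)"
      proof (intro in_span_sum)
        fix e assume e: "e \<in> {..D}"
        have "in_span S ((\<lambda>g s. h s ^ e * g s) ` G) (\<lambda>s. h s ^ e * p e s)"
          using p e G by (intro in_span_mult) auto
        then show "in_span S ?H (\<lambda>s. h s ^ e * p e s)"
          using e G(1) by (auto elim!: in_span_superset)
      qed
      then show ?thesis by (rule in_span_cong) (simp add: p(2) mult.commute)
    qed
    moreover have "card ?H \<le> C * (D + 1) ^ (N + 1)"
    proof -
      have "card ?H \<le> (\<Sum>e\<le>D. card ((\<lambda>g s. h s ^ e * g s) ` G))" by (rule card_UN_le) simp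
      also have "\<dots> \<le> (\<Sum>e\<le>D. C * (D + 1) ^ N)"
        by (intro sum_mono order_trans[OF card_image_le[OF G(1)] G(2)])
      finally show ?thesis by (simp add: algebra_simps)
    qed
    ultimately show ?thesis using G(1) by (intro exI[of _ ?H]) auto
  qed
  then show ?thesis unfolding growth_le_def by blast
qed

lemma growth_le_insert_many:
  assumes "finite A" "growth_le S \<Psi> N" shows "growth_le S (\<Psi> \<union> f ` A) (N + card A)"
  using assms
proof (induction A rule: finite_induct)
  case (insert x A)
  then show ?case using growth_le_insert[of S "\<Psi> \<union> f ` A" "N + card A" "f x"] by simp
qed simp

text \<open>A function that satisfies a quadratic equation over the family is free: after multiplication
  by a power of the leading coefficient, its powers reduce to degree one, and division by that
  coefficient is harmless because the spanning functions are arbitrary.\<close>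

lemma growth_le_quadratic:
  assumes growth: "growth_le S \<Psi> N"
    and alg: "a \<in> alg \<Psi>" "b \<in> alg \<Psi>" "c \<in> alg \<Psi>"
    and eq: "\<And>s. s \<in> S \<Longrightarrow> a s \<noteq> 0" "\<And>s. s \<in> S \<Longrightarrow> a s * h s ^ 2 = b s + c s * h s"
  shows "growth_le S (insert h \<Psi>) N"
proof -
  obtain da db dc where d: "a \<in> polys \<Psi> da" "b \<in> polys \<Psi> db" "c \<in> polys \<Psi> dc"
    using alg by (auto simp: alg_def)
  define \<delta> where "\<delta> = da + db + dc"
  have \<delta>: "a \<in> polys \<Psi> \<delta>" "b \<in> polys \<Psi> \<delta>" "c \<in> polys \<Psi> \<delta>"
    using d by (auto simp: \<delta>_def elim!: polys_mono_degree)
  have reduce: "\<exists>P Q. P \<in> polys \<Psi> (e * \<delta>) \<and> Q \<in> polys \<Psi> (e * \<delta>) \<and>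
      (\<forall>s\<in>S. a s ^ e * h s ^ (Suc e) = P s + Q s * h s)" for e
  proof (induction e)
    case 0
    show ?case by (intro exI[of _ "\<lambda>_. 0"] exI[of _ "\<lambda>_. 1"]) (auto intro: polys_const)
  next
    case (Suc e)
    then obtain P Q where PQ: "P \<in> polys \<Psi> (e * \<delta>)" "Q \<in> polys \<Psi> (e * \<delta>)"
      "\<forall>s\<in>S. a s ^ e * h s ^ (Suc e) = P s + Q s * h s" by blast
    have "(\<lambda>s. b s * Q s) \<in> polys \<Psi> (Suc e * \<delta>)" "(\<lambda>s. a s * P s + c s * Q s) \<in> polys \<Psi> (Suc e * \<delta>)"
      using PQ(1,2) \<delta> by (auto intro!: polys_add polys_mult)
    moreover have "a s ^ Suc e * h s ^ Suc (Suc e) = b s * Q s + (a s * P s + c s * Q s) * h s"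
      if s: "s \<in> S" for s
    proof -
      have "a s ^ Suc e * h s ^ Suc (Suc e) = a s * h s * (a s ^ e * h s ^ Suc e)" by simp
      also have "\<dots> = a s * P s * h s + Q s * (a s * h s ^ 2)"
        using PQ(3) s by (simp add: algebra_simps power2_eq_square)
      also have "\<dots> = b s * Q s + (a s * P s + c s * Q s) * h s"
        using eq(2)[OF s] by (simp add: algebra_simps)
      finally show ?thesis .
    qed
    ultimately show ?case by blast
  qed
  obtain C where C: "\<And>D. \<exists>G. finite G \<and> card G \<le> C * (D + 1) ^ N \<and> (\<forall>f\<in>polys \<Psi> D. in_span S G f)"
    using growth by (auto simp: growth_le_def)
  define C' where "C' = 2 * C * (1 + \<delta>) ^ N"
  have "\<exists>G. finite G \<and> card G \<le> C' * (D + 1) ^ N \<and> (\<forall>f\<in>polys (insert h \<Psi>) D. in_span S G f)" for D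
  proof -
    \<comment> \<open>Degree \<open>D\<close> from the coefficients \<open>p e\<close>, and \<open>D * \<delta>\<close> from reducing \<open>a s ^ D * h s ^ e\<close>.\<close>
    define D' where "D' = D + D * \<delta>"
    obtain G where G: "finite G" "card G \<le> C * (D' + 1) ^ N" "\<forall>f\<in>polys \<Psi> D'. in_span S G f"
      using C by blast
    let ?G = "(\<lambda>g s. (1 / a s ^ D) * g s) ` G" and ?H = "(\<lambda>g s. (h s / a s ^ D) * g s) ` G"
    have "in_span S (?G \<union> ?H) f" if f: "f \<in> polys (insert h \<Psi>) D" for f
    proof -
      obtain p where p: "\<forall>e\<le>D. p e \<in> polys \<Psi> D" "\<forall>s. f s = (\<Sum>e\<le>D. p e s * h s ^ e)"
        using polys_insert[OF f] by blast
      have "\<exists>P Q. P \<in> polys \<Psi> (D * \<delta>) \<and> Q \<in> polys \<Psi> (D * \<delta>) \<and>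
          (\<forall>s\<in>S. a s ^ D * h s ^ e = P s + Q s * h s)" if e: "e \<le> D" for e
      proof (cases e)
        case 0
        show ?thesis using 0 polys_power[OF \<delta>(1), of D]
          by (intro exI[of _ "\<lambda>s. a s ^ D"] exI[of _ "\<lambda>_. 0"]) (auto intro: polys_const)
      next
        case (Suc e')
        obtain P Q where PQ: "P \<in> polys \<Psi> (e' * \<delta>)" "Q \<in> polys \<Psi> (e' * \<delta>)"
          "\<forall>s\<in>S. a s ^ e' * h s ^ (Suc e') = P s + Q s * h s" using reduce by blast
        have D: "D * \<delta> = (D - e') * \<delta> + e' * \<delta>" using e Suc by (simp flip: distrib_right)
        have "a s ^ D * h s ^ e = a s ^ (D - e') * P s + a s ^ (D - e') * Q s * h s" if "s \<in> S" for s
        proof -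
          have "a s ^ D = a s ^ (D - e') * a s ^ e'" using e Suc by (simp flip: power_add)
          then have "a s ^ D * h s ^ e = a s ^ (D - e') * (a s ^ e' * h s ^ Suc e')" using Suc by simp
          also have "\<dots> = a s ^ (D - e') * (P s + Q s * h s)" using PQ(3) that by simp
          finally show ?thesis by (simp add: algebra_simps)
        qed
        then show ?thesis using PQ(1,2)
          by (intro exI[of _ "\<lambda>s. a s ^ (D - e') * P s"] exI[of _ "\<lambda>s. a s ^ (D - e') * Q s"])
            (auto simp: D intro!: polys_mult polys_power \<delta>)
      qed
      then obtain P Q where PQ: "\<And>e. e \<le> D \<Longrightarrow> P e \<in> polys \<Psi> (D * \<delta>)"
        "\<And>e. e \<le> D \<Longrightarrow> Q e \<in> polys \<Psi> (D * \<delta>)"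
        "\<And>e s. e \<le> D \<Longrightarrow> s \<in> S \<Longrightarrow> a s ^ D * h s ^ e = P e s + Q e s * h s" by metis
      have "in_span S G (\<lambda>s. \<Sum>e\<le>D. p e s * P e s)" "in_span S G (\<lambda>s. \<Sum>e\<le>D. p e s * Q e s)"
        using PQ p G(3) by (auto simp: D'_def intro!: polys_sum polys_mult)
      then have "in_span S ?G (\<lambda>s. (1 / a s ^ D) * (\<Sum>e\<le>D. p e s * P e s))"
        "in_span S ?H (\<lambda>s. (h s / a s ^ D) * (\<Sum>e\<le>D. p e s * Q e s))"
        using G(1) by - (rule in_span_mult; assumption)+
      then have "in_span S (?G \<union> ?H)
          (\<lambda>s. (1 / a s ^ D) * (\<Sum>e\<le>D. p e s * P e s) + (h s / a s ^ D) * (\<Sum>e\<le>D. p e s * Q e s))"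
        using G(1) by (intro in_span_add) (auto elim!: in_span_superset)
      then show ?thesis
      proof (rule in_span_cong)
        fix s assume s: "s \<in> S"
        have "a s ^ D * f s = (\<Sum>e\<le>D. p e s * (a s ^ D * h s ^ e))"
          by (simp add: p(2) sum_distrib_left mult_ac)
        also have "\<dots> = (\<Sum>e\<le>D. p e s * (P e s + Q e s * h s))"
          using PQ(3) s by (intro sum.cong) auto
        also have "\<dots> = (\<Sum>e\<le>D. p e s * P e s) + h s * (\<Sum>e\<le>D. p e s * Q e s)"
          by (simp add: sum_distrib_left sum.distrib algebra_simps)
        finally show "(1 / a s ^ D) * (\<Sum>e\<le>D. p e s * P e s) + (h s / a s ^ D) * (\<Sum>e\<le>D. p e s * Q e s) = f s"
          using eq(1)[OF s] by (simp add: field_simps)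
      qed
    qed
    moreover have "card (?G \<union> ?H) \<le> C' * (D + 1) ^ N"
    proof -
      have "card (?G \<union> ?H) \<le> card G + card G"
        by (intro order_trans[OF card_Un_le] add_mono card_image_le G)
      also have "\<dots> \<le> 2 * C * (D' + 1) ^ N" using G(2) by simp
      also have "D' + 1 \<le> (1 + \<delta>) * (D + 1)" by (simp add: D'_def)
      then have "2 * C * (D' + 1) ^ N \<le> 2 * C * ((1 + \<delta>) * (D + 1)) ^ N"
        by (intro mult_left_mono power_mono) auto
      also have "\<dots> = C' * (D + 1) ^ N" by (simp only: C'_def power_mult_distrib mult.assoc)
      finally show ?thesis .
    qed
    ultimately show ?thesis using G(1) by (intro exI[of _ "?G \<union> ?H"]) auto
  qed
  then show ?thesis unfolding growth_le_def by blast
qed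

lemma growth_le_rational:
  assumes "growth_le S \<Psi> N" "a \<in> alg \<Psi>" "b \<in> alg \<Psi>"
    and "\<And>s. s \<in> S \<Longrightarrow> a s \<noteq> 0" "\<And>s. s \<in> S \<Longrightarrow> a s * h s = b s"
  shows "growth_le S (insert h \<Psi>) N"
proof (rule growth_le_quadratic[where b="\<lambda>_. 0" and c=b])
  fix s assume "s \<in> S"
  with assms(5)[of s] show "a s * h s ^ 2 = 0 + b s * h s" by (simp add: power2_eq_square flip: mult.assoc)
qed (use assms in auto)

lemma growth_le_rational_many:
  assumes "finite A" "growth_le S \<Psi> N"
    and "\<And>i. i \<in> A \<Longrightarrow> \<exists>a\<in>alg \<Psi>. \<exists>b\<in>alg \<Psi>. \<forall>s\<in>S. a s \<noteq> 0 \<and> a s * f i s = b s"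
  shows "growth_le S (\<Psi> \<union> f ` A) N"
  using assms
proof (induction A rule: finite_induct)
  case (insert x A)
  then have IH: "growth_le S (\<Psi> \<union> f ` A) N" by auto
  obtain a b where "a \<in> alg \<Psi>" "b \<in> alg \<Psi>" "\<forall>s\<in>S. a s \<noteq> 0 \<and> a s * f x s = b s"
    using insert.prems(2)[of x] by blast
  then have "growth_le S (insert (f x) (\<Psi> \<union> f ` A)) N"
    by (intro growth_le_rational[OF IH, of a b]) (auto elim: alg_mono)
  then show ?case by simp
qed simp

lemma growth_le_alg:
  assumes "growth_le S \<Psi> N" "finite \<Phi>" "\<And>f. f \<in> \<Phi> \<Longrightarrow> \<exists>g\<in>alg \<Psi>. \<forall>s\<in>S. f s = g s"
  shows "growth_le S (\<Psi> \<union> \<Phi>) N"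
  using growth_le_rational_many[of \<Phi> S \<Psi> N "\<lambda>f. f"] assms
  by (simp add: image_ident) (metis alg_const mult_1 zero_neq_one)

section \<open>Solving linear systems\<close>

text \<open>Each independent linear condition on new functions saves one dimension. The proof is Gaussian
  elimination, with the domain cut according to the position of the pivot.\<close>

lemma growth_le_linear_system:
  assumes "finite R" "finite V" "growth_le S \<Psi> N"
    and "\<And>\<rho> v. \<rho> \<in> R \<Longrightarrow> v \<in> V \<Longrightarrow> A \<rho> v \<in> alg \<Psi>" "\<And>\<rho>. \<rho> \<in> R \<Longrightarrow> b \<rho> \<in> alg \<Psi>"
    and "\<And>\<rho> s. \<rho> \<in> R \<Longrightarrow> s \<in> S \<Longrightarrow> (\<Sum>v\<in>V. A \<rho> v s * f v s) = b \<rho> s"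
    and "\<And>s l \<rho>. s \<in> S \<Longrightarrow> (\<And>v. v \<in> V \<Longrightarrow> (\<Sum>\<rho>\<in>R. l \<rho> * A \<rho> v s) = 0) \<Longrightarrow> \<rho> \<in> R \<Longrightarrow> l \<rho> = (0::complex)"
    and "N + card V \<le> M + card R"
  shows "growth_le S (\<Psi> \<union> f ` V) M"
  using assms
proof (induction R arbitrary: V S A b rule: finite_induct)
  case empty
  then show ?case by (auto intro: growth_le_mono growth_le_insert_many)
next
  case (insert \<sigma> R)
  let ?S = "\<lambda>v. {s \<in> S. A \<sigma> v s \<noteq> 0}"
  have "S \<subseteq> (\<Union>v\<in>V. ?S v)"
  proof
    fix s assume s: "s \<in> S"
    have "\<exists>v\<in>V. A \<sigma> v s \<noteq> 0"
    proof (rule ccontr)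
      assume "\<not> ?thesis"
      then have "(\<Sum>\<rho>\<in>insert \<sigma> R. (if \<rho> = \<sigma> then 1 else 0) * A \<rho> v s) = 0" if "v \<in> V" for v
        using that insert.hyps by (auto intro!: sum.neutral)
      from insert.prems(6)[OF s this, of \<sigma>] show False by simp
    qed
    then show "s \<in> (\<Union>v\<in>V. ?S v)" using s by auto
  qed
  moreover have "growth_le (?S v) (\<Psi> \<union> f ` V) M" if v: "v \<in> V" for v
  proof -
    define A' where "A' = (\<lambda>\<rho> w s. A \<sigma> v s * A \<rho> w s - A \<rho> v s * A \<sigma> w s)"
    define b' where "b' = (\<lambda>\<rho> s. A \<sigma> v s * b \<rho> s - A \<rho> v s * b \<sigma> s)"
    have split: "(\<Sum>w\<in>V. A \<rho> w s * f w s) = A \<rho> v s * f v s + (\<Sum>w\<in>V - {v}. A \<rho> w s * f w s)" for \<rho> s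
      using v insert.prems(1) by (simp add: sum.remove)
    have "growth_le (?S v) (\<Psi> \<union> f ` (V - {v})) M"
    proof (rule insert.IH[where A=A' and b=b'])
      show "A' \<rho> w \<in> alg \<Psi>" if "\<rho> \<in> R" "w \<in> V - {v}" for \<rho> w
        using that insert.prems(3) v unfolding A'_def by (intro alg_diff alg_mult) auto
      show "b' \<rho> \<in> alg \<Psi>" if "\<rho> \<in> R" for \<rho>
        using that insert.prems(3,4) v unfolding b'_def by (intro alg_diff alg_mult) auto
      show "(\<Sum>w\<in>V - {v}. A' \<rho> w s * f w s) = b' \<rho> s" if "\<rho> \<in> R" "s \<in> ?S v" for \<rho> s
      proof -
        have "(\<Sum>w\<in>V - {v}. A' \<rho> w s * f w s) = A \<sigma> v s * (\<Sum>w\<in>V - {v}. A \<rho> w s * f w s)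
          - A \<rho> v s * (\<Sum>w\<in>V - {v}. A \<sigma> w s * f w s)"
          by (simp add: A'_def left_diff_distrib sum_subtractf sum_distrib_left mult.assoc)
        moreover have "A \<rho> v s * f v s + (\<Sum>w\<in>V - {v}. A \<rho> w s * f w s) = b \<rho> s"
          using insert.prems(5)[of \<rho> s] that split[of \<rho> s] by simp
        moreover have "A \<sigma> v s * f v s + (\<Sum>w\<in>V - {v}. A \<sigma> w s * f w s) = b \<sigma> s"
          using insert.prems(5)[of \<sigma> s] that split[of \<sigma> s] by simp
        ultimately show ?thesis unfolding b'_def by algebra
      qed
      show "l \<rho> = 0" if s: "s \<in> ?S v" and l: "\<And>w. w \<in> V - {v} \<Longrightarrow> (\<Sum>\<rho>\<in>R. l \<rho> * A' \<rho> w s) = 0"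
        and \<rho>: "\<rho> \<in> R" for s l \<rho>
      proof -
        \<comment> \<open>A dependence of the reduced rows is one of the original rows, with the weight of the
          pivot row chosen to make the pivot column vanish.\<close>
        define l' where "l' \<rho> = (if \<rho> = \<sigma> then - (\<Sum>\<tau>\<in>R. l \<tau> * A \<tau> v s) else A \<sigma> v s * l \<rho>)" for \<rho>
        have eq: "(\<Sum>\<tau>\<in>insert \<sigma> R. l' \<tau> * A \<tau> w s) = (\<Sum>\<tau>\<in>R. l \<tau> * A' \<tau> w s)" for w
        proof -
          have "(\<Sum>\<tau>\<in>R. l' \<tau> * A \<tau> w s) = (\<Sum>\<tau>\<in>R. A \<sigma> v s * l \<tau> * A \<tau> w s)"
            using insert.hyps by (intro sum.cong) (auto simp: l'_def)
          then have "(\<Sum>\<tau>\<in>insert \<sigma> R. l' \<tau> * A \<tau> w s) =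
              - (\<Sum>\<tau>\<in>R. l \<tau> * A \<tau> v s) * A \<sigma> w s + (\<Sum>\<tau>\<in>R. A \<sigma> v s * l \<tau> * A \<tau> w s)"
            using insert.hyps by (simp add: l'_def)
          also have "\<dots> = (\<Sum>\<tau>\<in>R. l \<tau> * A' \<tau> w s)"
            by (simp add: A'_def sum_distrib_right sum_distrib_left right_diff_distrib sum_subtractf mult_ac)
          finally show ?thesis .
        qed
        have "(\<Sum>\<tau>\<in>insert \<sigma> R. l' \<tau> * A \<tau> w s) = 0" if "w \<in> V" for w
        proof (cases "w = v")
          case True
          show ?thesis unfolding eq by (simp add: A'_def True)
        next
          case False
          with l that show ?thesis unfolding eq by auto
        qed
        from insert.prems(6)[OF _ this, of \<rho>] s \<rho> have "l' \<rho> = 0" by auto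
        then show ?thesis using s \<rho> insert.hyps by (auto simp: l'_def split: if_splits)
      qed
      show "N + card (V - {v}) \<le> M + card R"
        using insert.prems(1,7) insert.hyps v by (simp add: card_Diff_singleton) (metis Suc_diff_le add_Suc_right card_gt_0_iff empty_iff leI le_zero_eq less_Suc_eq_le One_nat_def Suc_le_eq Suc_pred add_le_mono1 not_less_eq_eq)
    qed (use insert.prems in \<open>auto elim: growth_le_on_subset\<close>)
    moreover have "A \<sigma> v \<in> alg (\<Psi> \<union> f ` (V - {v}))"
      using insert.prems(3)[of \<sigma> v] v by (blast intro: alg_mono)
    moreover have "(\<lambda>s. b \<sigma> s - (\<Sum>w\<in>V - {v}. A \<sigma> w s * f w s)) \<in> alg (\<Psi> \<union> f ` (V - {v}))"
      using insert.prems(3,4)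
      by (intro alg_diff alg_sum alg_mult) (blast intro: alg_gen alg_mono)+
    ultimately have "growth_le (?S v) (insert (f v) (\<Psi> \<union> f ` (V - {v}))) M"
    proof (rule growth_le_rational)
      fix s assume "s \<in> ?S v"
      then show "A \<sigma> v s * f v s = b \<sigma> s - (\<Sum>w\<in>V - {v}. A \<sigma> w s * f w s)"
        using insert.prems(5)[of \<sigma> s] split[of \<sigma> s] by (simp add: algebra_simps)
    qed auto
    moreover have "insert (f v) (\<Psi> \<union> f ` (V - {v})) = \<Psi> \<union> f ` V" using v by auto
    ultimately show ?thesis by simp
  qed
  ultimately show ?case using growth_le_UN[of V ?S] insert.prems(1) growth_le_on_subset by meson
qed

text \<open>Several systems with separate unknowns form one system with a block diagonal matrix.\<close>

lemma growth_le_linear_systems: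
  assumes fin: "finite I" "finite R" "\<And>i. i \<in> I \<Longrightarrow> finite (V i)" and "growth_le S \<Psi> N"
    and A: "\<And>i \<rho> v. i \<in> I \<Longrightarrow> \<rho> \<in> R \<Longrightarrow> v \<in> V i \<Longrightarrow> A i \<rho> v \<in> alg \<Psi>"
    and b: "\<And>i \<rho>. i \<in> I \<Longrightarrow> \<rho> \<in> R \<Longrightarrow> b i \<rho> \<in> alg \<Psi>"
    and eq: "\<And>i \<rho> s. i \<in> I \<Longrightarrow> \<rho> \<in> R \<Longrightarrow> s \<in> S \<Longrightarrow> (\<Sum>v\<in>V i. A i \<rho> v s * f (i, v) s) = b i \<rho> s"
    and indep: "\<And>i s l \<rho>. i \<in> I \<Longrightarrow> s \<in> S \<Longrightarrow>
      (\<And>v. v \<in> V i \<Longrightarrow> (\<Sum>\<rho>\<in>R. l \<rho> * A i \<rho> v s) = 0) \<Longrightarrow> \<rho> \<in> R \<Longrightarrow> l \<rho> = (0::complex)"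
    and card: "N + (\<Sum>i\<in>I. card (V i)) \<le> M + card I * card R"
  shows "growth_le S (\<Psi> \<union> f ` Sigma I V) M"
proof -
  define A' where "A' = (\<lambda>(i, \<rho>) (j, v) s. if i = j then A i \<rho> v s else 0)"
  have sumV: "(\<Sum>v\<in>Sigma I V. A' (i, \<rho>) v s * f v s) = (\<Sum>v\<in>V i. A i \<rho> v s * f (i, v) s)"
    if "i \<in> I" for i \<rho> s
  proof -
    have "(\<Sum>v\<in>Sigma I V. A' (i, \<rho>) v s * f v s) = (\<Sum>j\<in>I. \<Sum>v\<in>V j. A' (i, \<rho>) (j, v) s * f (j, v) s)"
      using fin by (subst sum.Sigma) auto
    also have "\<dots> = (\<Sum>j\<in>I. if j = i then \<Sum>v\<in>V i. A i \<rho> v s * f (i, v) s else 0)"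
      by (intro sum.cong) (auto simp: A'_def)
    finally show ?thesis using that fin by simp
  qed
  have sumR: "(\<Sum>\<rho>\<in>I \<times> R. l \<rho> * A' \<rho> (j, v) s) = (\<Sum>\<rho>\<in>R. l (j, \<rho>) * A j \<rho> v s)"
    if "j \<in> I" for l j v s
  proof -
    have "(\<Sum>\<rho>\<in>I \<times> R. l \<rho> * A' \<rho> (j, v) s) = (\<Sum>i\<in>I. \<Sum>\<rho>\<in>R. l (i, \<rho>) * A' (i, \<rho>) (j, v) s)"
      using fin by (subst sum.Sigma) auto
    also have "\<dots> = (\<Sum>i\<in>I. if i = j then \<Sum>\<rho>\<in>R. l (j, \<rho>) * A j \<rho> v s else 0)"
      by (intro sum.cong) (auto simp: A'_def)
    finally show ?thesis using that fin by simp
  qed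
  show ?thesis
  proof (rule growth_le_linear_system[where R="I \<times> R" and A=A' and b="\<lambda>(i, \<rho>). b i \<rho>"])
    show "A' \<rho> v \<in> alg \<Psi>" if "\<rho> \<in> I \<times> R" "v \<in> Sigma I V" for \<rho> v
      using that A by (cases \<rho>; cases v; cases "fst \<rho> = fst v") (auto simp: A'_def)
    show "(\<Sum>v\<in>Sigma I V. A' \<rho> v s * f v s) = (case \<rho> of (i, \<rho>) \<Rightarrow> b i \<rho>) s"
      if "\<rho> \<in> I \<times> R" "s \<in> S" for \<rho> s
      using that eq sumV by auto
    show "l \<rho> = 0" if s: "s \<in> S" and l: "\<And>v. v \<in> Sigma I V \<Longrightarrow> (\<Sum>\<rho>\<in>I \<times> R. l \<rho> * A' \<rho> v s) = 0"
      and \<rho>: "\<rho> \<in> I \<times> R" for s l \<rho>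
    proof -
      obtain i \<tau> where [simp]: "\<rho> = (i, \<tau>)" and i: "i \<in> I" "\<tau> \<in> R" using \<rho> by auto
      show ?thesis
      proof (simp only: \<open>\<rho> = (i, \<tau>)\<close>, rule indep[OF i(1) s _ i(2), of "\<lambda>\<rho>. l (i, \<rho>)"])
        fix v assume "v \<in> V i"
        then show "(\<Sum>\<rho>\<in>R. l (i, \<rho>) * A i \<rho> v s) = 0"
          using l[of "(i, v)"] i(1) sumR[OF i(1)] by simp
      qed
    qed
    show "N + card (Sigma I V) \<le> M + card (I \<times> R)"
      using card fin by (simp add: card_cartesian_product)
  qed (use assms in auto)
qed

section \<open>Polynomials in many variables\<close>

definition mon :: "'v monom \<Rightarrow> ('v \<Rightarrow> complex) \<Rightarrow> complex" where
  "mon m x = (\<Prod>v\<in>Poly_Mapping.keys m. x v ^ Poly_Mapping.lookup m v)"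

lemma mon_superset:
  assumes "finite B" "Poly_Mapping.keys m \<subseteq> B"
  shows "mon m x = (\<Prod>v\<in>B. x v ^ Poly_Mapping.lookup m v)"
  unfolding mon_def using assms by (intro prod.mono_neutral_left) (auto simp: in_keys_iff)

lemma monom_degree_superset:
  assumes "finite B" "Poly_Mapping.keys m \<subseteq> B"
  shows "monom_degree m = (\<Sum>v\<in>B. Poly_Mapping.lookup m v)"
  unfolding monom_degree_def using assms by (intro sum.mono_neutral_left) (auto simp: in_keys_iff)

lemma mon_0 [simp]: "mon 0 x = 1"
  by (simp add: mon_def)

lemma mon_mult: "mon m (\<lambda>v. x v * y v) = mon m x * mon m y"
  by (simp add: mon_def power_mult_distrib prod.distrib)

lemma mon_cong: "(\<And>v. v \<in> Poly_Mapping.keys m \<Longrightarrow> x v = y v) \<Longrightarrow> mon m x = mon m y"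
  by (simp add: mon_def)

lemma mon_add_var: "mon (m + Poly_Mapping.single v 1) x = x v * mon m x"
proof -
  let ?B = "insert v (Poly_Mapping.keys m)"
  have B: "Poly_Mapping.keys (m + Poly_Mapping.single v 1) \<subseteq> ?B"
    using keys_add[of m "Poly_Mapping.single v 1"] by auto
  have "mon (m + Poly_Mapping.single v 1) x = (\<Prod>w\<in>?B. x w ^ Poly_Mapping.lookup m w * (if w = v then x v else 1))"
    by (subst mon_superset[OF _ B]) (auto simp: lookup_add lookup_single when_def power_add intro!: prod.cong)
  also have "\<dots> = mon m x * x v"
    by (subst mon_superset[of ?B]) (auto simp: prod.distrib)
  finally show ?thesis by (simp add: mult.commute)
qed

lemma monom_degree_add_var: "monom_degree (m + Poly_Mapping.single v 1) = Suc (monom_degree m)"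
proof -
  let ?B = "insert v (Poly_Mapping.keys m)"
  have B: "Poly_Mapping.keys (m + Poly_Mapping.single v 1) \<subseteq> ?B"
    using keys_add[of m "Poly_Mapping.single v 1"] by auto
  have "monom_degree (m + Poly_Mapping.single v 1) = (\<Sum>w\<in>?B. Poly_Mapping.lookup m w + (if w = v then 1 else 0))"
    by (subst monom_degree_superset[OF _ B]) (auto simp: lookup_add lookup_single when_def intro!: sum.cong)
  also have "\<dots> = monom_degree m + 1"
    by (subst monom_degree_superset[of ?B]) (auto simp: sum.distrib)
  finally show ?thesis by simp
qed

lemma peval_superset:
  assumes "finite A" "Poly_Mapping.keys f \<subseteq> A"
  shows "peval f x = (\<Sum>m\<in>A. Poly_Mapping.lookup f m * mon m x)"
  unfolding peval_def mon_def[symmetric] using assms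
  by (intro sum.mono_neutral_left) (auto simp: in_keys_iff)

lemma peval_mon: "peval f x = (\<Sum>m\<in>Poly_Mapping.keys f. Poly_Mapping.lookup f m * mon m x)"
  by (rule peval_superset) auto

lemma peval_add: "peval (f + g) x = peval f x + peval g x"
proof -
  let ?A = "Poly_Mapping.keys f \<union> Poly_Mapping.keys g"
  have "peval (f + g) x = (\<Sum>m\<in>?A. Poly_Mapping.lookup (f + g) m * mon m x)"
    by (rule peval_superset) (auto simp: keys_add)
  also have "\<dots> = peval f x + peval g x"
    by (simp add: peval_superset[of ?A] lookup_add distrib_right sum.distrib)
  finally show ?thesis .
qed

lemma peval_0 [simp]: "peval 0 x = 0"
  by (simp add: peval_def)

lemma peval_single: "peval (Poly_Mapping.single m a) x = a * mon m x"
  by (subst peval_superset[of "{m}"]) auto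

lemma peval_sum: "peval (\<Sum>i\<in>A. f i) x = (\<Sum>i\<in>A. peval (f i) x)"
  by (induction A rule: infinite_finite_induct) (auto simp: peval_add)

lemma keys_sum_subset:
  "Poly_Mapping.keys (\<Sum>i\<in>A. f i) \<subseteq> (\<Union>i\<in>A. Poly_Mapping.keys (f i))"
proof (induction A rule: infinite_finite_induct)
  case (insert i A)
  then show ?case using keys_add[of "f i" "\<Sum>i\<in>A. f i"] by auto
qed auto

lemma polys_imp_peval:
  assumes "f \<in> polys (\<xi> ` J) D"
  shows "\<exists>g. (\<forall>s. f s = peval g (\<lambda>v. \<xi> v s)) \<and> degree_le D g \<and> (\<forall>m\<in>Poly_Mapping.keys g. Poly_Mapping.keys m \<subseteq> J)"
  using assms
proof induction
  case (const D a)
  show ?case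
    by (intro exI[of _ "Poly_Mapping.single 0 a"])
      (auto simp: peval_single degree_le_def monom_degree_def split: if_splits)
next
  case (add D f1 f2)
  then obtain g1 g2 where g: "\<forall>s. f1 s = peval g1 (\<lambda>v. \<xi> v s)" "degree_le D g1"
    "\<forall>m\<in>Poly_Mapping.keys g1. Poly_Mapping.keys m \<subseteq> J"
    "\<forall>s. f2 s = peval g2 (\<lambda>v. \<xi> v s)" "degree_le D g2"
    "\<forall>m\<in>Poly_Mapping.keys g2. Poly_Mapping.keys m \<subseteq> J" by blast
  have "m \<in> Poly_Mapping.keys g1 \<or> m \<in> Poly_Mapping.keys g2" if "m \<in> Poly_Mapping.keys (g1 + g2)" for m
    using that keys_add[of g1 g2] by blast
  then have "degree_le D (g1 + g2)" "\<forall>m\<in>Poly_Mapping.keys (g1 + g2). Poly_Mapping.keys m \<subseteq> J"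
    using g unfolding degree_le_def by meson+
  then show ?case
    using g by (intro exI[of _ "g1 + g2"]) (simp add: peval_add)
next
  case (gen_mult D f h)
  then obtain g v where g: "\<forall>s. f s = peval g (\<lambda>v. \<xi> v s)" "degree_le D g"
    "\<forall>m\<in>Poly_Mapping.keys g. Poly_Mapping.keys m \<subseteq> J" and v: "v \<in> J" "h = \<xi> v" by blast
  let ?g = "\<Sum>m\<in>Poly_Mapping.keys g. Poly_Mapping.single (m + Poly_Mapping.single v 1) (Poly_Mapping.lookup g m)"
  have keys: "\<exists>m'\<in>Poly_Mapping.keys g. m = m' + Poly_Mapping.single v 1" if "m \<in> Poly_Mapping.keys ?g" for m
  proof -
    have "m \<in> (\<Union>m'\<in>Poly_Mapping.keys g. Poly_Mapping.keys (Poly_Mapping.single (m' + Poly_Mapping.single v 1) (Poly_Mapping.lookup g m')))"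
      using that keys_sum_subset by (rule subsetD[rotated])
    then show ?thesis by (auto split: if_splits)
  qed
  have "peval ?g (\<lambda>v. \<xi> v s) = h s * f s" for s
    by (simp add: peval_sum peval_single mon_add_var[simplified] g(1) v(2) sum_distrib_left peval_mon[of g] mult_ac)
  moreover have "degree_le (Suc D) ?g"
    unfolding degree_le_def
  proof
    fix m assume "m \<in> Poly_Mapping.keys ?g"
    then obtain m' where "m' \<in> Poly_Mapping.keys g" "m = m' + Poly_Mapping.single v 1" using keys by blast
    then show "monom_degree m \<le> Suc D"
      using g(2) monom_degree_add_var[of m' v] by (auto simp: degree_le_def)
  qed
  moreover have "\<forall>m\<in>Poly_Mapping.keys ?g. Poly_Mapping.keys m \<subseteq> J"
  proof
    fix m assume "m \<in> Poly_Mapping.keys ?g"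
    then obtain m' where "m' \<in> Poly_Mapping.keys g" "m = m' + Poly_Mapping.single v 1" using keys by blast
    then show "Poly_Mapping.keys m \<subseteq> J"
      using g(3) keys_add[of m' "Poly_Mapping.single v (1::nat)"] v(1) by (auto split: if_splits)
  qed
  ultimately show ?case by (intro exI[of _ ?g]) auto
next
  case (weaken D f)
  then show ?case unfolding degree_le_def by (meson le_SucI)
qed

lemma polys_prod:
  "(\<And>i. i \<in> A \<Longrightarrow> f i \<in> polys \<Psi> (D i)) \<Longrightarrow> (\<lambda>s. \<Prod>i\<in>A. f i s) \<in> polys \<Psi> (\<Sum>i\<in>A. D i)"
proof (induction A rule: infinite_finite_induct)
  case (insert i A)
  then show ?case using polys_mult[of "f i" \<Psi> "D i"] by simp
qed (auto intro: polys_const)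

lemma mon_alg: "(\<And>v. v \<in> Poly_Mapping.keys m \<Longrightarrow> \<xi> v \<in> alg \<Psi>) \<Longrightarrow> (\<lambda>s. mon m (\<lambda>v. \<xi> v s)) \<in> alg \<Psi>"
  unfolding mon_def by (intro alg_prod alg_power)

lemma peval_alg:
  assumes "\<And>m v. m \<in> Poly_Mapping.keys g \<Longrightarrow> v \<in> Poly_Mapping.keys m \<Longrightarrow> \<xi> v \<in> alg \<Psi>"
  shows "(\<lambda>s. peval g (\<lambda>v. \<xi> v s)) \<in> alg \<Psi>"
  unfolding peval_mon using assms by (intro alg_sum alg_mult alg_const mon_alg)

section \<open>Algebraic dependence\<close>

lemma underdetermined_system:
  fixes a :: "'i \<Rightarrow> 'g \<Rightarrow> complex"
  assumes "finite G" "finite I" "card G < card I"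
  shows "\<exists>c. (\<exists>i\<in>I. c i \<noteq> 0) \<and> (\<forall>g\<in>G. (\<Sum>i\<in>I. c i * a i g) = 0)"
  using assms
proof (induction G arbitrary: I a rule: finite_induct)
  case empty
  then show ?case by (intro exI[of _ "\<lambda>_. 1"]) (auto simp: card_gt_0_iff)
next
  case (insert g G)
  show ?case
  proof (cases "\<forall>i\<in>I. a i g = 0")
    case True
    then show ?thesis using insert.IH[OF insert.prems(1), of a] insert.prems insert.hyps by auto
  next
    case False
    then obtain j where j: "j \<in> I" "a j g \<noteq> 0" by auto
    let ?a = "\<lambda>i h. a i h - a i g / a j g * a j h"
    have "card G < card (I - {j})" using insert j by (simp add: card_Diff_singleton)
    then obtain c where c: "\<exists>i\<in>I - {j}. c i \<noteq> 0" "\<forall>h\<in>G. (\<Sum>i\<in>I - {j}. c i * ?a i h) = 0"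
      using insert.IH[of "I - {j}" ?a] insert.prems by auto
    define c' where "c' i = (if i = j then - (\<Sum>i\<in>I - {j}. c i * a i g) / a j g else c i)" for i
    have sum: "(\<Sum>i\<in>I. c' i * a i h) = (\<Sum>i\<in>I - {j}. c i * ?a i h)" for h
    proof -
      have "(\<Sum>i\<in>I. c' i * a i h) = c' j * a j h + (\<Sum>i\<in>I - {j}. c' i * a i h)"
        using insert.prems j by (simp add: sum.remove)
      also have "(\<Sum>i\<in>I - {j}. c' i * a i h) = (\<Sum>i\<in>I - {j}. c i * a i h)"
        by (intro sum.cong) (auto simp: c'_def)
      also have "c' j * a j h = - (\<Sum>i\<in>I - {j}. c i * (a i g / a j g * a j h))"
        by (simp add: c'_def sum_distrib_right sum_divide_distrib mult.assoc)
      finally show ?thesis by (simp add: right_diff_distrib sum_subtractf)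
    qed
    have "(\<Sum>i\<in>I - {j}. c i * ?a i g) = 0" using j by (intro sum.neutral) auto
    then have "\<forall>h\<in>insert g G. (\<Sum>i\<in>I. c' i * a i h) = 0" using c(2) unfolding sum by auto
    moreover have "\<exists>i\<in>I. c' i \<noteq> 0" using c(1) by (auto simp: c'_def)
    ultimately show ?thesis by blast
  qed
qed

text \<open>A family of growth \<open>N\<close> satisfies a relation between any \<open>N\<close> of its members and one more,
  as there are more monomials than dimensions. Where a coefficient of the relation, regarded as a
  polynomial in the additional member \<open>y\<close>, does not vanish, it determines \<open>y\<close> up to finitely many
  values.\<close>

lemma growth_le_imp_generically_finite:
  assumes "growth_le S \<Psi> (card J)" "finite J" "\<And>j. j \<in> J \<Longrightarrow> u j \<in> \<Psi>" "y \<in> \<Psi>"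
  shows "\<exists>p. p \<noteq> 0 \<and> (\<forall>m\<in>Poly_Mapping.keys p. Poly_Mapping.keys m \<subseteq> J) \<and>
    (\<forall>v. peval p v \<noteq> 0 \<longrightarrow> finite {y s | s. s \<in> S \<and> (\<forall>j\<in>J. u j s = v j)})"
proof -
  obtain C where C: "\<And>D. \<exists>G. finite G \<and> card G \<le> C * (D + 1) ^ card J \<and> (\<forall>f\<in>polys \<Psi> D. in_span S G f)"
    using assms(1) by (auto simp: growth_le_def)
  define N where "N = card J"
  \<comment> \<open>Exponents up to \<open>D\<close> in \<open>N + 1\<close> functions give \<open>(D + 1) ^ (N + 1)\<close> monomials of total degree at
    most \<open>(N + 1) * D\<close>, in a space of dimension at most \<open>C * (N + 1) ^ N * (D + 1) ^ N\<close>.\<close>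
  define D where "D = C * (N + 1) ^ N"
  obtain G where G: "finite G" "card G \<le> C * ((N + 1) * D + 1) ^ N" "\<forall>f\<in>polys \<Psi> ((N + 1) * D). in_span S G f"
    using C[of "(N + 1) * D"] unfolding N_def by blast
  let ?E = "J \<rightarrow>\<^sub>E {..D}"
  let ?I = "?E \<times> {..D}"
  define pm where "pm f = Poly_Mapping.Abs_poly_mapping (\<lambda>j. if j \<in> J then f j else (0::nat))" for f
  have lookup_pm: "Poly_Mapping.lookup (pm f) = (\<lambda>j. if j \<in> J then f j else 0)" for f
    unfolding pm_def using assms(2) by (subst lookup_Abs_poly_mapping) (auto elim: rev_finite_subset)
  have keys_pm: "Poly_Mapping.keys (pm f) \<subseteq> J" for f
    by (auto simp: in_keys_iff lookup_pm split: if_splits)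
  have inj: "inj_on pm ?E"
  proof (rule inj_onI)
    fix f g assume fg: "f \<in> ?E" "g \<in> ?E" "pm f = pm g"
    then show "f = g" using lookup_pm[of f] lookup_pm[of g]
      by (intro PiE_ext[OF fg(1,2)]) (metis fg(3))
  qed
  have finE: "finite ?E" using assms(2) by (intro finite_PiE) auto
  have cardE: "card ?E = (D + 1) ^ N" using assms(2) by (simp add: card_PiE N_def)
  have "card G \<le> C * ((N + 1) * D + 1) ^ N" by (rule G)
  also have "\<dots> \<le> C * ((N + 1) * (D + 1)) ^ N" by (intro mult_left_mono power_mono) auto
  also have "\<dots> = D * (D + 1) ^ N" by (simp only: D_def power_mult_distrib mult.assoc)
  also have "\<dots> < card ?I" by (simp add: card_cartesian_product cardE)
  finally have cardI: "card G < card ?I" .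
  have "in_span S G (\<lambda>s. mon (pm f) (\<lambda>j. u j s) * y s ^ e)" if "f \<in> ?E" "e \<le> D" for f e
  proof -
    have "(\<lambda>s. mon (pm f) (\<lambda>j. u j s)) \<in> polys \<Psi> (N * D)"
    proof -
      have "(\<lambda>s. u j s ^ Poly_Mapping.lookup (pm f) j) \<in> polys \<Psi> D" if "j \<in> J" for j
        using polys_power[OF polys_gen, of "u j" \<Psi> "f j"] assms(3) that \<open>f \<in> ?E\<close>
        by (auto simp: lookup_pm elim!: polys_mono_degree)
      then have "(\<lambda>s. \<Prod>j\<in>J. u j s ^ Poly_Mapping.lookup (pm f) j) \<in> polys \<Psi> (\<Sum>j\<in>J. D)"
        by (rule polys_prod)
      then show ?thesis by (simp add: mon_superset[OF assms(2) keys_pm] N_def)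
    qed
    moreover have "(\<lambda>s. y s ^ e) \<in> polys \<Psi> D"
      using polys_power[OF polys_gen[OF assms(4)], of e] that by (auto elim!: polys_mono_degree)
    ultimately have "(\<lambda>s. mon (pm f) (\<lambda>j. u j s) * y s ^ e) \<in> polys \<Psi> (N * D + D)"
      by (rule polys_mult)
    then show ?thesis using G(3) by (simp add: algebra_simps)
  qed
  then have "\<forall>i\<in>?I. \<exists>a. \<forall>s\<in>S. mon (pm (fst i)) (\<lambda>j. u j s) * y s ^ snd i = (\<Sum>g\<in>G. a g * g s)"
    unfolding in_span_def by auto
  then obtain a where a: "\<And>i s. i \<in> ?I \<Longrightarrow> s \<in> S \<Longrightarrow>
      mon (pm (fst i)) (\<lambda>j. u j s) * y s ^ snd i = (\<Sum>g\<in>G. a i g * g s)"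
    by (auto simp: bchoice_iff)
  obtain c where c: "\<exists>i\<in>?I. c i \<noteq> 0" "\<forall>g\<in>G. (\<Sum>i\<in>?I. c i * a i g) = 0"
    using underdetermined_system[OF G(1) _ cardI] finE by blast
  have rel: "(\<Sum>e\<le>D. (\<Sum>f\<in>?E. c (f, e) * mon (pm f) (\<lambda>j. u j s)) * y s ^ e) = 0" if "s \<in> S" for s
  proof -
    have "(\<Sum>e\<le>D. (\<Sum>f\<in>?E. c (f, e) * mon (pm f) (\<lambda>j. u j s)) * y s ^ e) =
        (\<Sum>f\<in>?E. \<Sum>e\<le>D. c (f, e) * (mon (pm f) (\<lambda>j. u j s) * y s ^ e))"
      by (subst sum.swap) (simp add: sum_distrib_right mult.assoc)
    also have "\<dots> = (\<Sum>i\<in>?I. c i * (mon (pm (fst i)) (\<lambda>j. u j s) * y s ^ snd i))"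
      by (subst sum.cartesian_product) (simp add: case_prod_unfold)
    also have "\<dots> = (\<Sum>i\<in>?I. \<Sum>g\<in>G. c i * a i g * g s)"
      using a that by (intro sum.cong) (auto simp: sum_distrib_left mult.assoc)
    also have "\<dots> = (\<Sum>g\<in>G. (\<Sum>i\<in>?I. c i * a i g) * g s)"
      by (subst sum.swap) (simp add: sum_distrib_right)
    finally show ?thesis using c(2) by simp
  qed
  obtain f0 e0 where fe: "f0 \<in> ?E" "e0 \<le> D" "c (f0, e0) \<noteq> 0" using c(1) by auto
  define p where "p = (\<Sum>f\<in>?E. Poly_Mapping.single (pm f) (c (f, e0)))"
  have "Poly_Mapping.lookup p (pm f0) = (\<Sum>f\<in>?E. if f = f0 then c (f, e0) else 0)"
    unfolding p_def lookup_sum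
    using inj fe(1) by (intro sum.cong) (auto simp: lookup_single when_def inj_on_def)
  also have "\<dots> = c (f0, e0)" using fe(1) finE by simp
  finally have "p \<noteq> 0" using fe(3) by auto
  moreover have "\<forall>m\<in>Poly_Mapping.keys p. Poly_Mapping.keys m \<subseteq> J"
  proof
    fix m assume "m \<in> Poly_Mapping.keys p"
    then have "m \<in> (\<Union>f\<in>?E. Poly_Mapping.keys (Poly_Mapping.single (pm f) (c (f, e0))))"
      unfolding p_def using keys_sum_subset by (rule subsetD[rotated])
    then show "Poly_Mapping.keys m \<subseteq> J" using keys_pm by (auto split: if_splits)
  qed
  moreover have "finite {y s | s. s \<in> S \<and> (\<forall>j\<in>J. u j s = v j)}" if v: "peval p v \<noteq> 0" for v
  proof -
    define b where "b e = (\<Sum>f\<in>?E. c (f, e) * mon (pm f) v)" for e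
    have "b e0 \<noteq> 0" using v by (simp add: p_def b_def peval_sum peval_single)
    then have "finite {z. (\<Sum>e\<le>D. b e * z ^ e) = 0}" using fe(2) polyfun_finite_roots[of b D] by auto
    moreover have "{y s | s. s \<in> S \<and> (\<forall>j\<in>J. u j s = v j)} \<subseteq> {z. (\<Sum>e\<le>D. b e * z ^ e) = 0}"
    proof clarify
      fix s assume s: "s \<in> S" "\<forall>j\<in>J. u j s = v j"
      have "mon (pm f) (\<lambda>j. u j s) = mon (pm f) v" for f
        using s(2) keys_pm by (intro mon_cong) auto
      then show "(\<Sum>e\<le>D. b e * y s ^ e) = 0" using rel[OF s(1)] by (simp add: b_def)
    qed
    ultimately show ?thesis by (rule rev_finite_subset)
  qed
  ultimately show ?thesis by blast
qed

section \<open>Hermite interpolation at affinely independent points\<close>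

definition monoms_upto :: "nat \<Rightarrow> 'n monom set" where
  "monoms_upto d = {m. monom_degree m \<le> d}"

lemma finite_monoms_upto: "finite (monoms_upto d :: ('n::finite) monom set)"
proof -
  have "Poly_Mapping.lookup ` (monoms_upto d :: 'n monom set) \<subseteq> UNIV \<rightarrow>\<^sub>E {..d}"
  proof (rule image_subsetI)
    fix m :: "'n monom" assume m: "m \<in> monoms_upto d"
    have "Poly_Mapping.lookup m v \<le> d" for v
    proof -
      have "Poly_Mapping.lookup m v \<le> (\<Sum>w\<in>UNIV. Poly_Mapping.lookup m w)"
        by (rule member_le_sum) auto
      then show ?thesis using m by (simp add: monom_degree_superset[of UNIV] monoms_upto_def)
    qed
    then show "Poly_Mapping.lookup m \<in> UNIV \<rightarrow>\<^sub>E {..d}" by auto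
  qed
  then have "finite (Poly_Mapping.lookup ` (monoms_upto d :: 'n monom set))"
    by (rule finite_subset) (auto intro: finite_PiE)
  moreover have "inj_on Poly_Mapping.lookup (monoms_upto d :: 'n monom set)"
    by (auto intro: inj_onI poly_mapping_eqI)
  ultimately show ?thesis by (rule finite_imageD)
qed

text \<open>The components of the \<open>1\<close>-jet of a monomial: \<open>None\<close> is the value, \<open>Some a\<close> the derivative in
  direction \<open>a\<close>.\<close>

fun jet :: "('n::finite) option \<Rightarrow> 'n monom \<Rightarrow> complex ^ 'n \<Rightarrow> complex" where
  "jet None m x = mon m (($) x)"
| "jet (Some a) m x = of_nat (Poly_Mapping.lookup m a) * x $ a ^ (Poly_Mapping.lookup m a - 1) *
    (\<Prod>v\<in>UNIV - {a}. x $ v ^ Poly_Mapping.lookup m v)"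

lemma mon_has_field_derivative:
  "((\<lambda>s. mon m (($) (x + s *s axis a 1))) has_field_derivative jet (Some a) m x) (at 0)"
proof -
  have "mon m (($) (x + s *s axis a 1)) =
      (x $ a + s) ^ Poly_Mapping.lookup m a * (\<Prod>v\<in>UNIV - {a}. x $ v ^ Poly_Mapping.lookup m v)" for s
    by (subst mon_superset[of UNIV]) (auto simp: prod.remove[of UNIV a] axis_def intro!: prod.cong)
  then show ?thesis by (auto intro!: derivative_eq_intros)
qed

lemma deriv_peval:
  assumes "degree_le d f"
  shows "deriv (\<lambda>s. peval f (($) (x + s *s axis a 1))) 0 =
    (\<Sum>m\<in>monoms_upto d. Poly_Mapping.lookup f m * jet (Some a) m x)"
proof (rule DERIV_imp_deriv)
  have "Poly_Mapping.keys f \<subseteq> monoms_upto d" using assms by (auto simp: degree_le_def monoms_upto_def)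
  then have "peval f y = (\<Sum>m\<in>monoms_upto d. Poly_Mapping.lookup f m * mon m y)" for y
    by (rule peval_superset[OF finite_monoms_upto])
  then show "((\<lambda>s. peval f (($) (x + s *s axis a 1))) has_field_derivative
      (\<Sum>m\<in>monoms_upto d. Poly_Mapping.lookup f m * jet (Some a) m x)) (at 0)"
    by (auto intro!: DERIV_sum DERIV_cmult mon_has_field_derivative simp del: jet.simps)
qed

lemma peval_monoms_upto:
  fixes x :: "complex ^ 'n::finite"
  assumes "degree_le d f"
  shows "peval f (($) x) = (\<Sum>m\<in>monoms_upto d. Poly_Mapping.lookup f m * jet None m x)"
proof -
  have "Poly_Mapping.keys f \<subseteq> monoms_upto d" using assms by (auto simp: degree_le_def monoms_upto_def)
  then show ?thesis by (simp add: peval_superset[OF finite_monoms_upto])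
qed

lemma jacobian_matrix_monoms_upto:
  "degree_le d (F i) \<Longrightarrow>
    jacobian_matrix F x $ i $ a = (\<Sum>m\<in>monoms_upto d. Poly_Mapping.lookup (F i) m * jet (Some a) m x)"
  by (simp add: jacobian_matrix_def deriv_peval del: jet.simps)

lemma jet_alg:
  assumes "\<And>a. (\<lambda>s. x s $ a) \<in> alg \<Psi>"
  shows "(\<lambda>s. jet \<rho> m (x s)) \<in> alg \<Psi>"
proof (cases \<rho>)
  case None
  then show ?thesis using assms by (simp add: mon_alg)
next
  case (Some a)
  then show ?thesis using assms by (simp add: alg_mult alg_const alg_power alg_prod)
qed

lemma sum_UNIV_option: "(\<Sum>\<rho>\<in>(UNIV :: 'a::finite option set). f \<rho>) = f None + (\<Sum>a\<in>UNIV. f (Some a))"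
  by (simp add: UNIV_option_conv sum.reindex)

text \<open>The rows \<open>(1, x i)\<close> of a matrix with affinely independent \<open>x i\<close> are linearly independent; the
  columns of a right inverse are the coefficients of the forms.\<close>

lemma barycentric_forms:
  fixes x :: "complex ^ 'n::finite ^ 'k::finite"
  assumes "\<not> complex_affine_dependent x"
  shows "\<exists>\<alpha> \<beta>. \<forall>i j. \<beta> j + (\<Sum>a\<in>UNIV. \<alpha> j a * x $ i $ a) = (if i = j then 1 else (0::complex))"
proof -
  let ?X = "\<chi> i \<rho>. case \<rho> of None \<Rightarrow> 1 | Some a \<Rightarrow> x $ i $ a :: complex ^ ('n option) ^ 'k"
  have "\<forall>c. (\<Sum>i\<in>UNIV. c i *s row i ?X) = 0 \<longrightarrow> (\<forall>i. c i = 0)"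
  proof clarify
    fix c i assume c: "(\<Sum>i\<in>UNIV. c i *s row i ?X) = 0"
    have "(\<Sum>i\<in>UNIV. c i * ?X $ i $ \<rho>) = 0" for \<rho>
      using arg_cong[OF c, of "\<lambda>v. v $ \<rho>"] by (simp add: row_def sum_component)
    from this[of None] this[of "Some _"]
    have "(\<Sum>i\<in>UNIV. c i) = 0" "(\<Sum>i\<in>UNIV. c i *s x $ i) = 0"
      by (auto simp: vec_eq_iff sum_component)
    then show "c i = 0"
      using assms by (auto simp: complex_affine_dependent_def vec_eq_iff dest: spec[of _ "\<chi> i. c i"])
  qed
  then obtain B where B: "?X ** B = mat 1"
    using matrix_right_invertible_independent_rows[of ?X] by blast
  have "B $ None $ j + (\<Sum>a\<in>UNIV. B $ Some a $ j * x $ i $ a) = (if i = j then 1 else 0)" for i j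
    using arg_cong[OF B, of "\<lambda>M. M $ i $ j"]
    by (simp add: matrix_matrix_mult_def sum_UNIV_option mat_def mult.commute)
  then show ?thesis by (intro exI[of _ "\<lambda>j a. B $ Some a $ j"] exI[of _ "\<lambda>j. B $ None $ j"]) auto
qed

abbreviation coordinates :: "(complex ^ 'n \<Rightarrow> complex) set" where
  "coordinates \<equiv> range (\<lambda>a x. x $ a)"

lemma vanishing_on_monoms:
  fixes x :: "complex ^ 'n::finite ^ 'k::finite"
  assumes "\<And>m. m \<in> monoms_upto d \<Longrightarrow> (\<Sum>(j, \<rho>)\<in>UNIV. l (j, \<rho>) * jet \<rho> m (x $ j)) = 0"
    and f: "f \<in> polys coordinates d"
    and f': "\<And>j a. ((\<lambda>s. f (x $ j + s *s axis a 1)) has_field_derivative f' j a) (at 0)"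
  shows "(\<Sum>j\<in>UNIV. l (j, None) * f (x $ j) + (\<Sum>a\<in>UNIV. l (j, Some a) * f' j a)) = 0"
proof -
  obtain g where g: "\<And>x. f x = peval g (($) x)" "degree_le d g"
    using polys_imp_peval[OF f] by auto
  have f0: "f (x $ j) = (\<Sum>m\<in>monoms_upto d. Poly_Mapping.lookup g m * jet None m (x $ j))" for j
    unfolding g(1) by (rule peval_monoms_upto[OF g(2)])
  have "f' j a = (\<Sum>m\<in>monoms_upto d. Poly_Mapping.lookup g m * jet (Some a) m (x $ j))" for j a
    using DERIV_imp_deriv[OF f'[of j a]] deriv_peval[OF g(2), of "x $ j" a] by (simp add: g(1) del: jet.simps)
  then have "(\<Sum>j\<in>UNIV. l (j, None) * f (x $ j) + (\<Sum>a\<in>UNIV. l (j, Some a) * f' j a)) =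
      (\<Sum>j\<in>UNIV. \<Sum>\<rho>\<in>UNIV. \<Sum>m\<in>monoms_upto d. l (j, \<rho>) * (Poly_Mapping.lookup g m * jet \<rho> m (x $ j)))"
    by (simp add: sum_UNIV_option f0 sum_distrib_left del: jet.simps)
  also have "\<dots> = (\<Sum>p\<in>UNIV. \<Sum>m\<in>monoms_upto d. l p * (Poly_Mapping.lookup g m * jet (snd p) m (x $ fst p)))"
    by (subst sum.cartesian_product) (simp add: case_prod_unfold del: jet.simps)
  also have "\<dots> = (\<Sum>m\<in>monoms_upto d. Poly_Mapping.lookup g m * (\<Sum>(j, \<rho>)\<in>UNIV. l (j, \<rho>) * jet \<rho> m (x $ j)))"
    by (subst sum.swap) (simp add: sum_distrib_left case_prod_unfold mult_ac del: jet.simps)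
  also have "\<dots> = 0" using assms(1) by (intro sum.neutral) auto
  finally show ?thesis .
qed

text \<open>If \<open>L\<close> is the barycentric form of a point, then \<open>L\<^sup>2\<close> and its products with the coordinates
  centred at that point have vanishing jets at the other points, and at that point they isolate the
  value and the derivatives. The products have degree three: this is where quadrics have to be
  excluded.\<close>

lemma hermite_independent:
  fixes x :: "complex ^ 'n::finite ^ 'k::finite"
  assumes "\<not> complex_affine_dependent x" "3 \<le> d"
    and l: "\<And>m. m \<in> monoms_upto d \<Longrightarrow> (\<Sum>(j, \<rho>)\<in>UNIV. l (j, \<rho>) * jet \<rho> m (x $ j)) = 0"
  shows "l (j, \<rho>) = 0"
proof -
  obtain \<alpha> \<beta> where L0: "\<And>i j. \<beta> j + (\<Sum>a\<in>UNIV. \<alpha> j a * x $ i $ a) = (if i = j then 1 else (0::complex))"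
    using barycentric_forms[OF assms(1)] by blast
  define L where "L y = \<beta> j + (\<Sum>a\<in>UNIV. \<alpha> j a * y $ a)" for y :: "complex ^ 'n"
  have L: "L (x $ i) = (if i = j then 1 else 0)" for i using L0 by (simp add: L_def)
  have shift: "L (y + s *s axis a 1) = L y + \<alpha> j a * s" for y s a
    by (simp add: L_def distrib_left sum.distrib axis_def if_distrib[of "\<lambda>x. _ * x"] cong: if_cong)
  have coord: "(\<lambda>y. y $ a) \<in> polys coordinates 1" for a :: 'n
    by (rule polys_gen) auto
  have polyL: "L \<in> polys coordinates 1"
    unfolding L_def by (intro polys_add polys_const polys_sum polys_scale coord)
  have L2: "(\<lambda>y. L y * L y) \<in> polys coordinates 2"
    using polys_mult[OF polyL polyL] by (simp add: numeral_2_eq_2)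
  have some: "l (j, Some b) = 0" for b
  proof -
    have lin: "(\<lambda>y. y $ b + - x $ j $ b) \<in> polys coordinates 1"
      by (intro polys_add polys_const coord)
    have "(\<Sum>i\<in>UNIV. l (i, None) * (L (x $ i) * L (x $ i) * (x $ i $ b + - x $ j $ b)) +
      (\<Sum>a\<in>UNIV. l (i, Some a) * (if i = j \<and> a = b then 1 else 0))) = 0"
    proof (rule vanishing_on_monoms[OF l])
      show "(\<lambda>y. L y * L y * (y $ b + - x $ j $ b)) \<in> polys coordinates d"
        using polys_mult[OF L2 lin] assms(2) by (auto elim!: polys_mono_degree)
      show "((\<lambda>s. L (x $ i + s *s axis a 1) * L (x $ i + s *s axis a 1) * ((x $ i + s *s axis a 1) $ b + - x $ j $ b))
          has_field_derivative (if i = j \<and> a = b then 1 else 0)) (at 0)" for i a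
        unfolding shift L by (auto simp: axis_def intro!: derivative_eq_intros)
    qed
    then have "(\<Sum>i\<in>UNIV. if i = j then l (j, Some b) else 0) = 0"
      by (subst (asm) sum.cong[OF refl, where h="\<lambda>i. if i = j then l (j, Some b) else 0"])
        (auto simp: L if_distrib[of "\<lambda>x. _ * x"] cong: if_cong)
    then show ?thesis by simp
  qed
  have "l (j, None) = 0"
  proof -
    have "(\<Sum>i\<in>UNIV. l (i, None) * (L (x $ i) * L (x $ i)) +
      (\<Sum>a\<in>UNIV. l (i, Some a) * (if i = j then 2 * \<alpha> j a else 0))) = 0"
    proof (rule vanishing_on_monoms[OF l])
      show "(\<lambda>y. L y * L y) \<in> polys coordinates d"
        using L2 assms(2) by (auto elim!: polys_mono_degree)
      show "((\<lambda>s. L (x $ i + s *s axis a 1) * L (x $ i + s *s axis a 1))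
          has_field_derivative (if i = j then 2 * \<alpha> j a else 0)) (at 0)" for i a
        unfolding shift L by (auto intro!: derivative_eq_intros)
    qed
    then have "(\<Sum>i\<in>UNIV. if i = j then l (j, None) else 0) = 0"
      by (subst (asm) sum.cong[OF refl, where h="\<lambda>i. if i = j then l (j, None) else 0"])
        (auto simp: L some)
    then show ?thesis by simp
  qed
  with some show ?thesis by (cases \<rho>) auto
qed

lemma lagrange_independent:
  fixes x :: "complex ^ 'n::finite ^ 'k::finite"
  assumes "\<not> complex_affine_dependent x" "1 \<le> d"
    and l: "\<And>m. m \<in> monoms_upto d \<Longrightarrow> (\<Sum>j\<in>UNIV. l j * jet None m (x $ j)) = 0"
  shows "l j = 0"
proof -
  define l' where "l' = (\<lambda>(j, \<rho>). if \<rho> = (None :: 'n option) then l j else 0)"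
  obtain \<alpha> \<beta> where L0: "\<And>i j. \<beta> j + (\<Sum>a\<in>UNIV. \<alpha> j a * x $ i $ a) = (if i = j then 1 else (0::complex))"
    using barycentric_forms[OF assms(1)] by blast
  define L where "L y = \<beta> j + (\<Sum>a\<in>UNIV. \<alpha> j a * y $ a)" for y :: "complex ^ 'n"
  have L: "L (x $ i) = (if i = j then 1 else 0)" for i using L0 by (simp add: L_def)
  have shift: "L (y + s *s axis a 1) = L y + \<alpha> j a * s" for y s a
    by (simp add: L_def distrib_left sum.distrib axis_def if_distrib[of "\<lambda>x. _ * x"] cong: if_cong)
  have polyL: "L \<in> polys coordinates 1"
    unfolding L_def by (intro polys_add polys_const polys_sum polys_scale polys_gen) auto
  have "(\<Sum>i\<in>UNIV. l' (i, None) * L (x $ i) + (\<Sum>a\<in>UNIV. l' (i, Some a) * \<alpha> j a)) = 0"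
  proof (rule vanishing_on_monoms)
    fix m :: "'n monom" assume m: "m \<in> monoms_upto d"
    have "(\<Sum>(i, \<rho>)\<in>UNIV. l' (i, \<rho>) * jet \<rho> m (x $ i)) = (\<Sum>i\<in>UNIV. \<Sum>\<rho>\<in>UNIV. l' (i, \<rho>) * jet \<rho> m (x $ i))"
      by (simp add: sum.cartesian_product del: jet.simps)
    also have "\<dots> = 0" using l[OF m] by (simp add: sum_UNIV_option l'_def)
    finally show "(\<Sum>(i, \<rho>)\<in>UNIV. l' (i, \<rho>) * jet \<rho> m (x $ i)) = 0" .
  next
    show "L \<in> polys coordinates d" using polyL assms(2) by (rule polys_mono_degree)
    show "((\<lambda>s. L (x $ i + s *s axis a 1)) has_field_derivative \<alpha> j a) (at 0)" for i a
      unfolding shift by (auto intro!: derivative_eq_intros)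
  qed
  then show ?thesis by (simp add: l'_def L if_distrib[of "\<lambda>x. _ * x"] cong: if_cong)
qed

section \<open>Points equidistant from their barycentre\<close>

lemma growth_le_sqrt_many:
  assumes "finite A" "growth_le S \<Psi> N"
    and "\<And>i. i \<in> A \<Longrightarrow> \<exists>b\<in>alg \<Psi>. \<forall>s\<in>S. f i s ^ 2 = b s"
  shows "growth_le S (\<Psi> \<union> f ` A) N"
  using assms
proof (induction A rule: finite_induct)
  case (insert x A)
  then have IH: "growth_le S (\<Psi> \<union> f ` A) N" by auto
  obtain b where b: "b \<in> alg \<Psi>" "\<forall>s\<in>S. f x s ^ 2 = b s" using insert.prems(2)[of x] by blast
  have "growth_le S (insert (f x) (\<Psi> \<union> f ` A)) N"
    by (rule growth_le_quadratic[OF IH, of "\<lambda>_. 1" b "\<lambda>_. 0"]) (use b in \<open>auto elim: alg_mono\<close>)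
  then show ?case by simp
qed simp

text \<open>The functions describe \<open>k\<close> points \<open>z + y i\<close> and weights \<open>t i\<close> with barycentre \<open>z\<close> at common
  squared distance \<open>r\<close> from \<open>z\<close>. The configurations have dimension \<open>k n\<close>. One point \<open>k\<^sub>0\<close> is determined
  by the others and the weights, so what remains is to see that the condition on the length of
  \<open>y k\<^sub>0\<close> cuts down the dimension.\<close>

context
  fixes S :: "'s set" and z :: "'n::finite \<Rightarrow> 's \<Rightarrow> complex" and r :: "'s \<Rightarrow> complex"
    and y :: "'k::finite \<times> 'n \<Rightarrow> 's \<Rightarrow> complex" and t :: "'k \<Rightarrow> 's \<Rightarrow> complex"
  assumes weights: "\<And>s. s \<in> S \<Longrightarrow> (\<Sum>i\<in>UNIV. t i s) = 1" "\<And>s i. s \<in> S \<Longrightarrow> t i s \<noteq> 0"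
    and barycentre: "\<And>s a. s \<in> S \<Longrightarrow> (\<Sum>i\<in>UNIV. t i s * y (i, a) s) = 0"
    and equidistant: "\<And>s i. s \<in> S \<Longrightarrow> (\<Sum>a\<in>UNIV. y (i, a) s ^ 2) = r s"
begin

text \<open>The last weight is one minus the others, and \<open>y k\<^sub>0\<close> is \<open>- (\<Sum>i \<noteq> k\<^sub>0. t i y i) / t k\<^sub>0\<close>.\<close>

lemma growth_le_all_but_one_point:
  assumes "T \<subseteq> S" "growth_le T \<Psi> N" "range z \<subseteq> \<Psi>" "r \<in> alg \<Psi>"
    and y\<Psi>: "\<And>i a. i \<noteq> k0 \<Longrightarrow> y (i, a) \<in> \<Psi>" and t\<Psi>: "\<And>i. i \<noteq> k0 \<Longrightarrow> t i \<in> \<Psi>"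
  shows "growth_le T (range z \<union> {r} \<union> range y \<union> range t) N"
proof -
  have tk: "(\<lambda>s. 1 - (\<Sum>i\<in>UNIV - {k0}. t i s)) \<in> alg \<Psi>"
    by (intro alg_diff alg_sum alg_const) (auto intro: alg_gen t\<Psi>)
  have tk_eq: "t k0 s = 1 - (\<Sum>i\<in>UNIV - {k0}. t i s)" if "s \<in> T" for s
    using weights(1)[of s] that assms(1) by (auto simp: sum.remove[of UNIV k0] algebra_simps)
  have "growth_le T (\<Psi> \<union> (\<lambda>a. y (k0, a)) ` UNIV) N"
  proof (rule growth_le_rational_many)
    fix a
    have "(\<lambda>s. - (\<Sum>i\<in>UNIV - {k0}. t i s * y (i, a) s)) \<in> alg \<Psi>"
      by (intro alg_uminus alg_sum alg_mult) (auto intro: alg_gen t\<Psi> y\<Psi>)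
    moreover have tky: "t k0 s * y (k0, a) s = - (\<Sum>i\<in>UNIV - {k0}. t i s * y (i, a) s)" if "s \<in> T" for s
      using barycentre[of s a] that assms(1)
      by (auto simp: sum.remove[of UNIV k0] eq_neg_iff_add_eq_0)
    moreover have "1 - (\<Sum>i\<in>UNIV - {k0}. t i s) \<noteq> 0 \<and> (1 - (\<Sum>i\<in>UNIV - {k0}. t i s)) * y (k0, a) s =
        - (\<Sum>i\<in>UNIV - {k0}. t i s * y (i, a) s)" if "s \<in> T" for s
      using tky[OF that] weights(2)[of s k0] that assms(1) unfolding tk_eq[OF that, symmetric] by auto
    ultimately show "\<exists>b\<in>alg \<Psi>. \<exists>c\<in>alg \<Psi>. \<forall>s\<in>T. b s \<noteq> 0 \<and> b s * y (k0, a) s = c s"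
      using tk by (intro bexI[rotated] ballI)
  qed (use assms in auto)
  then have "growth_le T (insert (t k0) (\<Psi> \<union> (\<lambda>a. y (k0, a)) ` UNIV)) N"
    by (rule growth_le_rational[OF _ alg_const[of 1] alg_mono[OF tk]]) (auto simp: tk_eq)
  then have "growth_le T (insert r (insert (t k0) (\<Psi> \<union> (\<lambda>a. y (k0, a)) ` UNIV))) N"
    by (rule growth_le_rational[OF _ alg_const[of 1] alg_mono[OF assms(4)]]) auto
  moreover have "range y \<subseteq> \<Psi> \<union> (\<lambda>a. y (k0, a)) ` UNIV"
    using y\<Psi> by (auto, metis rangeI)
  moreover have "range t \<subseteq> insert (t k0) \<Psi>"
  proof (rule image_subsetI)
    fix i show "t i \<in> insert (t k0) \<Psi>" using t\<Psi>[of i] by (cases "i = k0") auto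
  qed
  ultimately show ?thesis using assms(3) by (elim growth_le_subset) blast
qed

text \<open>If \<open>r = 0\<close>, then the parameter \<open>r\<close> is saved, which makes up for leaving the length of \<open>y k\<^sub>0\<close>
  unconstrained: to the \<open>n\<close> coordinates of \<open>z\<close>, each of the other \<open>k - 1\<close> points adds \<open>n - 1\<close>
  coordinates and a weight.\<close>

lemma growth_le_equidistant_isotropic:
  assumes "T \<subseteq> S" "\<And>s. s \<in> T \<Longrightarrow> r s = 0"
  shows "growth_le T (range z \<union> {r} \<union> range y \<union> range t) (CARD('k) * CARD('n))"
proof -
  obtain k0 :: 'k and a0 :: 'n where True by blast
  let ?Y = "(UNIV - {k0}) \<times> (UNIV - {a0})"
  let ?\<Psi> = "{} \<union> z ` UNIV \<union> y ` ?Y \<union> t ` (UNIV - {k0})"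
  have "growth_le T ?\<Psi> (0 + CARD('n) + card ?Y + card (UNIV - {k0}))"
    by (intro growth_le_insert_many growth_le_empty) auto
  moreover have "0 + CARD('n) + card ?Y + card (UNIV - {k0}) = CARD('k) * CARD('n)"
  proof -
    obtain k' where "CARD('k) = Suc k'" by (cases "CARD('k)") auto
    moreover obtain n' where "CARD('n) = Suc n'" by (cases "CARD('n)") auto
    ultimately show ?thesis by (simp add: card_cartesian_product card_Diff_singleton)
  qed
  ultimately have *: "growth_le T ?\<Psi> (CARD('k) * CARD('n))" by simp
  have "growth_le T (?\<Psi> \<union> (\<lambda>i. y (i, a0)) ` (UNIV - {k0})) (CARD('k) * CARD('n))"
  proof (rule growth_le_sqrt_many[OF _ *])
    fix i assume i: "i \<in> UNIV - {k0}"
    have "(\<lambda>s. - (\<Sum>a\<in>UNIV - {a0}. y (i, a) s ^ 2)) \<in> alg ?\<Psi>"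
      using i by (intro alg_uminus alg_sum alg_power alg_gen) auto
    moreover have "y (i, a0) s ^ 2 = - (\<Sum>a\<in>UNIV - {a0}. y (i, a) s ^ 2)" if "s \<in> T" for s
      using equidistant[of s i] assms that by (auto simp: sum.remove[of UNIV a0] eq_neg_iff_add_eq_0)
    ultimately show "\<exists>b\<in>alg ?\<Psi>. \<forall>s\<in>T. y (i, a0) s ^ 2 = b s"
      by (intro bexI[rotated] ballI)
  qed auto
  then have "growth_le T (?\<Psi> \<union> (\<lambda>i. y (i, a0)) ` (UNIV - {k0}) \<union> {r}) (CARD('k) * CARD('n))"
    unfolding Un_insert_right Un_empty_right
    by (rule growth_le_rational[OF _ alg_const[of 1] alg_const[of 0]]) (use assms(2) in auto)
  then show ?thesis
  proof (rule growth_le_all_but_one_point[OF assms(1), where ?k0.0=k0])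
    show "y (i, a) \<in> ?\<Psi> \<union> (\<lambda>i. y (i, a0)) ` (UNIV - {k0}) \<union> {r}" if "i \<noteq> k0" for i a
      using that by (cases "a = a0") auto
  qed (auto intro: alg_gen)
qed

text \<open>If \<open>y j\<^sub>0 \<bullet> y k\<^sub>0 \<noteq> r\<close>, then the length condition on \<open>y k\<^sub>0\<close> is a linear equation for \<open>t j\<^sub>0\<close>: in
  \<open>q (w + t j\<^sub>0 y j\<^sub>0) = r (1 - T - t j\<^sub>0)\<^sup>2\<close>, where \<open>w\<close> and \<open>T\<close> collect the other points, the terms
  quadratic in \<open>t j\<^sub>0\<close> cancel, and the coefficient of \<open>t j\<^sub>0\<close> is \<open>2 t k\<^sub>0 (r - y j\<^sub>0 \<bullet> y k\<^sub>0)\<close>.\<close>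

lemma growth_le_equidistant_anisotropic:
  assumes "T \<subseteq> S" "j0 \<noteq> k0" and ne: "\<And>s. s \<in> T \<Longrightarrow> (\<Sum>a\<in>UNIV. y (j0, a) s * y (k0, a) s) \<noteq> r s"
  shows "growth_le T (range z \<union> {r} \<union> range y \<union> range t) (CARD('k) * CARD('n))"
proof -
  obtain a0 :: 'n where True by blast
  let ?Y = "(UNIV - {k0}) \<times> (UNIV - {a0})"
  let ?R = "UNIV - {k0} - {j0}"
  let ?\<Psi> = "{} \<union> z ` UNIV \<union> (\<lambda>_. r) ` {()} \<union> y ` ?Y \<union> t ` ?R"
  have "growth_le T ?\<Psi> (0 + CARD('n) + card {()} + card ?Y + card ?R)"
    by (intro growth_le_insert_many growth_le_empty) auto
  moreover have "0 + CARD('n) + card {()} + card ?Y + card ?R = CARD('k) * CARD('n)"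
  proof -
    obtain n' where n: "CARD('n) = Suc n'" by (cases "CARD('n)") auto
    have "card {j0, k0} \<le> CARD('k)" by (rule card_mono) auto
    then obtain k' where k: "CARD('k) = Suc (Suc k')"
      using assms(2) by (metis card_2_iff le_Suc_ex numeral_2_eq_2 add_Suc)
    have "card ?R = k'" using k assms(2) by (simp add: card_Diff_singleton)
    then show ?thesis using n k by (simp add: card_cartesian_product card_Diff_singleton)
  qed
  ultimately have *: "growth_le T ?\<Psi> (CARD('k) * CARD('n))" by simp
  let ?\<Phi> = "?\<Psi> \<union> (\<lambda>i. y (i, a0)) ` (UNIV - {k0})"
  have growth: "growth_le T ?\<Phi> (CARD('k) * CARD('n))"
  proof (rule growth_le_sqrt_many[OF _ *])
    fix i assume i: "i \<in> UNIV - {k0}"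
    have "(\<lambda>s. r s - (\<Sum>a\<in>UNIV - {a0}. y (i, a) s ^ 2)) \<in> alg ?\<Psi>"
      using i by (intro alg_diff alg_sum alg_power alg_gen) auto
    moreover have "y (i, a0) s ^ 2 = r s - (\<Sum>a\<in>UNIV - {a0}. y (i, a) s ^ 2)" if "s \<in> T" for s
      using equidistant[of s i] assms that by (auto simp: sum.remove[of UNIV a0] algebra_simps)
    ultimately show "\<exists>b\<in>alg ?\<Psi>. \<forall>s\<in>T. y (i, a0) s ^ 2 = b s"
      by (intro bexI[rotated] ballI)
  qed auto
  define \<Phi> where "\<Phi> = ?\<Phi>"
  have y\<Phi>: "y (i, a) \<in> \<Phi>" if "i \<noteq> k0" for i a
    using that unfolding \<Phi>_def by (cases "a = a0") auto
  have t\<Phi>: "t i \<in> \<Phi>" if "i \<in> ?R" for i using that unfolding \<Phi>_def by auto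
  have rz\<Phi>: "r \<in> \<Phi>" "range z \<subseteq> \<Phi>" unfolding \<Phi>_def by auto
  define w where "w a s = (\<Sum>i\<in>?R. t i s * y (i, a) s)" for a s
  define \<tau> where "\<tau> s = 1 - (\<Sum>i\<in>?R. t i s)" for s
  have [intro]: "r \<in> alg \<Phi>" by (rule alg_gen rz\<Phi>)+
  have [intro]: "y (j0, a) \<in> alg \<Phi>" for a using y\<Phi> assms(2) by (intro alg_gen) auto
  have [intro]: "w a \<in> alg \<Phi>" for a
    unfolding w_def by (intro alg_sum alg_mult alg_gen y\<Phi> t\<Phi>) auto
  have [intro]: "\<tau> \<in> alg \<Phi>"
    unfolding \<tau>_def by (intro alg_diff alg_const alg_sum alg_gen t\<Phi>) auto
  have "growth_le T (insert (t j0) \<Phi>) (CARD('k) * CARD('n))"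
  proof (rule growth_le_rational[OF growth[folded \<Phi>_def]])
    show "(\<lambda>s. 2 * ((\<Sum>a\<in>UNIV. w a s * y (j0, a) s) + r s * \<tau> s)) \<in> alg \<Phi>"
      by (intro alg_mult alg_const alg_add alg_sum) auto
    show "(\<lambda>s. r s * \<tau> s ^ 2 - (\<Sum>a\<in>UNIV. w a s ^ 2)) \<in> alg \<Phi>"
      by (intro alg_mult alg_power alg_diff alg_sum) auto
    fix s assume s: "s \<in> T"
    then have sS: "s \<in> S" using assms(1) by auto
    define P where "P = (\<Sum>a\<in>UNIV. y (j0, a) s * y (k0, a) s)"
    have UNIV_sum: "(\<Sum>i\<in>UNIV. f i) = f k0 + (f j0 + (\<Sum>i\<in>?R. f i))" for f :: "'k \<Rightarrow> complex"
      using assms(2) sum.remove[of UNIV k0 f] sum.remove[of "UNIV - {k0}" j0 f] by simp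
    have w: "w a s = - (t k0 s * y (k0, a) s) - t j0 s * y (j0, a) s" for a
      using barycentre[OF sS, of a] unfolding UNIV_sum w_def by (simp add: algebra_simps eq_neg_iff_add_eq_0)
    have \<tau>: "\<tau> s = t j0 s + t k0 s"
      using weights(1)[OF sS] unfolding UNIV_sum \<tau>_def by (simp add: algebra_simps)
    have "(\<Sum>a\<in>UNIV. w a s * y (j0, a) s) =
        - t k0 s * P - t j0 s * (\<Sum>a\<in>UNIV. y (j0, a) s ^ 2)"
      unfolding w P_def by (simp add: sum_distrib_left sum_subtractf sum_negf algebra_simps power2_eq_square)
    then have wy: "(\<Sum>a\<in>UNIV. w a s * y (j0, a) s) = - t k0 s * P - t j0 s * r s"
      using equidistant[OF sS] by simp
    have "(\<Sum>a\<in>UNIV. w a s ^ 2) = t k0 s ^ 2 * (\<Sum>a\<in>UNIV. y (k0, a) s ^ 2)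
        + 2 * t k0 s * t j0 s * P + t j0 s ^ 2 * (\<Sum>a\<in>UNIV. y (j0, a) s ^ 2)"
      unfolding w P_def by (simp add: sum_distrib_left sum.distrib algebra_simps power2_eq_square)
    then have ww: "(\<Sum>a\<in>UNIV. w a s ^ 2) = t k0 s ^ 2 * r s + 2 * t k0 s * t j0 s * P + t j0 s ^ 2 * r s"
      using equidistant[OF sS] by simp
    have "2 * ((\<Sum>a\<in>UNIV. w a s * y (j0, a) s) + r s * \<tau> s) = 2 * (t k0 s * (r s - P))"
      unfolding wy \<tau> by (simp add: algebra_simps)
    moreover have "r s - P \<noteq> 0" using ne[OF s] by (simp add: P_def)
    ultimately show "2 * ((\<Sum>a\<in>UNIV. w a s * y (j0, a) s) + r s * \<tau> s) \<noteq> 0"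
      using weights(2)[OF sS] by simp
    show "2 * ((\<Sum>a\<in>UNIV. w a s * y (j0, a) s) + r s * \<tau> s) * t j0 s = r s * \<tau> s ^ 2 - (\<Sum>a\<in>UNIV. w a s ^ 2)"
      unfolding wy ww \<tau> by (simp add: algebra_simps power2_eq_square)
  qed
  then show ?thesis
  proof (rule growth_le_all_but_one_point[OF assms(1), where ?k0.0=k0])
    show "y (i, a) \<in> insert (t j0) \<Phi>" if "i \<noteq> k0" for i a
      using y\<Phi>[OF that] by blast
    show "t i \<in> insert (t j0) \<Phi>" if "i \<noteq> k0" for i
      using that t\<Phi> by (cases "i = j0") auto
  qed (use rz\<Phi> in \<open>auto intro: alg_gen\<close>)
qed

text \<open>If all \<open>y j \<bullet> y k\<close> are equal to \<open>r\<close>, then pairing \<open>\<Sum>k. t k y k = 0\<close> with \<open>y j\<close> gives \<open>r = 0\<close>. So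
  the two cases above cover everything.\<close>

lemma growth_le_equidistant:
  "growth_le S (range z \<union> {r} \<union> range y \<union> range t) (CARD('k) * CARD('n))"
proof -
  let ?A = "\<lambda>(j, k). {s \<in> S. (\<Sum>a\<in>UNIV. y (j, a) s * y (k, a) s) \<noteq> r s}"
  let ?I = "{(j :: 'k, k). j \<noteq> k}"
  have "r s = 0" if s: "s \<in> S" "s \<notin> (\<Union>p\<in>?I. ?A p)" for s
  proof -
    obtain j :: 'k where True by blast
    have "(\<Sum>a\<in>UNIV. y (j, a) s * y (k, a) s) = r s" for k
      using s equidistant[of s j] by (cases "j = k") (auto simp: power2_eq_square)
    then have "(\<Sum>k\<in>UNIV. t k s * (\<Sum>a\<in>UNIV. y (j, a) s * y (k, a) s)) = r s"
      using weights(1)[OF s(1)] by (simp flip: sum_distrib_right)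
    also have "(\<Sum>k\<in>UNIV. t k s * (\<Sum>a\<in>UNIV. y (j, a) s * y (k, a) s)) =
        (\<Sum>a\<in>UNIV. y (j, a) s * (\<Sum>k\<in>UNIV. t k s * y (k, a) s))"
      unfolding sum_distrib_left by (subst sum.swap) (simp add: mult_ac)
    finally show ?thesis using barycentre[OF s(1)] by simp
  qed
  then have sub: "S \<subseteq> (\<Union>p\<in>?I. ?A p) \<union> {s \<in> S. r s = 0}" by blast
  have "growth_le {s \<in> S. r s = 0} (range z \<union> {r} \<union> range y \<union> range t) (CARD('k) * CARD('n))"
    by (rule growth_le_equidistant_isotropic) auto
  moreover have "growth_le (\<Union>p\<in>?I. ?A p) (range z \<union> {r} \<union> range y \<union> range t) (CARD('k) * CARD('n))"
  proof (intro growth_le_UN)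
    fix p assume "p \<in> ?I"
    then show "growth_le (?A p) (range z \<union> {r} \<union> range y \<union> range t) (CARD('k) * CARD('n))"
      by (cases p) (auto simp only: mem_Collect_eq case_prod_conv intro!: growth_le_equidistant_anisotropic)
  qed auto
  ultimately show ?thesis using sub by (meson growth_le_Un growth_le_on_subset)
qed

end

section \<open>The incidence variety\<close>

definition base_config :: "(('c::finite) \<Rightarrow> ('n::finite) cpoly) \<Rightarrow> complex ^ 'n ^ 'k::finite \<Rightarrow> complex ^ 'k \<Rightarrow> bool" where
  "base_config F x t \<longleftrightarrow> (\<Sum>j\<in>UNIV. t $ j) = 1 \<and> (\<forall>j. t $ j \<noteq> 0) \<and> \<not> complex_affine_dependent x \<and>
    (\<forall>i j. sqdist (x $ i) (rho (x, t)) = sqdist (x $ j) (rho (x, t))) \<and>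
    (\<forall>i j. peval (F i) (($) (x $ j)) = 0)"

definition multiplier_eq ::
  "(('c::finite) \<Rightarrow> ('n::finite) cpoly) \<Rightarrow> complex ^ 'n ^ 'k::finite \<Rightarrow> complex ^ 'k \<Rightarrow> ('k \<Rightarrow> 'c option \<Rightarrow> complex) \<Rightarrow> bool" where
  "multiplier_eq F x t w \<longleftrightarrow> (\<forall>j a. w j None * (x $ j - rho (x, t)) $ a +
    (\<Sum>i\<in>UNIV. w j (Some i) * jacobian_matrix F (x $ j) $ i $ a) = 0)"

text \<open>A kernel vector of the augmented Jacobian is useful for the count only if the gradient of an
  equation of degree at least three enters into it; this gradient can then be eliminated.\<close>

definition critical_configs ::
  "('c::finite \<Rightarrow> nat) \<Rightarrow> ('c \<Rightarrow> ('n::finite) cpoly) \<Rightarrow> ((complex ^ 'n ^ 'k::finite) \<times> (complex ^ 'k)) set" where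
  "critical_configs d F = {(x, t). base_config F x t \<and>
    (\<exists>w. multiplier_eq F x t w \<and> (\<forall>j. \<exists>i. d i \<noteq> 1 \<and> w j (Some i) \<noteq> 0))}"

definition coefficient_index :: "('c \<Rightarrow> nat) \<Rightarrow> ('c \<times> 'n monom) set" where
  "coefficient_index d = Sigma UNIV (\<lambda>i. monoms_upto (d i))"

lemma finite_coefficient_index: "finite (coefficient_index d :: ('c::finite \<times> ('n::finite) monom) set)"
  unfolding coefficient_index_def by (auto intro: finite_monoms_upto)

definition coefficients :: "('c \<Rightarrow> 'n cpoly) \<Rightarrow> 'c \<times> 'n monom \<Rightarrow> complex" where
  "coefficients F = (\<lambda>(i, m). Poly_Mapping.lookup (F i) m)"

definition config_coordinates :: "((complex ^ 'n ^ 'k) \<times> (complex ^ 'k) \<Rightarrow> complex) set" where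
  "config_coordinates = range (\<lambda>(j, a) (x, t). x $ j $ a) \<union> range (\<lambda>j (x, t). t $ j)"

text \<open>The points, weights and multipliers account for \<open>k n + k c\<close> dimensions. With them given, the
  equations of degree one satisfy \<open>k\<close> independent conditions each. For the others the gradients at
  the points are chosen first, except for the gradient of \<open>F (p j)\<close> at \<open>x j\<close>, which the multiplier
  equation provides; then the values and gradients at the points are \<open>k (n + 1)\<close> independent
  conditions on the coefficients of each equation. In total the dimension is that of the space of systems.\<close>

lemma growth_le_incidence:
  fixes d :: "'c::finite \<Rightarrow> nat" and p :: "'k::finite \<Rightarrow> 'c"
    and F :: "'s \<Rightarrow> 'c \<Rightarrow> ('n::finite) cpoly" and x :: "'s \<Rightarrow> complex ^ 'n ^ 'k"
    and t :: "'s \<Rightarrow> complex ^ 'k" and w :: "'s \<Rightarrow> 'k \<Rightarrow> 'c option \<Rightarrow> complex"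
  assumes d: "\<And>i. 1 \<le> d i \<and> d i \<noteq> 2" and p: "\<And>j. d (p j) \<noteq> 1"
    and deg: "\<And>s i. s \<in> S \<Longrightarrow> degree_le (d i) (F s i)"
    and base: "\<And>s. s \<in> S \<Longrightarrow> base_config (F s) (x s) (t s)"
    and mult: "\<And>s. s \<in> S \<Longrightarrow> multiplier_eq (F s) (x s) (t s) (w s)"
    and wp: "\<And>s j. s \<in> S \<Longrightarrow> w s j (Some (p j)) = -1"
  shows "growth_le S ((\<lambda>v s. coefficients (F s) v) ` coefficient_index d \<union>
      (\<lambda>h s. h (x s, t s)) ` config_coordinates)
    (card (coefficient_index d :: ('c \<times> 'n monom) set))"
proof -
  obtain j0 :: 'k where True by blast
  define L where "L = {i. d i = 1}"
  define B where "B = {i. d i \<noteq> 1}"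
  define \<Lambda> where "\<Lambda> = (\<Sum>i\<in>L. card (monoms_upto (d i) :: 'n monom set))"
  define k n b where "k = CARD('k)" and "n = CARD('n)" and "b = card B"
  have LB: "L \<union> B = UNIV" "L \<inter> B = {}" by (auto simp: L_def B_def)
  have cardLB: "card L + b = CARD('c)"
    unfolding b_def using LB card_Un_disjoint[of L B] by (simp add: finite_subset[OF subset_UNIV])
  have pB: "p j \<in> B" for j using p by (simp add: B_def)
  have b_pos: "b \<ge> 1" unfolding b_def using pB[of j0] by (auto simp: Suc_le_eq card_gt_0_iff)
  define z where "z a s = rho (x s, t s) $ a" for a s
  define y where "y = (\<lambda>(j, a) s. (x s $ j - rho (x s, t s)) $ a)"
  define r where "r s = sqdist (x s $ j0) (rho (x s, t s))" for s
  define u where "u v s = coefficients (F s) v" for v s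
  define g where "g = (\<lambda>(i, j, a) s. jacobian_matrix (F s) (x s $ j) $ i $ a)"
  define \<Psi>0 where "\<Psi>0 = range z \<union> {r} \<union> range y \<union> range (\<lambda>j s. t s $ j)"
  have "growth_le S \<Psi>0 (k * n)"
    unfolding \<Psi>0_def k_def n_def
  proof (rule growth_le_equidistant)
    fix s assume s: "s \<in> S"
    note bc = base[OF s, unfolded base_config_def]
    show "(\<Sum>i\<in>UNIV. t s $ i) = 1" "t s $ i \<noteq> 0" for i using bc by auto
    show "(\<Sum>i\<in>UNIV. t s $ i * y (i, a) s) = 0" for a
      using bc by (simp add: y_def rho_def sum_component right_diff_distrib sum_subtractf flip: sum_distrib_right)
    show "(\<Sum>a\<in>UNIV. y (i, a) s ^ 2) = r s" for i
      using bc unfolding y_def r_def by (simp add: sqdist_def)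
  qed
  then have "growth_le S (\<Psi>0 \<union> (\<lambda>(j, q) s. w s j q) ` Sigma UNIV (\<lambda>j. UNIV - {Some (p j)}))
      (k * n + card (Sigma UNIV (\<lambda>j. UNIV - {Some (p j)})))"
    by (intro growth_le_insert_many) auto
  moreover define \<Psi>1 where "\<Psi>1 = \<Psi>0 \<union> (\<lambda>(j, q) s. w s j q) ` Sigma UNIV (\<lambda>j. UNIV - {Some (p j)})"
  moreover have "card (Sigma (UNIV :: 'k set) (\<lambda>j. UNIV - {Some (p j)})) = k * CARD('c)"
    by (simp add: card_Diff_singleton k_def)
  ultimately have growth1: "growth_le S \<Psi>1 (k * n + k * CARD('c))" by simp
  have y1: "y v \<in> alg \<Psi>1" for v by (rule alg_gen) (auto simp: \<Psi>1_def \<Psi>0_def)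
  have x1: "(\<lambda>s. x s $ j $ a) \<in> alg \<Psi>1" for j a
  proof -
    have "(\<lambda>s. z a s + y (j, a) s) \<in> alg \<Psi>1"
      by (intro alg_add y1 alg_gen) (auto simp: \<Psi>1_def \<Psi>0_def)
    then show ?thesis by (simp add: z_def y_def)
  qed
  have w1: "(\<lambda>s. w s j q) \<in> alg \<Psi>1" if "q \<noteq> Some (p j)" for j q
    using that by (intro alg_gen) (force simp: \<Psi>1_def)

  have growth2: "growth_le S (\<Psi>1 \<union> u ` Sigma L (\<lambda>i. monoms_upto (d i))) (k * n + k * b + \<Lambda>)"
  proof (rule growth_le_linear_systems[OF _ _ _ growth1, where R=UNIV
        and A="\<lambda>i j m s. jet None m (x s $ j)" and b="\<lambda>_ _ _. 0"])
    show "(\<Sum>m\<in>monoms_upto (d i). jet None m (x s $ j) * u (i, m) s) = 0" if "s \<in> S" for i j s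
      using base[OF that] peval_monoms_upto[OF deg[OF that], of i "x s $ j"]
      by (simp add: base_config_def u_def coefficients_def mult.commute)
    show "l j = 0" if "s \<in> S" "\<And>m. m \<in> monoms_upto (d i) \<Longrightarrow> (\<Sum>j\<in>UNIV. l j * jet None m (x s $ j)) = 0"
      for i s l and j :: 'k
      using lagrange_independent[of "x s" "d i" l j] base[OF that(1)] d[of i] that(2)
      by (simp add: base_config_def)
    show "k * n + k * CARD('c) + (\<Sum>i\<in>L. card (monoms_upto (d i) :: 'n monom set)) \<le>
        k * n + k * b + \<Lambda> + card L * card (UNIV :: 'k set)"
      by (simp add: \<Lambda>_def k_def flip: cardLB) (simp add: algebra_simps)
  qed (auto intro: finite_monoms_upto jet_alg x1 simp del: jet.simps)
  define \<Psi>2 where "\<Psi>2 = \<Psi>1 \<union> u ` Sigma L (\<lambda>i. monoms_upto (d i))"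

  define I where "I = {(i, j, a :: 'n). i \<in> B \<and> i \<noteq> p j}"
  have "growth_le S (\<Psi>2 \<union> g ` I) (k * n + k * b + \<Lambda> + card I)"
    using growth2 unfolding \<Psi>2_def by (rule growth_le_insert_many[rotated]) simp
  moreover define \<Psi>3 where "\<Psi>3 = \<Psi>2 \<union> g ` I"
  moreover have "card I = k * (b - 1) * n"
  proof -
    have "card I = card (Sigma (UNIV :: 'k set) (\<lambda>j. (B - {p j}) \<times> (UNIV :: 'n set)))"
      by (rule bij_betw_same_card[of "\<lambda>(i, j, a). (j, i, a)"])
        (auto simp: I_def bij_betw_def inj_on_def image_def)
    also have "\<dots> = k * (b - 1) * n"
      using pB by (simp add: card_cartesian_product card_Diff_singleton k_def b_def n_def)
    finally show ?thesis .
  qed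
  moreover have "k * n + k * b + \<Lambda> + k * (b - 1) * n = k * b * (n + 1) + \<Lambda>"
    using b_pos by (cases b) (auto simp: algebra_simps)
  ultimately have growth3: "growth_le S \<Psi>3 (k * b * (n + 1) + \<Lambda>)" by metis
  have up: "f \<in> alg \<Psi>3" if "f \<in> alg \<Psi>1" for f
    using that by (rule alg_mono) (auto simp: \<Psi>3_def \<Psi>2_def)

  have jet3: "(\<lambda>s. jet \<rho> m (x s $ j)) \<in> alg \<Psi>3" for \<rho> m j
    by (intro jet_alg up x1)

  \<comment> \<open>\<open>g'\<close> and \<open>h\<close> agree with the derivatives on \<open>S\<close> and are polynomial in the functions at hand:
    for equations of degree one through the coefficients, for \<open>F (p j)\<close> through the multiplier equation.\<close>
  define g' where "g' i j a = (if i \<in> L then (\<lambda>s. \<Sum>m\<in>monoms_upto (d i). u (i, m) s * jet (Some a) m (x s $ j))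
    else g (i, j, a))" for i j a
  have g'_alg: "g' i j a \<in> alg \<Psi>3" if "i \<noteq> p j" for i j a
  proof (cases "i \<in> L")
    case True
    then have "u (i, m) \<in> \<Psi>3" if "m \<in> monoms_upto (d i)" for m using that by (auto simp: \<Psi>3_def \<Psi>2_def)
    then show ?thesis using True unfolding g'_def
      by (auto intro!: alg_sum alg_mult jet3 intro: alg_gen simp del: jet.simps)
  next
    case False
    then show ?thesis using that LB by (auto simp: g'_def \<Psi>3_def I_def intro!: alg_gen)
  qed
  have g'_eq: "g' i j a s = jacobian_matrix (F s) (x s $ j) $ i $ a" if "s \<in> S" for i j a s
    using jacobian_matrix_monoms_upto[where F="F s" and i=i, OF deg[OF that], of "x s $ j" a]
    by (simp add: g'_def g_def u_def coefficients_def del: jet.simps)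
  define h where "h i j a = (if i = p j then (\<lambda>s. w s j None * y (j, a) s +
    (\<Sum>i\<in>UNIV - {p j}. w s j (Some i) * g' i j a s)) else g' i j a)" for i j a
  have h_alg: "h i j a \<in> alg \<Psi>3" for i j a
    unfolding h_def by (auto intro!: alg_add alg_mult alg_sum g'_alg up[OF y1] up[OF w1])
  have h_eq: "h i j a s = jacobian_matrix (F s) (x s $ j) $ i $ a" if s: "s \<in> S" for i j a s
  proof (cases "i = p j")
    case True
    have "w s j None * (x s $ j - rho (x s, t s)) $ a +
        (\<Sum>i\<in>UNIV. w s j (Some i) * jacobian_matrix (F s) (x s $ j) $ i $ a) = 0"
      using mult[OF s] unfolding multiplier_eq_def by blast
    then show ?thesis
      using True wp[OF s, of j] by (simp add: h_def y_def g'_eq[OF s] sum.remove[of UNIV "p j"] algebra_simps)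
  qed (use g'_eq[OF s] in \<open>simp add: h_def\<close>)

  have "growth_le S (\<Psi>3 \<union> u ` Sigma B (\<lambda>i. monoms_upto (d i))) (card (coefficient_index d :: ('c \<times> 'n monom) set))"
  proof (rule growth_le_linear_systems[OF _ _ _ growth3, where R=UNIV
        and A="\<lambda>i (j, \<rho>) m s. jet \<rho> m (x s $ j)"
        and b="\<lambda>i (j, \<rho>). case \<rho> of None \<Rightarrow> (\<lambda>_. 0) | Some a \<Rightarrow> h i j a"])
    show "(case q of (j, \<rho>) \<Rightarrow> \<lambda>m s. jet \<rho> m (x s $ j)) m \<in> alg \<Psi>3" for q m
      by (cases q) (auto intro: jet3 simp del: jet.simps)
    show "(case q of (j, \<rho>) \<Rightarrow> case \<rho> of None \<Rightarrow> \<lambda>_. 0 | Some a \<Rightarrow> h i j a) \<in> alg \<Psi>3" for i q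
      by (auto intro: h_alg split: prod.splits option.splits)
    show "(\<Sum>m\<in>monoms_upto (d i). (case q of (j, \<rho>) \<Rightarrow> \<lambda>m s. jet \<rho> m (x s $ j)) m s * u (i, m) s) =
      (case q of (j, \<rho>) \<Rightarrow> case \<rho> of None \<Rightarrow> \<lambda>_. 0 | Some a \<Rightarrow> h i j a) s" if s: "s \<in> S" for i q s
    proof -
      obtain j \<rho> where q: "q = (j, \<rho>)" by fastforce
      show ?thesis
      proof (cases \<rho>)
        case None
        then show ?thesis using base[OF s] peval_monoms_upto[OF deg[OF s], of i "x s $ j"]
          by (simp add: base_config_def u_def coefficients_def mult.commute q)
      next
        case (Some a)
        then show ?thesis using jacobian_matrix_monoms_upto[where F="F s" and i=i, OF deg[OF s], of "x s $ j" a]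
          by (simp add: u_def coefficients_def mult.commute q h_eq[OF s] del: jet.simps)
      qed
    qed
    show "l q = 0" if i: "i \<in> B" and s: "s \<in> S"
      and l: "\<And>m. m \<in> monoms_upto (d i) \<Longrightarrow> (\<Sum>q\<in>UNIV. l q * (case q of (j, \<rho>) \<Rightarrow> \<lambda>m s. jet \<rho> m (x s $ j)) m s) = 0"
      for i s l q
    proof -
      have "d i \<ge> 3" using i d[of i] by (auto simp: B_def)
      moreover have "(\<Sum>(j, \<rho>)\<in>UNIV. l (j, \<rho>) * jet \<rho> m (x s $ j)) = 0" if "m \<in> monoms_upto (d i)" for m
        using l[OF that] by (simp add: case_prod_unfold)
      ultimately show ?thesis
        using hermite_independent[of "x s" "d i" l] base[OF s] by (cases q) (auto simp: base_config_def)
    qed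
    have "card (coefficient_index d :: ('c \<times> 'n monom) set) = (\<Sum>i\<in>L \<union> B. card (monoms_upto (d i) :: 'n monom set))"
      unfolding coefficient_index_def LB(1) by (rule card_SigmaI) (auto intro: finite_monoms_upto)
    also have "\<dots> = \<Lambda> + (\<Sum>i\<in>B. card (monoms_upto (d i) :: 'n monom set))"
      unfolding \<Lambda>_def using LB by (intro sum.union_disjoint) auto
    finally show "k * b * (n + 1) + \<Lambda> + (\<Sum>i\<in>B. card (monoms_upto (d i) :: 'n monom set)) \<le>
        card (coefficient_index d :: ('c \<times> 'n monom) set) + card B * card (UNIV :: ('k \<times> 'n option) set)"
      by (simp add: k_def n_def b_def card_cartesian_product mult_ac flip: UNIV_Times_UNIV)
  qed (auto intro: finite_monoms_upto)
  moreover define \<Psi>4 where "\<Psi>4 = \<Psi>3 \<union> u ` Sigma B (\<lambda>i. monoms_upto (d i))"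
  ultimately have growth4: "growth_le S \<Psi>4 (card (coefficient_index d :: ('c \<times> 'n monom) set))" by simp
  have "finite ((\<lambda>h s. h (x s, t s)) ` (config_coordinates :: ((complex ^ 'n ^ 'k) \<times> (complex ^ 'k) \<Rightarrow> complex) set))"
    by (simp add: config_coordinates_def)
  with growth4 have "growth_le S (\<Psi>4 \<union> (\<lambda>h s. h (x s, t s)) ` config_coordinates)
      (card (coefficient_index d :: ('c \<times> 'n monom) set))"
  proof (rule growth_le_alg)
    fix f assume "f \<in> (\<lambda>h s. h (x s, t s)) ` config_coordinates"
    then consider j a where "f = (\<lambda>s. x s $ j $ a)" | j where "f = (\<lambda>s. t s $ j)"
      by (auto simp: config_coordinates_def)
    then have "f \<in> alg \<Psi>1"
    proof cases
      case 2
      then show ?thesis by (intro alg_gen) (auto simp: \<Psi>1_def \<Psi>0_def)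
    qed (simp add: x1)
    then have "f \<in> alg \<Psi>4" by (rule alg_mono) (auto simp: \<Psi>4_def \<Psi>3_def \<Psi>2_def)
    then show "\<exists>g\<in>alg \<Psi>4. \<forall>s\<in>S. f s = g s" by blast
  qed
  moreover have "u ` coefficient_index d \<subseteq> \<Psi>4"
  proof (rule image_subsetI)
    fix v :: "'c \<times> 'n monom" assume v: "v \<in> coefficient_index d"
    then have "v \<in> Sigma L (\<lambda>i. monoms_upto (d i)) \<or> v \<in> Sigma B (\<lambda>i. monoms_upto (d i))"
      by (auto simp: coefficient_index_def L_def B_def)
    then show "u v \<in> \<Psi>4" by (auto simp: \<Psi>4_def \<Psi>3_def \<Psi>2_def)
  qed
  ultimately show ?thesis
    unfolding u_def by (elim growth_le_subset) auto
qed

lemma generically_finite_coordinate: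
  fixes d :: "'c::finite \<Rightarrow> nat" and h :: "(complex ^ 'n::finite ^ 'k::finite) \<times> (complex ^ 'k) \<Rightarrow> complex"
  assumes d: "\<And>i. 1 \<le> d i \<and> d i \<noteq> 2" and h: "h \<in> config_coordinates"
  shows "\<exists>q. q \<noteq> 0 \<and> (\<forall>m\<in>Poly_Mapping.keys q. Poly_Mapping.keys m \<subseteq> coefficient_index d) \<and>
    (\<forall>F. (\<forall>i. degree_le (d i) (F i)) \<longrightarrow> peval q (coefficients F) \<noteq> 0 \<longrightarrow> finite (h ` critical_configs d F))"
proof -
  define S :: "('k \<Rightarrow> 'c) \<Rightarrow> (('c \<Rightarrow> 'n cpoly) \<times> (complex ^ 'n ^ 'k) \<times> (complex ^ 'k) \<times> ('k \<Rightarrow> 'c option \<Rightarrow> complex)) set"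
    where "S p = {(F, x, t, w). (\<forall>i. degree_le (d i) (F i)) \<and> base_config F x t \<and>
      multiplier_eq F x t w \<and> (\<forall>j. w j (Some (p j)) = -1)}" for p
  define P where "P = {p :: 'k \<Rightarrow> 'c. \<forall>j. d (p j) \<noteq> 1}"
  let ?u = "\<lambda>v s. coefficients (fst s) v" and ?h = "\<lambda>s. h (fst (snd s), fst (snd (snd s)))"
  let ?J = "coefficient_index d :: ('c \<times> 'n monom) set"
  have "growth_le (\<Union>p\<in>P. S p) (?u ` ?J \<union> {?h}) (card ?J)"
  proof (rule growth_le_UN)
    show "finite P" by simp
    fix p assume "p \<in> P"
    have "growth_le (S p) (?u ` ?J \<union> (\<lambda>h s. h (fst (snd s), fst (snd (snd s)))) ` config_coordinates) (card ?J)"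
      by (rule growth_le_incidence[where p=p and w="\<lambda>s. snd (snd (snd s))"])
        (use d \<open>p \<in> P\<close> in \<open>auto simp: S_def P_def\<close>)
    then show "growth_le (S p) (?u ` ?J \<union> {?h}) (card ?J)"
      by (rule growth_le_subset) (use h in auto)
  qed
  from growth_le_imp_generically_finite[OF this finite_coefficient_index, of ?u ?h]
  obtain q where q: "q \<noteq> 0" "\<forall>m\<in>Poly_Mapping.keys q. Poly_Mapping.keys m \<subseteq> ?J"
    and fin: "\<And>v. peval q v \<noteq> 0 \<Longrightarrow> finite {?h s | s. s \<in> (\<Union>p\<in>P. S p) \<and> (\<forall>j\<in>?J. ?u j s = v j)}"
    by auto
  have "finite (h ` critical_configs d F)"
    if deg: "\<forall>i. degree_le (d i) (F i)" and F: "peval q (coefficients F) \<noteq> 0" for F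
  proof (rule finite_subset[OF _ fin[OF F]], clarify)
    fix x :: "complex ^ 'n ^ 'k" and t :: "complex ^ 'k" assume "(x, t) \<in> critical_configs d F"
    then obtain w :: "'k \<Rightarrow> 'c option \<Rightarrow> complex" where base: "base_config F x t" and mult: "multiplier_eq F x t w"
      and "\<forall>j. \<exists>i. d i \<noteq> 1 \<and> w j (Some i) \<noteq> 0" by (auto simp: critical_configs_def)
    then obtain p :: "'k \<Rightarrow> 'c" where p: "\<And>j. d (p j) \<noteq> 1 \<and> w j (Some (p j)) \<noteq> 0" by metis
    \<comment> \<open>The incidence variety requires the normalization \<open>w j (Some (p j)) = -1\<close>.\<close>
    define w' where "w' j q = - w j q / w j (Some (p j))" for j q
    have "multiplier_eq F x t w'"
      unfolding multiplier_eq_def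
    proof (intro allI)
      fix j a
      have "w' j None * (x $ j - rho (x, t)) $ a + (\<Sum>i\<in>UNIV. w' j (Some i) * jacobian_matrix F (x $ j) $ i $ a)
        = - (w j None * (x $ j - rho (x, t)) $ a + (\<Sum>i\<in>UNIV. w j (Some i) * jacobian_matrix F (x $ j) $ i $ a))
          / w j (Some (p j))"
        by (simp add: w'_def sum_divide_distrib sum_negf add_divide_distrib diff_divide_distrib)
      also have "\<dots> = - 0 / w j (Some (p j))" using mult unfolding multiplier_eq_def by metis
      finally show "w' j None * (x $ j - rho (x, t)) $ a + (\<Sum>i\<in>UNIV. w' j (Some i) * jacobian_matrix F (x $ j) $ i $ a) = 0"
        by simp
    qed
    then have "(F, x, t, w') \<in> S p" using deg base p by (simp add: S_def w'_def)
    then show "\<exists>s. h (x, t) = ?h s \<and> s \<in> (\<Union>p\<in>P. S p) \<and> (\<forall>j\<in>?J. ?u j s = coefficients F j)"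
      using p by (intro exI[of _ "(F, x, t, w')"]) (auto simp: P_def)
  qed
  with q show ?thesis by blast
qed

section \<open>Generic properties\<close>

text \<open>Dedekind's argument: subtracting \<open>\<phi> e\<^sub>0 h\<close> times a relation from its translate by \<open>h\<close> removes one
  character.\<close>

lemma characters_independent:
  fixes \<phi> :: "'e \<Rightarrow> 'g \<Rightarrow> complex"
  assumes "finite E" "\<And>e g h. e \<in> E \<Longrightarrow> g \<in> G \<Longrightarrow> h \<in> G \<Longrightarrow> \<phi> e (mul g h) = \<phi> e g * \<phi> e h"
    and "\<And>g h. g \<in> G \<Longrightarrow> h \<in> G \<Longrightarrow> mul g h \<in> G" "\<And>e g. e \<in> E \<Longrightarrow> g \<in> G \<Longrightarrow> \<phi> e g \<noteq> 0" "G \<noteq> {}"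
    and "\<And>e e'. e \<in> E \<Longrightarrow> e' \<in> E \<Longrightarrow> e \<noteq> e' \<Longrightarrow> \<exists>g\<in>G. \<phi> e g \<noteq> \<phi> e' g"
    and "\<And>g. g \<in> G \<Longrightarrow> (\<Sum>e\<in>E. a e * \<phi> e g) = 0" "e \<in> E"
  shows "a e = 0"
  using assms(1,2,4,6-8)
proof (induction E arbitrary: a e rule: finite_induct)
  case (insert e0 E)
  have E: "a e' = 0" if e': "e' \<in> E" for e'
  proof -
    obtain h where h: "h \<in> G" "\<phi> e0 h \<noteq> \<phi> e' h"
      using insert.prems(3)[of e0 e'] e' insert.hyps by auto
    have "a e' * (\<phi> e' h - \<phi> e0 h) = 0"
    proof (rule insert.IH[where a="\<lambda>e. a e * (\<phi> e h - \<phi> e0 h)", OF _ _ _ _ e'])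
      fix g assume g: "g \<in> G"
      have "(\<Sum>e\<in>E. a e * (\<phi> e h - \<phi> e0 h) * \<phi> e g) =
          (\<Sum>e\<in>insert e0 E. a e * (\<phi> e h - \<phi> e0 h) * \<phi> e g)"
        using insert.hyps by simp
      also have "\<dots> = (\<Sum>e\<in>insert e0 E. a e * \<phi> e (mul g h) - \<phi> e0 h * (a e * \<phi> e g))"
        by (intro sum.cong) (simp_all add: insert.prems(1)[OF _ g h(1)] algebra_simps)
      also have "\<dots> = 0"
        using insert.prems(4)[OF assms(3)[OF g h(1)]] insert.prems(4)[OF g]
        by (simp add: sum_subtractf flip: sum_distrib_left)
      finally show "(\<Sum>e\<in>E. a e * (\<phi> e h - \<phi> e0 h) * \<phi> e g) = 0" .
    qed (use insert.prems in auto)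
    then show ?thesis using h(2) by auto
  qed
  obtain g where "g \<in> G" using assms(5) by blast
  then have "a e0 = 0" using insert.prems(4)[of g] insert.prems(2)[of e0 g] insert.hyps E by simp
  then show ?case using E insert.prems by auto
qed simp

lemma two_power_complex_inject: "(2 :: complex) ^ a = 2 ^ b \<longleftrightarrow> a = b"
  using of_nat_eq_iff[of "2 ^ a" "2 ^ b", where ?'a=complex] by simp

lemma polynomial_nonvanishing_point:
  assumes "p \<noteq> 0" shows "\<exists>x. peval p x \<noteq> 0"
proof (rule ccontr)
  assume "\<not> ?thesis"
  then have zero: "(\<Sum>m\<in>Poly_Mapping.keys p. Poly_Mapping.lookup p m * mon m x) = 0" for x
    by (simp add: peval_mon)
  obtain m where m: "m \<in> Poly_Mapping.keys p" using assms by (metis all_not_in_conv keys_eq_empty)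
  have "Poly_Mapping.lookup p m = 0"
  proof (rule characters_independent[where E="Poly_Mapping.keys p" and \<phi>=mon
        and G="{x. \<forall>v. x v \<noteq> 0}" and mul="\<lambda>x y v. x v * y v"])
    show "{x :: _ \<Rightarrow> complex. \<forall>v. x v \<noteq> 0} \<noteq> {}" by (auto intro!: exI[of _ "\<lambda>_. 1"])
    fix m m' :: "'a monom" assume "m \<noteq> m'"
    then obtain v where v: "Poly_Mapping.lookup m v \<noteq> Poly_Mapping.lookup m' v"
      by (auto simp: poly_mapping_eq_iff fun_eq_iff)
    have mon: "mon m (\<lambda>w. if w = v then 2 else 1) = 2 ^ Poly_Mapping.lookup m v" for m :: "'a monom"
      by (subst mon_superset[of "insert v (Poly_Mapping.keys m)"])
        (auto simp: prod.insert_remove intro!: prod.neutral)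
    have "mon m (\<lambda>w. if w = v then 2 else 1) \<noteq> mon m' (\<lambda>w. if w = v then 2 else 1)"
      unfolding mon using v by (simp add: two_power_complex_inject)
    then show "\<exists>x\<in>{x. \<forall>v. x v \<noteq> 0}. mon m x \<noteq> mon m' x"
      by (intro bexI[of _ "\<lambda>w. if w = v then 2 else 1"]) auto
  qed (use m zero in \<open>auto simp: mon_mult mon_def\<close>)
  then show False using m by (simp add: in_keys_iff)
qed

definition multidegree :: "('c \<times> 'b) monom \<Rightarrow> 'c \<Rightarrow> nat" where
  "multidegree m i = (\<Sum>v\<in>{v\<in>Poly_Mapping.keys m. fst v = i}. Poly_Mapping.lookup m v)"

definition torus_act :: "('c \<Rightarrow> complex) \<Rightarrow> ('c \<times> 'b \<Rightarrow> complex) \<Rightarrow> 'c \<times> 'b \<Rightarrow> complex" where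
  "torus_act \<kappa> x v = \<kappa> (fst v) * x v"

lemma mon_torus_act:
  "mon m (torus_act \<kappa> x) = (\<Prod>i\<in>UNIV. \<kappa> i ^ multidegree m i) * mon m x" for \<kappa> :: "'c::finite \<Rightarrow> complex"
proof -
  have "mon m (\<lambda>v. \<kappa> (fst v)) =
      (\<Prod>i\<in>UNIV. \<Prod>v\<in>{v\<in>Poly_Mapping.keys m. fst v = i}. \<kappa> (fst v) ^ Poly_Mapping.lookup m v)"
    unfolding mon_def by (rule prod.group[symmetric]) auto
  also have "\<dots> = (\<Prod>i\<in>UNIV. \<kappa> i ^ multidegree m i)"
    by (intro prod.cong) (auto simp: multidegree_def power_sum)
  finally show ?thesis unfolding torus_act_def mon_mult by simp
qed

lemma multihomogeneous_torus_act:
  fixes g :: "('c::finite \<times> 'b) cpoly"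
  assumes "multihomogeneous g" "\<And>i. \<kappa> i \<noteq> 0" "peval g x \<noteq> 0"
  shows "peval g (torus_act \<kappa> x) \<noteq> 0"
proof -
  obtain e where "\<And>m i. m \<in> Poly_Mapping.keys g \<Longrightarrow> multidegree m i = e i"
    using assms(1) by (auto simp: multihomogeneous_def multidegree_def)
  then have "peval g (torus_act \<kappa> x) = (\<Prod>i\<in>UNIV. \<kappa> i ^ e i) * peval g x"
    by (simp add: peval_mon mon_torus_act sum_distrib_left mult_ac)
  then show ?thesis using assms(2,3) by simp
qed

text \<open>The scalings of the equations act on a polynomial through distinct characters on its
  multihomogeneous components. So where a component does not vanish, some scaling moves the point
  to where the polynomial does not vanish.\<close>

lemma multihomogeneous_component:
  fixes p :: "('c::finite \<times> 'b) cpoly"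
  assumes "p \<noteq> 0"
  shows "\<exists>g. g \<noteq> 0 \<and> multihomogeneous g \<and> Poly_Mapping.keys g \<subseteq> Poly_Mapping.keys p \<and>
    (\<forall>x. peval g x \<noteq> 0 \<longrightarrow> (\<exists>\<kappa>. (\<forall>i. \<kappa> i \<noteq> 0) \<and> peval p (torus_act \<kappa> x) \<noteq> 0))"
proof -
  let ?K = "Poly_Mapping.keys p"
  obtain m0 where m0: "m0 \<in> ?K" using assms by (metis all_not_in_conv keys_eq_empty)
  define comp where "comp e = (\<Sum>m\<in>{m\<in>?K. multidegree m = e}. Poly_Mapping.single m (Poly_Mapping.lookup p m))" for e
  define g where "g = comp (multidegree m0)"
  have peval_comp: "peval (comp e) x = (\<Sum>m\<in>{m\<in>?K. multidegree m = e}. Poly_Mapping.lookup p m * mon m x)" for e x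
    by (simp add: comp_def peval_sum peval_single)
  have "Poly_Mapping.keys g \<subseteq> (\<Union>m\<in>{m\<in>?K. multidegree m = multidegree m0}.
      Poly_Mapping.keys (Poly_Mapping.single m (Poly_Mapping.lookup p m)))"
    unfolding g_def comp_def by (rule keys_sum_subset)
  then have keys: "Poly_Mapping.keys g \<subseteq> {m\<in>?K. multidegree m = multidegree m0}"
    by (auto split: if_splits)
  have "Poly_Mapping.lookup g m0 = (\<Sum>m\<in>{m\<in>?K. multidegree m = multidegree m0}. if m = m0 then Poly_Mapping.lookup p m0 else 0)"
    unfolding g_def comp_def lookup_sum by (intro sum.cong) (auto simp: lookup_single when_def)
  also have "\<dots> = Poly_Mapping.lookup p m0" using m0 by simp
  finally have "g \<noteq> 0" using m0 by (auto simp: in_keys_iff)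
  moreover have "multihomogeneous g"
    unfolding multihomogeneous_def multidegree_def[symmetric] using keys by (intro exI[of _ "multidegree m0"]) auto
  moreover have "\<exists>\<kappa>. (\<forall>i. \<kappa> i \<noteq> 0) \<and> peval p (torus_act \<kappa> x) \<noteq> 0" if x: "peval g x \<noteq> 0" for x
  proof (rule ccontr)
    assume "\<not> ?thesis"
    then have zero: "\<And>\<kappa>. (\<forall>i. \<kappa> i \<noteq> 0) \<Longrightarrow> peval p (torus_act \<kappa> x) = 0" by blast
    let ?\<phi> = "\<lambda>e (\<kappa> :: 'c \<Rightarrow> complex). \<Prod>i\<in>UNIV. \<kappa> i ^ e i"
    have "peval (comp (multidegree m0)) x = 0"
    proof (rule characters_independent[where E="multidegree ` ?K" and \<phi>="?\<phi>" and G="{\<kappa>. \<forall>i. \<kappa> i \<noteq> 0}"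
          and mul="\<lambda>x y i. x i * y i" and a="\<lambda>e. peval (comp e) x"])
      show "{\<kappa> :: 'c \<Rightarrow> complex. \<forall>i. \<kappa> i \<noteq> 0} \<noteq> {}" by (auto intro!: exI[of _ "\<lambda>_. 1"])
      show "multidegree m0 \<in> multidegree ` ?K" using m0 by simp
      show "(\<Sum>e\<in>multidegree ` ?K. peval (comp e) x * ?\<phi> e \<kappa>) = 0" if "\<kappa> \<in> {\<kappa>. \<forall>i. \<kappa> i \<noteq> 0}" for \<kappa>
      proof -
        have "peval (comp e) x * ?\<phi> e \<kappa> =
            (\<Sum>m\<in>{m\<in>?K. multidegree m = e}. Poly_Mapping.lookup p m * mon m (torus_act \<kappa> x))" for e
          by (simp add: peval_comp sum_distrib_left sum_distrib_right mon_torus_act mult_ac)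
        then have "(\<Sum>e\<in>multidegree ` ?K. peval (comp e) x * ?\<phi> e \<kappa>) =
            (\<Sum>e\<in>multidegree ` ?K. \<Sum>m\<in>{m\<in>?K. multidegree m = e}. Poly_Mapping.lookup p m * mon m (torus_act \<kappa> x))"
          by simp
        also have "\<dots> = peval p (torus_act \<kappa> x)"
          unfolding peval_mon by (rule sum.group) auto
        finally show ?thesis using zero that by simp
      qed
      fix e e' :: "'c \<Rightarrow> nat" assume "e \<noteq> e'"
      then obtain i where i: "e i \<noteq> e' i" by auto
      have two: "?\<phi> e (\<lambda>j. if j = i then 2 else 1) = 2 ^ e i" for e :: "'c \<Rightarrow> nat"
        by (simp add: prod.remove[of UNIV i])
      then have "?\<phi> e (\<lambda>j. if j = i then 2 else 1) \<noteq> ?\<phi> e' (\<lambda>j. if j = i then 2 else 1)"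
        unfolding two using i by (simp add: two_power_complex_inject)
      then show "\<exists>\<kappa>\<in>{\<kappa>. \<forall>i. \<kappa> i \<noteq> 0}. ?\<phi> e \<kappa> \<noteq> ?\<phi> e' \<kappa>"
        by (intro bexI[of _ "\<lambda>j. if j = i then 2 else 1"]) auto
    qed (auto simp: power_mult_distrib prod.distrib)
    then show False using x by (simp add: g_def)
  qed
  ultimately show ?thesis using keys by (intro exI[of _ g]) auto
qed

text \<open>Restricted to a line, a polynomial that does not vanish at one point has finitely many zeros.
  So finitely many polynomials that do not vanish identically on a linear subspace have a common
  point of nonvanishing in it.\<close>

lemma finite_zeros_on_line:
  assumes "peval p (\<lambda>v. x v + \<tau>0 * y v) \<noteq> 0"
  shows "finite {\<tau>. peval p (\<lambda>v. x v + \<tau> * y v) = 0}"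
proof -
  have "(\<lambda>\<tau>. x v + \<tau> * y v) \<in> alg {\<lambda>\<tau>. \<tau>}" for v
    by (intro alg_add alg_mult alg_const alg_gen) auto
  then have "(\<lambda>\<tau>. peval p (\<lambda>v. x v + \<tau> * y v)) \<in> alg {\<lambda>\<tau>. \<tau>}"
    by (intro peval_alg[where \<xi>="\<lambda>v \<tau>. x v + \<tau> * y v"])
  then obtain D where D: "(\<lambda>\<tau>. peval p (\<lambda>v. x v + \<tau> * y v)) \<in> polys {\<lambda>\<tau>. \<tau>} D" by (auto simp: alg_def)
  obtain c where c: "\<forall>e\<le>D. c e \<in> polys {} D"
    "\<And>\<tau>. peval p (\<lambda>v. x v + \<tau> * y v) = (\<Sum>e\<le>D. c e \<tau> * \<tau> ^ e)"
    using polys_insert[OF D] by blast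
  have "\<exists>a. f = (\<lambda>_. a)" if "f \<in> polys {} D" for f :: "complex \<Rightarrow> complex" and D
    using that by induction auto
  then have "\<forall>e\<le>D. \<exists>a. c e = (\<lambda>_. a)" using c(1) by blast
  then obtain a where a: "\<And>e. e \<le> D \<Longrightarrow> c e = (\<lambda>_. a e)" by metis
  have eq: "peval p (\<lambda>v. x v + \<tau> * y v) = (\<Sum>e\<le>D. a e * \<tau> ^ e)" for \<tau>
    unfolding c(2) by (intro sum.cong) (auto simp: a)
  then have "\<exists>e\<le>D. a e \<noteq> 0" using assms by (metis (no_types, lifting) atMost_iff mult_zero_left sum.neutral)
  then show ?thesis unfolding eq by (simp add: polyfun_finite_roots)
qed

lemma common_nonvanishing_point:
  assumes "finite P" "\<And>p. p \<in> P \<Longrightarrow> \<exists>x. (\<forall>v. v \<notin> J \<longrightarrow> x v = 0) \<and> peval p x \<noteq> 0"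
  shows "\<exists>x. (\<forall>v. v \<notin> J \<longrightarrow> x v = 0) \<and> (\<forall>p\<in>P. peval p x \<noteq> 0)"
  using assms
proof (induction P rule: finite_induct)
  case empty
  show ?case by (intro exI[of _ "\<lambda>_. 0"]) auto
next
  case (insert p P)
  obtain x where x: "\<forall>v. v \<notin> J \<longrightarrow> x v = 0" "\<forall>p\<in>P. peval p x \<noteq> 0" using insert by auto
  obtain y where y: "\<forall>v. v \<notin> J \<longrightarrow> y v = 0" "peval p y \<noteq> 0" using insert.prems[of p] by blast
  let ?l = "\<lambda>\<tau> v. x v + \<tau> * (y v - x v)"
  have "finite {\<tau>. peval q (?l \<tau>) = 0}" if "q \<in> insert p P" for q
  proof (cases "q = p")
    case True
    show ?thesis by (rule finite_zeros_on_line[of _ _ 1]) (use y True in simp)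
  next
    case False
    show ?thesis by (rule finite_zeros_on_line[of _ _ 0]) (use x that False in simp)
  qed
  then have "finite (\<Union>q\<in>insert p P. {\<tau>. peval q (?l \<tau>) = 0})" using insert.hyps by blast
  then obtain \<tau> where "\<tau> \<notin> (\<Union>q\<in>insert p P. {\<tau>. peval q (?l \<tau>) = 0})"
    using ex_new_if_finite[OF infinite_UNIV_char_0] by blast
  then show ?case using x(1) y(1) by (intro exI[of _ "?l \<tau>"]) auto
qed

text \<open>Genericity on the vector space of systems, in a form that descends to the product of projective
  spaces: the exceptional set is invariant under scaling, and proper because \<open>g\<close> involves only
  variables that are coefficients of the systems.\<close>

definition generic :: "('c::finite \<Rightarrow> nat) \<Rightarrow> (('c \<Rightarrow> ('n::finite) cpoly) \<Rightarrow> bool) \<Rightarrow> bool" where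
  "generic d P \<longleftrightarrow> (\<exists>g. multihomogeneous g \<and> g \<noteq> 0 \<and>
    (\<forall>m\<in>Poly_Mapping.keys g. Poly_Mapping.keys m \<subseteq> coefficient_index d) \<and>
    (\<forall>F. (\<forall>i. degree_le (d i) (F i)) \<longrightarrow> peval g (coefficients F) \<noteq> 0 \<longrightarrow> P F))"

definition rescale :: "('c \<Rightarrow> complex) \<Rightarrow> ('c \<Rightarrow> 'n cpoly) \<Rightarrow> 'c \<Rightarrow> 'n cpoly" where
  "rescale \<kappa> F i = Poly_Mapping.map ((*) (\<kappa> i)) (F i)"

lemma lookup_rescale: "Poly_Mapping.lookup (rescale \<kappa> F i) m = \<kappa> i * Poly_Mapping.lookup (F i) m"
  by (simp add: rescale_def map.rep_eq when_def)

lemma coefficients_rescale: "coefficients (rescale \<kappa> F) = torus_act \<kappa> (coefficients F)"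
  by (auto simp: coefficients_def torus_act_def lookup_rescale fun_eq_iff)

lemma degree_le_rescale: "degree_le d (F i) \<Longrightarrow> degree_le d (rescale \<kappa> F i)"
  by (auto simp: degree_le_def in_keys_iff lookup_rescale)

lemma generic_if_rescale_invariant:
  assumes q: "q \<noteq> 0" "\<And>m. m \<in> Poly_Mapping.keys q \<Longrightarrow> Poly_Mapping.keys m \<subseteq> coefficient_index d"
    and P: "\<And>F. (\<And>i. degree_le (d i) (F i)) \<Longrightarrow> peval q (coefficients F) \<noteq> 0 \<Longrightarrow> P F"
    and invariant: "\<And>F \<kappa>. (\<And>i. degree_le (d i) (F i)) \<Longrightarrow> (\<And>i. \<kappa> i \<noteq> 0) \<Longrightarrow> P (rescale \<kappa> F) \<Longrightarrow> P F"
  shows "generic d P"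
proof -
  obtain g where g: "g \<noteq> 0" "multihomogeneous g" "Poly_Mapping.keys g \<subseteq> Poly_Mapping.keys q"
    "\<And>x. peval g x \<noteq> 0 \<Longrightarrow> \<exists>\<kappa>. (\<forall>i. \<kappa> i \<noteq> 0) \<and> peval q (torus_act \<kappa> x) \<noteq> 0"
    using multihomogeneous_component[OF q(1)] by blast
  have "P F" if deg: "\<forall>i. degree_le (d i) (F i)" and F: "peval g (coefficients F) \<noteq> 0" for F
  proof -
    obtain \<kappa> where \<kappa>: "\<forall>i. \<kappa> i \<noteq> 0" "peval q (torus_act \<kappa> (coefficients F)) \<noteq> 0" using g(4)[OF F] by blast
    then have "P (rescale \<kappa> F)" using deg by (intro P) (auto simp: degree_le_rescale coefficients_rescale)
    then show ?thesis using deg \<kappa>(1) by (intro invariant[of F \<kappa>]) auto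
  qed
  then show ?thesis unfolding generic_def using g q(2) by blast
qed

definition system_of :: "('c::finite \<Rightarrow> nat) \<Rightarrow> ('c \<times> ('n::finite) monom \<Rightarrow> complex) \<Rightarrow> 'c \<Rightarrow> 'n cpoly" where
  "system_of d x i = (\<Sum>m\<in>monoms_upto (d i). Poly_Mapping.single m (x (i, m)))"

lemma coefficients_system_of:
  "coefficients (system_of d x) v = (if v \<in> coefficient_index d then x v else 0)"
proof -
  obtain i m where v: "v = (i, m)" by fastforce
  have "coefficients (system_of d x) v = (\<Sum>m'\<in>monoms_upto (d i). if m' = m then x (i, m) else 0)"
    unfolding v coefficients_def system_of_def lookup_sum case_prod_conv
    by (intro sum.cong) (auto simp: lookup_single when_def)
  then show ?thesis by (simp add: v coefficient_index_def finite_monoms_upto)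
qed

lemma degree_le_system_of: "degree_le (d i) (system_of d x i)"
proof -
  have "Poly_Mapping.keys (system_of d x i) \<subseteq>
      (\<Union>m\<in>monoms_upto (d i). Poly_Mapping.keys (Poly_Mapping.single m (x (i, m))))"
    unfolding system_of_def by (rule keys_sum_subset)
  then show ?thesis by (auto simp: degree_le_def monoms_upto_def split: if_splits)
qed

lemma generate_topology_on_basic_nbhd:
  assumes "generate_topology_on \<B> U" "u \<in> U"
  shows "\<exists>\<F>. finite \<F> \<and> \<F> \<subseteq> \<B> \<and> u \<in> \<Inter>\<F> \<and> \<Inter>\<F> \<subseteq> U"
  using assms
proof induction
  case (Int a b)
  then obtain \<F> \<G> where "finite \<F>" "\<F> \<subseteq> \<B>" "u \<in> \<Inter>\<F>" "\<Inter>\<F> \<subseteq> a" "finite \<G>" "\<G> \<subseteq> \<B>" "u \<in> \<Inter>\<G>" "\<Inter>\<G> \<subseteq> b"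
    by auto
  then show ?case by (intro exI[of _ "\<F> \<union> \<G>"]) auto
next
  case (UN K)
  then obtain k where "k \<in> K" "u \<in> k" by blast
  then show ?case using UN.IH by (meson Sup_upper order_trans)
next
  case (Basis s)
  then show ?case by (intro exI[of _ "{s}"]) auto
qed simp

lemma system_in_proj_point:
  assumes "u \<in> param_space d"
  shows "system u i \<noteq> 0" "degree_le (d i) (system u i)"
proof -
  obtain f where f: "u i = proj_point f" "f \<noteq> 0" "degree_le (d i) f"
    using assms by (auto simp: param_space_def hypersurfaces_def)
  have "f \<in> u i" unfolding f(1) proj_point_def
    by (intro CollectI exI[of _ 1]) (auto intro!: poly_mapping_eqI simp: map.rep_eq when_def)
  then have "system u i \<in> proj_point f" unfolding system_def f(1)[symmetric] by (rule someI)
  then obtain a where a: "a \<noteq> 0" "system u i = Poly_Mapping.map ((*) a) f" by (auto simp: proj_point_def)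
  then have lookup: "Poly_Mapping.lookup (system u i) m = a * Poly_Mapping.lookup f m" for m
    by (simp add: map.rep_eq when_def)
  show "system u i \<noteq> 0" using f(2) a(1) lookup by (metis lookup_zero mult_eq_0_iff poly_mapping_eqI)
  show "degree_le (d i) (system u i)" using f(3) by (auto simp: degree_le_def in_keys_iff lookup)
qed

lemma homogeneous_coords_eq: "homogeneous_coords u = coefficients (system u)"
  by (simp add: homogeneous_coords_def coefficients_def)

text \<open>Nonempty open subsets of the parameter space meet: a point of nonvanishing common to all the
  polynomials concerned is found among the systems.\<close>

lemma for_general_generic:
  fixes d :: "'c::finite \<Rightarrow> nat" and \<P> :: "(('c \<Rightarrow> ('n::finite) cpoly) \<Rightarrow> bool) set"
  assumes U: "openin (param_zariski d) U" "U \<noteq> {}" and "finite \<P>" and "\<And>P. P \<in> \<P> \<Longrightarrow> generic d P"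
  shows "for_general (param_zariski d) U (\<lambda>u. \<forall>P\<in>\<P>. P (system u))"
proof -
  let ?D = "\<lambda>g. {u \<in> param_space d. peval g (homogeneous_coords u) \<noteq> 0}"
  let ?B = "{?D g | g. multihomogeneous g}"
  have "\<forall>P\<in>\<P>. \<exists>g. multihomogeneous g \<and> g \<noteq> 0 \<and>
      (\<forall>m\<in>Poly_Mapping.keys g. Poly_Mapping.keys m \<subseteq> coefficient_index d) \<and>
      (\<forall>F. (\<forall>i. degree_le (d i) (F i)) \<longrightarrow> peval g (coefficients F) \<noteq> 0 \<longrightarrow> P F)"
    using assms(4) unfolding generic_def by blast
  from bchoice[OF this] obtain G where "\<forall>P\<in>\<P>. multihomogeneous (G P) \<and> G P \<noteq> 0 \<and>
      (\<forall>m\<in>Poly_Mapping.keys (G P). Poly_Mapping.keys m \<subseteq> coefficient_index d) \<and>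
      (\<forall>F. (\<forall>i. degree_le (d i) (F i)) \<longrightarrow> peval (G P) (coefficients F) \<noteq> 0 \<longrightarrow> P F)"
    by (elim exE)
  note G = bspec[OF this]
  define W where "W = U \<inter> (\<Inter>P\<in>\<P>. ?D (G P))"
  have open_D: "openin (param_zariski d) (?D g)" if "multihomogeneous g" for g
    unfolding param_zariski_def by (rule topology_generated_by_Basis) (use that in blast)
  have "openin (param_zariski d) W"
  proof (cases "\<P> = {}")
    case True
    then show ?thesis using U by (simp add: W_def)
  next
    case False
    then show ?thesis unfolding W_def
      using assms(3) U(1) open_D G by (intro openin_Int openin_INT2) auto
  qed
  then have "openin (subtopology (param_zariski d) U) W"
    by (auto simp: openin_subtopology W_def)
  moreover have "P (system u)" if "u \<in> W" "P \<in> \<P>" for u P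
    using that G[OF that(2)] system_in_proj_point(2)[of u d] by (auto simp: W_def homogeneous_coords_eq)
  moreover have "W \<noteq> {}"
  proof -
    obtain u0 where u0: "u0 \<in> U" using U(2) by blast
    have "generate_topology_on ?B U"
      using U(1) by (simp add: param_zariski_def openin_topology_generated_by_iff)
    from generate_topology_on_basic_nbhd[OF this u0]
    obtain \<F> where \<F>: "finite \<F>" "\<F> \<subseteq> ?B" "u0 \<in> \<Inter>\<F>" "\<Inter>\<F> \<subseteq> U"
      by (elim exE conjE)
    have "\<forall>A\<in>\<F>. \<exists>g. multihomogeneous g \<and> A = ?D g" using \<F>(2) by blast
    from bchoice[OF this] obtain H where H: "\<forall>A\<in>\<F>. multihomogeneous (H A) \<and> A = ?D (H A)"
      by (elim exE)
    have "U \<subseteq> topspace (param_zariski d)" using U(1) by (rule openin_subset)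
    also have "\<dots> \<subseteq> param_space d" by (auto simp: param_zariski_def)
    finally have u0p: "u0 \<in> param_space d" using u0 by blast
    have "\<exists>m. m \<in> Poly_Mapping.keys (system u0 i)" for i
      using system_in_proj_point(1)[OF u0p, of i] by (metis all_not_in_conv keys_eq_empty)
    then obtain m where m: "\<And>i. m i \<in> Poly_Mapping.keys (system u0 i)" by metis
    \<comment> \<open>The last polynomials are single coordinates; they make all equations nonzero.\<close>
    define Q where "Q = H ` \<F> \<union> G ` \<P> \<union> range (\<lambda>i. Poly_Mapping.single (Poly_Mapping.single (i, m i) 1) 1)"
    have var: "peval (Poly_Mapping.single (Poly_Mapping.single v 1) 1) x = x v" for v and x :: "'c \<times> 'n monom \<Rightarrow> complex"
      by (simp add: peval_single mon_def)
    have coeff0: "coefficients (system u0) v = 0" if "v \<notin> coefficient_index d" for v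
      using that system_in_proj_point(2)[OF u0p]
      by (cases v) (auto simp: coefficient_index_def coefficients_def degree_le_def monoms_upto_def,
        metis in_keys_iff)
    have nonvanishing: "\<exists>x. (\<forall>v. v \<notin> coefficient_index d \<longrightarrow> x v = 0) \<and> peval q x \<noteq> 0" if qQ: "q \<in> Q" for q
    proof -
      consider "q \<in> H ` \<F>" | P where "P \<in> \<P>" "q = G P" | i where "q = Poly_Mapping.single (Poly_Mapping.single (i, m i) 1) 1"
        using qQ unfolding Q_def by blast
      then show ?thesis
      proof cases
        case 1
        then obtain A where A: "A \<in> \<F>" "q = H A" by blast
        then have "u0 \<in> ?D (H A)" using \<F>(3) bspec[OF H A(1)] by blast
        then show ?thesis using coeff0 A(2)
          by (intro exI[of _ "coefficients (system u0)"]) (auto simp: homogeneous_coords_eq)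
      next
        case 2
        then obtain x where x: "peval q x \<noteq> 0" using G polynomial_nonvanishing_point by blast
        have "peval q (\<lambda>v. if v \<in> coefficient_index d then x v else 0) = peval q x"
          unfolding peval_mon using G[OF 2(1)] 2(2)
          by (intro sum.cong refl arg_cong[where f="(*) _"] mon_cong) auto
        then show ?thesis using x by (intro exI[of _ "\<lambda>v. if v \<in> coefficient_index d then x v else 0"]) auto
      next
        case 3
        then show ?thesis using coeff0 m[of i]
          by (intro exI[of _ "coefficients (system u0)"]) (auto simp: var[simplified] coefficients_def in_keys_iff)
      qed
    qed
    have "finite Q" using \<F>(1) assms(3) by (simp add: Q_def)
    then have "\<exists>x. (\<forall>v. v \<notin> coefficient_index d \<longrightarrow> x v = 0) \<and> (\<forall>q\<in>Q. peval q x \<noteq> 0)"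
      by (rule common_nonvanishing_point[OF _ nonvanishing])
    then obtain x where x0: "\<forall>v. v \<notin> coefficient_index d \<longrightarrow> x v = 0" and x1: "\<forall>q\<in>Q. peval q x \<noteq> 0"
      by (elim exE conjE)
    note x = x0[rule_format] x1[rule_format]
    define F where "F = system_of d x"
    have F: "coefficients F = x" using x(1) by (auto simp: F_def coefficients_system_of)
    have "F i \<noteq> 0" for i
    proof -
      have "peval (Poly_Mapping.single (Poly_Mapping.single (i, m i) 1) 1) x \<noteq> 0"
        by (rule x(2)) (auto simp: Q_def)
      then have "Poly_Mapping.lookup (F i) (m i) \<noteq> 0"
        unfolding var F[symmetric] by (simp add: coefficients_def)
      then show ?thesis by auto
    qed
    define u where "u i = proj_point (F i)" for i
    have u: "u \<in> param_space d"
      unfolding param_space_def hypersurfaces_def u_def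
    proof (intro CollectI allI)
      fix i
      show "\<exists>f. proj_point (F i) = proj_point f \<and> f \<noteq> 0 \<and> degree_le (d i) f"
        using \<open>F i \<noteq> 0\<close> degree_le_system_of[of d i x] unfolding F_def by blast
    qed
    have "\<exists>a. a \<noteq> 0 \<and> system u i = Poly_Mapping.map ((*) a) (F i)" for i
    proof -
      have "Poly_Mapping.map ((*) 1) (F i) \<in> u i"
        unfolding u_def proj_point_def by (intro CollectI exI[of _ 1] conjI refl) simp
      then have "system u i \<in> u i" unfolding system_def by (rule someI)
      then show ?thesis by (auto simp: u_def proj_point_def)
    qed
    then obtain \<kappa> where \<kappa>: "\<And>i. \<kappa> i \<noteq> 0" "\<And>i. system u i = Poly_Mapping.map ((*) (\<kappa> i)) (F i)" by metis
    then have "system u = rescale \<kappa> F" by (auto simp: rescale_def fun_eq_iff)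
    then have "peval g (homogeneous_coords u) \<noteq> 0" if "multihomogeneous g" "g \<in> Q" for g
      using multihomogeneous_torus_act[OF that(1) \<kappa>(1) x(2)[OF that(2)]]
      by (simp add: homogeneous_coords_eq coefficients_rescale F)
    then have D: "u \<in> ?D g" if "multihomogeneous g" "g \<in> Q" for g using that u by simp
    have "u \<in> A" if "A \<in> \<F>" for A
      using D[of "H A"] bspec[OF H that] that unfolding Q_def by blast
    then have "u \<in> U" using \<F>(4) by blast
    moreover have "u \<in> ?D (G P)" if "P \<in> \<P>" for P
      using D[of "G P"] G[OF that] that unfolding Q_def by blast
    ultimately have "u \<in> W" unfolding W_def by blast
    then show ?thesis by blast
  qed
  ultimately show ?thesis unfolding for_general_def by blast
qed

section \<open>Equations of degree one\<close>

definition linear_part :: "('c \<Rightarrow> ('n::finite) cpoly) \<Rightarrow> 'c \<Rightarrow> 'n \<Rightarrow> complex" where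
  "linear_part F i a = Poly_Mapping.lookup (F i) (Poly_Mapping.single a 1)"

lemma monoms_upto_1: "monoms_upto 1 = insert 0 (range (\<lambda>a :: 'n::finite. Poly_Mapping.single a 1))"
proof (intro equalityI subsetI)
  fix m :: "'n monom" assume "m \<in> monoms_upto 1"
  then have m: "(\<Sum>a\<in>UNIV. Poly_Mapping.lookup m a) \<le> 1"
    by (simp add: monoms_upto_def monom_degree_superset[of UNIV])
  show "m \<in> insert 0 (range (\<lambda>a. Poly_Mapping.single a 1))"
  proof (cases "m = 0")
    case False
    then obtain a where a: "Poly_Mapping.lookup m a \<noteq> 0" by (metis lookup_zero poly_mapping_eqI)
    have "Poly_Mapping.lookup m a + (\<Sum>b\<in>UNIV - {a}. Poly_Mapping.lookup m b) \<le> 1"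
      using m by (simp add: sum.remove[of UNIV a])
    with a have "Poly_Mapping.lookup m a = 1" "(\<Sum>b\<in>UNIV - {a}. Poly_Mapping.lookup m b) = 0" by linarith+
    then have "m = Poly_Mapping.single a 1"
      by (intro poly_mapping_eqI) (auto simp: lookup_single when_def)
    then show ?thesis by blast
  qed simp
qed (auto simp: monoms_upto_def monom_degree_def)

lemma sum_monoms_upto_1:
  "(\<Sum>m\<in>monoms_upto 1. f m) = f 0 + (\<Sum>a\<in>UNIV. f (Poly_Mapping.single (a :: 'n::finite) 1))"
proof -
  have "inj (\<lambda>a :: 'n. Poly_Mapping.single a (1 :: nat))"
    by (rule injI) (metis lookup_single_eq lookup_single_not_eq zero_neq_one)
  moreover have "0 \<notin> range (\<lambda>a :: 'n. Poly_Mapping.single a (1 :: nat))"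
    by (metis (no_types, lifting) imageE lookup_single_eq lookup_zero zero_neq_one)
  ultimately show ?thesis unfolding monoms_upto_1 by (simp add: sum.reindex)
qed

lemma jacobian_degree_one:
  assumes "degree_le 1 (F i)" shows "jacobian_matrix F x $ i $ a = linear_part F i a"
proof -
  have "jet (Some a) (Poly_Mapping.single b 1) x = (if b = a then 1 else 0)" for b
    by (auto simp: lookup_single when_def intro!: prod.neutral)
  then show ?thesis
    using jacobian_matrix_monoms_upto[where F=F and i=i, OF assms, of x a]
    by (simp only: sum_monoms_upto_1) (simp add: linear_part_def if_distrib[of "\<lambda>x. _ * x"] cong: if_cong)
qed

lemma peval_degree_one:
  fixes x :: "complex ^ 'n::finite"
  assumes "degree_le 1 (F i)"
  shows "peval (F i) (($) x) = Poly_Mapping.lookup (F i) 0 + (\<Sum>a\<in>UNIV. linear_part F i a * x $ a)"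
  using peval_monoms_upto[OF assms, of x] by (simp only: sum_monoms_upto_1) (simp add: linear_part_def mon_def)

text \<open>The Gram matrix of the gradients of the equations of degree one is nonsingular. Over the complex
  numbers this is stronger than their independence.\<close>

definition nondegenerate_linear_parts :: "('c::finite \<Rightarrow> nat) \<Rightarrow> ('c \<Rightarrow> ('n::finite) cpoly) \<Rightarrow> bool" where
  "nondegenerate_linear_parts d F \<longleftrightarrow> (\<forall>v. (\<forall>i. d i = 1 \<longrightarrow>
      (\<Sum>j\<in>{j. d j = 1}. v j * (\<Sum>a\<in>UNIV. linear_part F i a * linear_part F j a)) = 0) \<longrightarrow>
    (\<forall>i. d i = 1 \<longrightarrow> v i = 0))"

lemma augmented_jacobian_kernel:
  fixes F :: "'c::finite \<Rightarrow> ('n::finite) cpoly"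
  assumes "rank (augmented_jacobian F x z) \<le> CARD('c)"
  shows "\<exists>v. v \<noteq> 0 \<and> (\<forall>a. v $ None * (x - z) $ a + (\<Sum>i\<in>UNIV. v $ Some i * jacobian_matrix F x $ i $ a) = 0)"
proof -
  let ?A = "augmented_jacobian F x z"
  have "\<not> (\<exists>B. B ** ?A = mat 1)"
  proof
    assume "\<exists>B. B ** ?A = mat 1"
    then have "vec.span (rows ?A) = UNIV" by (simp add: matrix_left_invertible_span_rows_gen)
    then have "rank ?A = CARD('c option)"
      unfolding row_rank_def_gen by (metis vec.dim_span vec_dim_card)
    then show False using assms by simp
  qed
  then obtain v where v: "v \<noteq> 0" "?A *v v = 0" unfolding matrix_left_invertible_ker by blast
  have "v $ None * (x - z) $ a + (\<Sum>i\<in>UNIV. v $ Some i * jacobian_matrix F x $ i $ a) = 0" for a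
    using arg_cong[OF v(2), of "\<lambda>w. w $ a"]
    by (simp add: matrix_vector_mult_def augmented_jacobian_def sum_UNIV_option transpose_def mult.commute)
  with v(1) show ?thesis by blast
qed

text \<open>If only the equations of degree one entered into a kernel vector at \<open>x j\<close>, then \<open>x j - z\<close> would
  be a combination of their gradients. But it is orthogonal to them as well, \<open>z\<close> being an affine
  combination of points of their common zero set. For general equations it would thus be zero, and
  \<open>x j\<close> an affine combination of the points with all weights nonzero.\<close>

lemma bottleneck_is_critical:
  fixes F :: "'c::finite \<Rightarrow> ('n::finite) cpoly" and x :: "complex ^ 'n ^ 'k::finite"
  assumes nondeg: "nondegenerate_linear_parts d F" and deg: "\<And>i. degree_le (d i) (F i)"
    and k: "CARD('k) \<ge> 2"
    and xt: "(x, t) \<in> bottleneck_correspondence F" "(x, t) \<notin> degenerate_locus"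
  shows "(x, t) \<in> critical_configs d F"
proof -
  define z where "z = rho (x, t)"
  have t1: "(\<Sum>i\<in>UNIV. t $ i) = 1" and t0: "\<And>i. t $ i \<noteq> 0" and indep: "\<not> complex_affine_dependent x"
    and zero: "\<And>i j. peval (F i) (($) (x $ j)) = 0"
    and rank: "\<And>j. rank (augmented_jacobian F (x $ j) z) \<le> CARD('c)"
    using xt by (auto simp: bottleneck_correspondence_def degenerate_locus_def z_def Let_def zero_locus_def)
  have base: "base_config F x t"
    using xt(1) t1 t0 indep zero by (auto simp: base_config_def bottleneck_correspondence_def Let_def)
  have off: "x $ j \<noteq> z" for j
  proof
    assume j: "x $ j = z"
    define e where "e = t - axis j 1"
    have "\<exists>i. i \<noteq> j"
    proof (rule ccontr)
      assume "\<not> ?thesis"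
      then have "UNIV = {j}" by auto
      then show False using k by (metis One_nat_def Suc_1 card.empty card.insert empty_iff finite.emptyI not_less_eq_eq order_refl)
    qed
    then obtain i where "i \<noteq> j" by blast
    then have "e $ i \<noteq> 0" using t0[of i] by (simp add: e_def axis_def)
    then have "e \<noteq> 0" by auto
    moreover have "(\<Sum>i\<in>UNIV. e $ i) = 0" using t1 by (simp add: e_def axis_def sum_subtractf)
    moreover have "(\<Sum>i\<in>UNIV. e $ i *s x $ i) = 0"
    proof -
      have "(\<Sum>i\<in>UNIV. e $ i *s x $ i) = z - (\<Sum>i\<in>UNIV. (if i = j then 1 else 0) *s x $ i)"
        unfolding z_def rho_def by (simp add: e_def axis_def vector_sub_rdistrib sum_subtractf)
      also have "(\<Sum>i\<in>UNIV. (if i = j then 1 else 0) *s x $ i) = (\<Sum>i\<in>UNIV. if i = j then x $ j else 0)"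
        by (intro sum.cong) auto
      finally show ?thesis using j by simp
    qed
    ultimately show False using indep unfolding complex_affine_dependent_def by blast
  qed
  have "\<exists>v. (\<forall>a. v $ None * (x $ j - z) $ a + (\<Sum>i\<in>UNIV. v $ Some i * jacobian_matrix F (x $ j) $ i $ a) = 0) \<and>
      (\<exists>i. d i \<noteq> 1 \<and> v $ Some i \<noteq> 0)" for j
  proof -
    obtain v where v: "v \<noteq> 0"
      "\<And>a. v $ None * (x $ j - z) $ a + (\<Sum>i\<in>UNIV. v $ Some i * jacobian_matrix F (x $ j) $ i $ a) = 0"
      using augmented_jacobian_kernel[OF rank[of j]] by blast
    have "\<exists>i. d i \<noteq> 1 \<and> v $ Some i \<noteq> 0"
    proof (rule ccontr)
      assume "\<not> ?thesis"
      then have v0: "\<And>i. d i \<noteq> 1 \<Longrightarrow> v $ Some i = 0" by blast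
      let ?L = "{i. d i = 1}"
      have rel: "v $ None * (x $ j - z) $ a + (\<Sum>i\<in>?L. v $ Some i * linear_part F i a) = 0" for a
      proof -
        have "(\<Sum>i\<in>UNIV. v $ Some i * jacobian_matrix F (x $ j) $ i $ a) = (\<Sum>i\<in>?L. v $ Some i * linear_part F i a)"
          using jacobian_degree_one[where F=F, of _ "x $ j" a] deg
          by (intro sum.mono_neutral_cong_right) (auto simp: v0, metis)
        then show ?thesis using v(2)[of a] by simp
      qed
      have orth: "(\<Sum>a\<in>UNIV. linear_part F i a * (x $ j - z) $ a) = 0" if "d i = 1" for i
      proof -
        have *: "(\<Sum>a\<in>UNIV. linear_part F i a * x $ l $ a) = - Poly_Mapping.lookup (F i) 0" for l
          using peval_degree_one[of F i "x $ l"] deg[of i] that zero[of i l] by (simp add: eq_neg_iff_add_eq_0 add.commute)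
        have "(\<Sum>a\<in>UNIV. linear_part F i a * z $ a) = (\<Sum>l\<in>UNIV. t $ l * (\<Sum>a\<in>UNIV. linear_part F i a * x $ l $ a))"
          unfolding z_def rho_def sum_distrib_left by (subst sum.swap) (simp add: sum_component sum_distrib_left mult_ac)
        also have "\<dots> = - Poly_Mapping.lookup (F i) 0"
          unfolding * by (subst sum_distrib_right[symmetric]) (simp add: t1)
        finally show ?thesis using *[of j] by (simp add: right_diff_distrib sum_subtractf)
      qed
      have "(\<Sum>l\<in>?L. v $ Some l * (\<Sum>a\<in>UNIV. linear_part F i a * linear_part F l a)) = 0" if "d i = 1" for i
      proof -
        have "0 = (\<Sum>a\<in>UNIV. linear_part F i a * (v $ None * (x $ j - z) $ a + (\<Sum>l\<in>?L. v $ Some l * linear_part F l a)))"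
          unfolding rel by simp
        also have "\<dots> = v $ None * (\<Sum>a\<in>UNIV. linear_part F i a * (x $ j - z) $ a) +
            (\<Sum>a\<in>UNIV. \<Sum>l\<in>?L. v $ Some l * (linear_part F i a * linear_part F l a))"
          by (simp add: distrib_left sum.distrib sum_distrib_left mult_ac)
        also have "\<dots> = (\<Sum>a\<in>UNIV. \<Sum>l\<in>?L. v $ Some l * (linear_part F i a * linear_part F l a))"
          using orth[OF that] by simp
        finally show ?thesis by (subst (asm) sum.swap) (simp add: sum_distrib_left)
      qed
      then have vL: "v $ Some i = 0" if "d i = 1" for i
        using nondeg[unfolded nondegenerate_linear_parts_def, rule_format, of "\<lambda>i. v $ Some i" i] that by simp
      have "v $ q = 0" if "q \<noteq> None" for q using that vL v0 by (cases q) auto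
      then have "v $ None \<noteq> 0" using v(1) by (metis vec_eq_iff zero_index)
      moreover have "v $ None * (x $ j - z) $ a = 0" for a using rel[of a] vL by simp
      ultimately have "x $ j - z = 0" by (simp add: vec_eq_iff)
      then show False using off[of j] by simp
    qed
    with v(2) show ?thesis by blast
  qed
  then have "\<forall>j. \<exists>v. (\<forall>a. v $ None * (x $ j - z) $ a + (\<Sum>i\<in>UNIV. v $ Some i * jacobian_matrix F (x $ j) $ i $ a) = 0) \<and>
      (\<exists>i. d i \<noteq> 1 \<and> v $ Some i \<noteq> 0)" by blast
  from choice[OF this] obtain v where v: "\<And>j a. v j $ None * (x $ j - z) $ a + (\<Sum>i\<in>UNIV. v j $ Some i * jacobian_matrix F (x $ j) $ i $ a) = 0"
    "\<And>j. \<exists>i. d i \<noteq> 1 \<and> v j $ Some i \<noteq> 0" by blast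
  then have "multiplier_eq F x t (\<lambda>j q. v j $ q)" by (simp add: multiplier_eq_def z_def)
  then show ?thesis unfolding critical_configs_def using base v(2) by blast
qed

text \<open>The polynomial is the Gram determinant. It does not vanish at \<open>c\<close> distinct coordinate functions,
  which exist as \<open>c \<le> n\<close>.\<close>

lemma generic_nondegenerate_linear_parts:
  fixes d :: "'c::finite \<Rightarrow> nat"
  assumes d: "\<And>i. 1 \<le> d i" and cn: "CARD('c) \<le> CARD('n::finite)"
  shows "generic d (nondegenerate_linear_parts d :: ('c \<Rightarrow> 'n cpoly) \<Rightarrow> bool)"
proof -
  \<comment> \<open>Equations of higher degree contribute rows and columns of the identity matrix, so that the
    matrix can be indexed by all equations.\<close>
  define A where "A X = (\<chi> i j. if d i = 1 \<and> d j = 1 then \<Sum>a\<in>UNIV. X (i, Poly_Mapping.single a 1) * X (j, Poly_Mapping.single a 1)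
    else if i = j then 1 else 0 :: complex ^ 'c ^ 'c)" for X :: "'c \<times> 'n monom \<Rightarrow> complex"
  have index: "(i, Poly_Mapping.single a 1) \<in> coefficient_index d" for i and a :: 'n
    using d[of i] by (simp add: coefficient_index_def monoms_upto_def monom_degree_def)
  have "(\<lambda>X. det (A X)) \<in> alg ((\<lambda>v X. X v) ` coefficient_index d)"
    unfolding det_def
  proof (intro alg_sum alg_mult alg_const alg_prod)
    fix i j
    have X: "(\<lambda>X. X (i, Poly_Mapping.single a 1)) \<in> alg ((\<lambda>v X. X v) ` (coefficient_index d :: ('c \<times> 'n monom) set))" for i and a :: 'n
      by (rule alg_gen) (use index in blast)
    show "(\<lambda>X. A X $ i $ j) \<in> alg ((\<lambda>v X. X v) ` (coefficient_index d :: ('c \<times> 'n monom) set))"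
      by (cases "d i = 1 \<and> d j = 1"; cases "i = j") (auto simp: A_def intro!: alg_sum alg_mult X[simplified])
  qed
  then obtain D where "(\<lambda>X. det (A X)) \<in> polys ((\<lambda>v X. X v) ` coefficient_index d) D" by (auto simp: alg_def)
  from polys_imp_peval[OF this] obtain q where q: "\<And>X. det (A X) = peval q X"
    "\<forall>m\<in>Poly_Mapping.keys q. Poly_Mapping.keys m \<subseteq> coefficient_index d" by auto
  show ?thesis
  proof (rule generic_if_rescale_invariant)
    obtain \<sigma> :: "'c \<Rightarrow> 'n" where \<sigma>: "inj \<sigma>"
      using cn card_le_inj[of "UNIV :: 'c set" "UNIV :: 'n set"] by auto
    define X where "X = (\<lambda>(i, m). if m = Poly_Mapping.single (\<sigma> i) (1 :: nat) then 1 else (0 :: complex))"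
    have single_eq: "Poly_Mapping.single a (1 :: nat) = Poly_Mapping.single b 1 \<longleftrightarrow> a = b" for a b :: 'n
      by (metis lookup_single_eq lookup_single_not_eq zero_neq_one)
    have X: "X (i, Poly_Mapping.single a 1) = (if a = \<sigma> i then 1 else 0)" for i a
      unfolding X_def case_prod_conv single_eq ..
    have "A X = mat 1"
      unfolding A_def X using \<sigma> by (auto simp: vec_eq_iff mat_def inj_eq if_distrib[of "\<lambda>x. _ * x"] cong: if_cong)
    then have "peval q X = 1" by (simp flip: q(1))
    then show "q \<noteq> 0" by auto
    show "Poly_Mapping.keys m \<subseteq> coefficient_index d" if "m \<in> Poly_Mapping.keys q" for m using q(2) that by blast
  next
    fix F :: "'c \<Rightarrow> 'n cpoly" assume "peval q (coefficients F) \<noteq> 0"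
    then have "invertible (A (coefficients F))" by (simp add: invertible_det_nz q(1))
    then have ker: "\<And>v. A (coefficients F) *v v = 0 \<Longrightarrow> v = 0"
      using matrix_left_invertible_ker[of "A (coefficients F)"] by (auto simp: invertible_def)
    show "nondegenerate_linear_parts d F"
      unfolding nondegenerate_linear_parts_def
    proof (intro allI impI)
      fix v i
      assume v: "\<forall>i. d i = 1 \<longrightarrow> (\<Sum>j\<in>{j. d j = 1}. v j * (\<Sum>a\<in>UNIV. linear_part F i a * linear_part F j a)) = 0"
        and i: "d i = 1"
      define v' where "v' = (\<chi> i. if d i = 1 then v i else 0)"
      have "(A (coefficients F) *v v') $ i = 0" for i
      proof (cases "d i = 1")
        case True
        have "(A (coefficients F) *v v') $ i = (\<Sum>j\<in>UNIV. if d j = 1 then v j * (\<Sum>a\<in>UNIV. linear_part F i a * linear_part F j a) else 0)"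
          unfolding matrix_vector_mult_def vec_lambda_beta
          using True by (intro sum.cong) (auto simp: A_def v'_def linear_part_def coefficients_def)
        also have "\<dots> = (\<Sum>j\<in>{j. d j = 1}. v j * (\<Sum>a\<in>UNIV. linear_part F i a * linear_part F j a))"
          by (simp add: sum.If_cases)
        finally show ?thesis using v True by simp
      next
        case False
        then show ?thesis unfolding matrix_vector_mult_def vec_lambda_beta
          by (intro sum.neutral) (auto simp: A_def v'_def)
      qed
      then have "A (coefficients F) *v v' = 0" unfolding vec_eq_iff by simp
      then have "v' = 0" by (rule ker)
      then have "v' $ i = 0" by simp
      then show "v i = 0" using i by (simp add: v'_def)
    qed
  next
    fix F :: "'c \<Rightarrow> 'n cpoly" and \<kappa> :: "'c \<Rightarrow> complex"
    assume \<kappa>: "\<And>i. \<kappa> i \<noteq> 0" and "nondegenerate_linear_parts d (rescale \<kappa> F)"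
    note nd = this(2)[unfolded nondegenerate_linear_parts_def, rule_format]
    have lin: "linear_part (rescale \<kappa> F) i a = \<kappa> i * linear_part F i a" for i a
      by (simp add: linear_part_def lookup_rescale)
    show "nondegenerate_linear_parts d F"
      unfolding nondegenerate_linear_parts_def
    proof (intro allI impI)
      fix v i
      assume v: "\<forall>i. d i = 1 \<longrightarrow> (\<Sum>j\<in>{j. d j = 1}. v j * (\<Sum>a\<in>UNIV. linear_part F i a * linear_part F j a)) = 0"
        and i: "d i = 1"
      have "v i / \<kappa> i = 0"
      proof (rule nd[of "\<lambda>i. v i / \<kappa> i", OF _ i])
        fix i assume i: "d i = 1"
        have "(\<Sum>j\<in>{j. d j = 1}. v j / \<kappa> j * (\<Sum>a\<in>UNIV. linear_part (rescale \<kappa> F) i a * linear_part (rescale \<kappa> F) j a))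
          = \<kappa> i * (\<Sum>j\<in>{j. d j = 1}. v j * (\<Sum>a\<in>UNIV. linear_part F i a * linear_part F j a))"
          unfolding lin sum_distrib_left using \<kappa> by (intro sum.cong) (auto simp: field_simps)
        then show "(\<Sum>j\<in>{j. d j = 1}. v j / \<kappa> j * (\<Sum>a\<in>UNIV. linear_part (rescale \<kappa> F) i a * linear_part (rescale \<kappa> F) j a)) = 0"
          using v i by simp
      qed
      then show "v i = 0" using \<kappa>[of i] by simp
    qed
  qed
qed

section \<open>Finiteness for general systems\<close>

lemma critical_configs_rescale:
  fixes F :: "'c::finite \<Rightarrow> ('n::finite) cpoly"
  assumes deg: "\<And>i. degree_le (d i) (F i)" and \<kappa>: "\<And>i. \<kappa> i \<noteq> 0"
  shows "critical_configs d F \<subseteq> (critical_configs d (rescale \<kappa> F) :: ((complex ^ 'n ^ 'k::finite) \<times> _) set)"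
proof clarify
  fix x :: "complex ^ 'n ^ 'k" and t assume "(x, t) \<in> critical_configs d F"
  then obtain w where base: "base_config F x t" and mult: "multiplier_eq F x t w"
    and w: "\<forall>j. \<exists>i. d i \<noteq> 1 \<and> w j (Some i) \<noteq> 0" by (auto simp: critical_configs_def)
  have jac: "jacobian_matrix (rescale \<kappa> F) y $ i $ a = \<kappa> i * jacobian_matrix F y $ i $ a" for y i a
    using jacobian_matrix_monoms_upto[where F=F and i=i, OF deg, of y a]
      jacobian_matrix_monoms_upto[where F="rescale \<kappa> F" and i=i, OF degree_le_rescale[where F=F and i=i, OF deg], of y a]
    by (simp add: lookup_rescale sum_distrib_left mult.assoc del: jet.simps)
  have "peval (rescale \<kappa> F i) (($) y) = \<kappa> i * peval (F i) (($) y)" for i and y :: "complex ^ 'n"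
    using peval_monoms_upto[where f="F i", OF deg, of y]
      peval_monoms_upto[where f="rescale \<kappa> F i", OF degree_le_rescale[where F=F and i=i, OF deg], of y]
    by (simp add: lookup_rescale sum_distrib_left mult.assoc)
  then have "base_config (rescale \<kappa> F) x t" using base by (simp add: base_config_def)
  moreover have "multiplier_eq (rescale \<kappa> F) x t (\<lambda>j q. case q of None \<Rightarrow> w j None | Some i \<Rightarrow> w j (Some i) / \<kappa> i)"
    using mult \<kappa> by (simp add: multiplier_eq_def jac)
  moreover have "\<forall>j. \<exists>i. d i \<noteq> 1 \<and> (case Some i of None \<Rightarrow> w j None | Some i \<Rightarrow> w j (Some i) / \<kappa> i) \<noteq> 0"
    using w \<kappa> by simp
  ultimately show "(x, t) \<in> critical_configs d (rescale \<kappa> F)" unfolding critical_configs_def by blast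
qed

lemma generic_finite_coordinate:
  fixes d :: "'c::finite \<Rightarrow> nat" and h :: "(complex ^ 'n::finite ^ 'k::finite) \<times> (complex ^ 'k) \<Rightarrow> complex"
  assumes "\<And>i. 1 \<le> d i \<and> d i \<noteq> 2" "h \<in> config_coordinates"
  shows "generic d (\<lambda>F. finite (h ` critical_configs d F))"
proof -
  from generically_finite_coordinate[of d h, OF assms]
  obtain q where q: "q \<noteq> 0" "\<forall>m\<in>Poly_Mapping.keys q. Poly_Mapping.keys m \<subseteq> coefficient_index d"
    "\<forall>F. (\<forall>i. degree_le (d i) (F i)) \<longrightarrow> peval q (coefficients F) \<noteq> 0 \<longrightarrow> finite (h ` critical_configs d F)"
    by (elim exE conjE)
  show ?thesis
  proof (rule generic_if_rescale_invariant[OF q(1)])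
    fix F :: "'c \<Rightarrow> 'n cpoly" and \<kappa> :: "'c \<Rightarrow> complex"
    assume "\<And>i. degree_le (d i) (F i)" "\<And>i. \<kappa> i \<noteq> 0" "finite (h ` critical_configs d (rescale \<kappa> F))"
    then show "finite (h ` critical_configs d F)"
      by (meson critical_configs_rescale finite_subset image_mono)
  qed (use q(2,3) in auto)
qed

lemma finite_if_coordinates_finite:
  fixes C :: "((complex ^ 'n::finite ^ 'k::finite) \<times> (complex ^ 'k)) set"
  assumes "\<And>h. h \<in> config_coordinates \<Longrightarrow> finite (h ` C)"
  shows "finite C"
proof -
  let ?H = "config_coordinates :: ((complex ^ 'n ^ 'k) \<times> (complex ^ 'k) \<Rightarrow> complex) set"
  let ?f = "\<lambda>p. \<lambda>h\<in>?H. h p"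
  have "finite (PiE ?H (\<lambda>h. h ` C))"
    using assms by (intro finite_PiE) (auto simp: config_coordinates_def)
  then have "finite (?f ` C)" by (rule rev_finite_subset) auto
  moreover have "inj_on ?f C"
  proof (rule inj_onI)
    fix p p' assume "?f p = ?f p'"
    then have eq: "h p = h p'" if "h \<in> ?H" for h using that by (metis restrict_apply')
    obtain x t x' t' where [simp]: "p = (x, t)" "p' = (x', t')" by fastforce
    have "x $ j $ a = x' $ j $ a" for j a
      using eq[unfolded config_coordinates_def, OF UnI1, OF rangeI[of _ "(j, a)"]] by simp
    moreover have "t $ j = t' $ j" for j
      using eq[unfolded config_coordinates_def, OF UnI2, OF rangeI[of _ j]] by simp
    ultimately show "p = p'" by (simp add: vec_eq_iff)
  qed
  ultimately show ?thesis by (rule finite_imageD)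
qed

theorem theorem4p15:
  fixes d :: "'c::finite \<Rightarrow> nat"
    and U :: "('c \<Rightarrow> ('n::finite) cpoly set) set"
  assumes "CARD('c) \<le> CARD('n)"
    and "CARD('k::finite) \<ge> 2"
    and "\<forall>i. d i \<ge> 1 \<and> d i \<noteq> 2"
    and "openin (param_zariski d) U" and "U \<noteq> {}"
    and "\<forall>u\<in>U. complete_intersection (system u)"
  shows "for_general (param_zariski d) U
           (\<lambda>u. finite (algebraic_bottlenecks TYPE('k) (system u)))
       \<and> for_general (param_zariski d) U
           (\<lambda>u. finite (eta_fiber U u - (degenerate_locus :: ((complex ^ 'n ^ 'k) \<times> (complex ^ 'k)) set)))"
proof -
  let ?\<Gamma> = "degenerate_locus :: ((complex ^ 'n ^ 'k) \<times> (complex ^ 'k)) set"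
  let ?H = "config_coordinates :: ((complex ^ 'n ^ 'k) \<times> (complex ^ 'k) \<Rightarrow> complex) set"
  let ?P = "insert (nondegenerate_linear_parts d) ((\<lambda>h F. finite (h ` critical_configs d F)) ` ?H)"
  have d: "\<And>i. 1 \<le> d i \<and> d i \<noteq> 2" using assms(3) by simp
  have "for_general (param_zariski d) U (\<lambda>u. \<forall>P\<in>?P. P (system u))"
  proof (rule for_general_generic[OF assms(4,5)])
    show "finite ?P" by (simp add: config_coordinates_def)
    show "generic d P" if "P \<in> ?P" for P :: "('c \<Rightarrow> 'n cpoly) \<Rightarrow> bool"
      using that
    proof (elim insertE imageE)
      assume "P = nondegenerate_linear_parts d"
      then show ?thesis using generic_nondegenerate_linear_parts[of d] assms(1) d by simp
    next
      fix h assume "h \<in> ?H" "P = (\<lambda>F. finite (h ` critical_configs d F))"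
      then show ?thesis using generic_finite_coordinate[of d h] d by simp
    qed
  qed
  then obtain W where W: "openin (subtopology (param_zariski d) U) W" "W \<noteq> {}"
    and generic: "\<forall>u\<in>W. \<forall>P\<in>?P. P (system u)"
    unfolding for_general_def by (elim exE conjE)
  have "W \<subseteq> U" using openin_subset[OF W(1)] by (simp add: topspace_subtopology)
  have "U \<subseteq> param_space d" using openin_subset[OF assms(4)] by (auto simp: param_zariski_def)
  have fin: "finite (bottleneck_correspondence (system u) - ?\<Gamma>)" if u: "u \<in> W" for u
  proof (rule finite_subset)
    have "u \<in> param_space d" using u \<open>W \<subseteq> U\<close> \<open>U \<subseteq> param_space d\<close> by blast
    moreover have "nondegenerate_linear_parts d (system u)" by (rule generic[rule_format, OF u]) simp
    ultimately show "bottleneck_correspondence (system u) - ?\<Gamma> \<subseteq> critical_configs d (system u)"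
      using bottleneck_is_critical[OF _ _ assms(2)] system_in_proj_point(2) by fastforce
    show "finite (critical_configs d (system u) :: ((complex ^ 'n ^ 'k) \<times> _) set)"
    proof (rule finite_if_coordinates_finite)
      fix h assume "h \<in> ?H"
      then show "finite (h ` critical_configs d (system u))"
        by (intro generic[rule_format, OF u, of "\<lambda>F. finite (h ` critical_configs d F)"] insertI2 imageI)
    qed
  qed
  have "finite (algebraic_bottlenecks TYPE('k) (system u))" if "u \<in> W" for u
    using fin[OF that] by (simp add: algebraic_bottlenecks_def)
  moreover have "finite (eta_fiber U u - ?\<Gamma>)" if "u \<in> W" for u
  proof -
    have "eta_fiber U u - ?\<Gamma> \<subseteq> bottleneck_correspondence (system u) - ?\<Gamma>"
      by (auto simp: eta_fiber_def bottleneck_incidence_def)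
    then show ?thesis using fin[OF that] by (rule finite_subset)
  qed
  ultimately show ?thesis unfolding for_general_def using W(1,2) by blast
qed

end
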